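(* Let $K$ be a field, $E$ an elliptic curve over $K$ given by a Weierstrass equation, and $m\geq 4$ an integer coprime to $\mathrm{char}(K)$ when $\mathrm{char}(K)>0$. Let $P_1=(x_1,y_1)$, $P_2=(x_2,y_2)$ be a $\mathbb{Z}/m\mathbb{Z}$-basis of $E[m]$, $\zeta_m:=e_m(P_1,P_2)$, $K_m:=K(E[m])$ and $F:=K(x_1,\zeta_m,y_1,y_2)$. If $m$ is odd, then $K_m=F$. If $m$ is even, then $K_m\neq F$ if and only if $[K_m:F]=2$ and $\mathrm{Gal}(K_m/F)$ is generated by the element acting on $E[m]$ by sending $P_2$ to $\frac{m}{2}P_1+P_2$. In particular, if $m$ is even then $K(E[m/2])\subseteq F$.
   Context: $E[n]$ is the $n$-torsion subgroup of $E(\overline{K})$; $K(E[n])$ is the field obtained from $K$ by adjoining the coordinates of all points of $E[n]$; $e_m$ is the Weil pairing on $E[m]$, so $\zeta_m$ is a primitive $m$-th root of unity. *)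

theory Defs
  imports
    "HOL-Algebra.Algebraic_Closure_Type"
    "HOL-Algebra.Generated_Fields"
    "HOL-Algebra.Generated_Groups"
    "HOL-Algebra.Bij"
begin

section \<open>Weierstrass curves and their group law\<close>

text \<open>The equation \<open>y\<^sup>2 + a\<^sub>1 x y + a\<^sub>3 y = x\<^sup>3 + a\<^sub>2 x\<^sup>2 + a\<^sub>4 x + a\<^sub>6\<close>.\<close>

datatype 'a weierstrass =
  Weierstrass (wa1: 'a) (wa2: 'a) (wa3: 'a) (wa4: 'a) (wa6: 'a)

definition discriminant :: "'a::field weierstrass \<Rightarrow> 'a" where
  "discriminant E =
     (let b2 = wa1 E ^ 2 + 4 * wa2 E;
          b4 = 2 * wa4 E + wa1 E * wa3 E;
          b6 = wa3 E ^ 2 + 4 * wa6 E;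
          b8 = wa1 E ^ 2 * wa6 E + 4 * wa2 E * wa6 E - wa1 E * wa3 E * wa4 E
                 + wa2 E * wa3 E ^ 2 - wa4 E ^ 2
      in - (b2 ^ 2) * b8 - 8 * b4 ^ 3 - 27 * b6 ^ 2 + 9 * b2 * b4 * b6)"

definition elliptic_curve :: "'a::field weierstrass \<Rightarrow> bool" where
  "elliptic_curve E \<longleftrightarrow> discriminant E \<noteq> 0"

datatype 'a point = Infinity | Affine 'a 'a

fun on_curve :: "'a::field weierstrass \<Rightarrow> 'a point \<Rightarrow> bool" where
  "on_curve E Infinity \<longleftrightarrow> True"
| "on_curve E (Affine x y) \<longleftrightarrow>
     y ^ 2 + wa1 E * x * y + wa3 E * y = x ^ 3 + wa2 E * x ^ 2 + wa4 E * x + wa6 E"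

text \<open>
  In the second branch \<open>l\<close> is the slope of the chord, respectively the tangent, through the two
  points; its intercept is \<open>y\<^sub>1 - l x\<^sub>1\<close>.
\<close>

fun ec_add :: "'a::field weierstrass \<Rightarrow> 'a point \<Rightarrow> 'a point \<Rightarrow> 'a point" where
  "ec_add E Infinity Q = Q"
| "ec_add E P Infinity = P"
| "ec_add E (Affine x1 y1) (Affine x2 y2) =
     (if x1 = x2 \<and> y1 + y2 + wa1 E * x2 + wa3 E = 0 then Infinity
      else
        let l = (if x1 = x2
                 then (3 * x1 ^ 2 + 2 * wa2 E * x1 + wa4 E - wa1 E * y1)
                        / (2 * y1 + wa1 E * x1 + wa3 E)
                 else (y2 - y1) / (x2 - x1));
            x3 = l ^ 2 + wa1 E * l - wa2 E - x1 - x2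
        in Affine x3 (- (l + wa1 E) * x3 - (y1 - l * x1) - wa3 E))"

definition ec_mult :: "'a::field weierstrass \<Rightarrow> nat \<Rightarrow> 'a point \<Rightarrow> 'a point" where
  "ec_mult E n P = (ec_add E P ^^ n) Infinity"

definition base_change :: "'k::field weierstrass \<Rightarrow> 'k alg_closure weierstrass" where
  "base_change E = map_weierstrass to_ac E"

definition torsion :: "'k::field weierstrass \<Rightarrow> nat \<Rightarrow> 'k alg_closure point set" where
  "torsion E n = {P. on_curve (base_change E) P \<and> ec_mult (base_change E) n P = Infinity}"

text \<open>Coefficients in \<open>\<int>/m\<int>\<close> are represented by natural numbers.\<close>

definition torsion_basis ::
    "'k::field weierstrass \<Rightarrow> nat \<Rightarrow> 'k alg_closure point \<Rightarrow> 'k alg_closure point \<Rightarrow> bool" where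
  "torsion_basis E m P1 P2 \<longleftrightarrow>
     (let C = base_change E in
        P1 \<in> torsion E m \<and> P2 \<in> torsion E m \<and>
        (\<forall>P\<in>torsion E m. \<exists>a b. P = ec_add C (ec_mult C a P1) (ec_mult C b P2)) \<and>
        (\<forall>a b. ec_add C (ec_mult C a P1) (ec_mult C b P2) = Infinity \<longrightarrow> m dvd a \<and> m dvd b))"


section \<open>Rational functions and their divisors\<close>

text \<open>
  Elements of \<open>'a poly poly\<close> are polynomials in \<open>Y\<close> whose coefficients are polynomials in \<open>X\<close>.
  A rational function on the curve is represented by a pair (numerator, denominator) of such
  polynomials, the denominator not being divisible by the Weierstrass polynomial; two pairs
  represent the same function iff they are related by \<open>ratfun_eq\<close>.
\<close>

definition weier_poly :: "'a::field weierstrass \<Rightarrow> 'a poly poly" where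
  "weier_poly E = [: - [:wa6 E, wa4 E, wa2 E, 1:], [:wa3 E, wa1 E:], 1 :]"

type_synonym 'a ratfun = "'a poly poly \<times> 'a poly poly"

definition is_ratfun :: "'a::field weierstrass \<Rightarrow> 'a ratfun \<Rightarrow> bool" where
  "is_ratfun E f \<longleftrightarrow> \<not> weier_poly E dvd snd f"

definition ratfun_eq :: "'a::field weierstrass \<Rightarrow> 'a ratfun \<Rightarrow> 'a ratfun \<Rightarrow> bool" where
  "ratfun_eq E f g \<longleftrightarrow> weier_poly E dvd (fst f * snd g - fst g * snd f)"

definition ratfun_mult :: "'a::field ratfun \<Rightarrow> 'a ratfun \<Rightarrow> 'a ratfun" where
  "ratfun_mult f g = (fst f * fst g, snd f * snd g)"

definition ratfun_power :: "'a::field ratfun \<Rightarrow> nat \<Rightarrow> 'a ratfun" where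
  "ratfun_power f n = (fst f ^ n, snd f ^ n)"

definition eval2 :: "'a::field poly poly \<Rightarrow> 'a \<Rightarrow> 'a \<Rightarrow> 'a" where
  "eval2 p x y = poly (poly p [:y:]) x"

definition total_degree_le :: "'a::field poly poly \<Rightarrow> nat \<Rightarrow> bool" where
  "total_degree_le p N \<longleftrightarrow>
     (\<forall>i j. Polynomial.coeff (Polynomial.coeff p j) i \<noteq> 0 \<longrightarrow> i + j \<le> N)"

text \<open>
  \<open>has_value E f P v\<close>: the function \<open>f\<close> is regular at \<open>P\<close> and takes the value \<open>v\<close> there, i.e.
  \<open>f\<close> is a quotient of two homogeneous forms of the same degree \<open>N\<close> in \<open>X, Y, Z\<close>, the
  denominator not vanishing at \<open>P\<close>. Forms of degree \<open>N\<close> correspond to polynomials in \<open>X, Y\<close> of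
  total degree at most \<open>N\<close>, and the value of the form at the point \<open>(0 : 1 : 0)\<close> at infinity is
  the coefficient of \<open>Y\<^sup>N\<close>.
\<close>

fun has_value :: "'a::field weierstrass \<Rightarrow> 'a ratfun \<Rightarrow> 'a point \<Rightarrow> 'a \<Rightarrow> bool" where
  "has_value E f (Affine x y) v \<longleftrightarrow>
     (\<exists>a b. is_ratfun E (a, b) \<and> ratfun_eq E f (a, b) \<and>
        eval2 b x y \<noteq> 0 \<and> v = eval2 a x y / eval2 b x y)"
| "has_value E f Infinity v \<longleftrightarrow>
     (\<exists>a b N. is_ratfun E (a, b) \<and> ratfun_eq E f (a, b) \<and>
        total_degree_le a N \<and> total_degree_le b N \<and>
        Polynomial.coeff (Polynomial.coeff b N) 0 \<noteq> 0 \<and>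
        v = Polynomial.coeff (Polynomial.coeff a N) 0 / Polynomial.coeff (Polynomial.coeff b N) 0)"

text \<open>A uniformizer at \<open>P\<close> is a generator of the maximal ideal of the local ring at \<open>P\<close>.\<close>

definition uniformizer :: "'a::field weierstrass \<Rightarrow> 'a point \<Rightarrow> 'a ratfun \<Rightarrow> bool" where
  "uniformizer E P t \<longleftrightarrow>
     is_ratfun E t \<and> has_value E t P 0 \<and>
     (\<forall>f. is_ratfun E f \<and> has_value E f P 0 \<longrightarrow>
        (\<exists>g v. is_ratfun E g \<and> has_value E g P v \<and> ratfun_eq E f (ratfun_mult t g)))"

text \<open>
  \<open>has_order E f P n\<close> says \<open>ord\<^sub>P f = n\<close>, i.e. \<open>f = t\<^sup>n u\<close> with \<open>t\<close> a uniformizer and \<open>u\<close> a unit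
  at \<open>P\<close>; the integer exponent \<open>n\<close> is written as a difference \<open>l - k\<close>.
\<close>

definition has_order :: "'a::field weierstrass \<Rightarrow> 'a ratfun \<Rightarrow> 'a point \<Rightarrow> int \<Rightarrow> bool" where
  "has_order E f P n \<longleftrightarrow>
     (\<exists>t u v k l. uniformizer E P t \<and> is_ratfun E u \<and> has_value E u P v \<and> v \<noteq> 0 \<and>
        n = int l - int k \<and>
        ratfun_eq E (ratfun_mult f (ratfun_power t k)) (ratfun_mult u (ratfun_power t l)))"

definition has_divisor :: "'a::field weierstrass \<Rightarrow> 'a ratfun \<Rightarrow> ('a point \<Rightarrow> int) \<Rightarrow> bool" where
  "has_divisor E f D \<longleftrightarrow> is_ratfun E f \<and> (\<forall>P. on_curve E P \<longrightarrow> has_order E f P (D P))"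


section \<open>The Weil pairing\<close>

text \<open>
  Let \<open>g\<close> be a function with divisor \<open>[m]\<^sup>*(T) - [m]\<^sup>*(O) = \<Sum>\<^bsub>R \<in> E[m]\<^esub> ((T' + R) - (R))\<close>, where
  \<open>m T' = T\<close>. (The map \<open>[m]\<close> is unramified when \<open>m\<close> is prime to the characteristic.) Then
  \<open>e\<^sub>m(S, T) = g(Q + S) / g(Q)\<close> for any point \<open>Q\<close> at which both values are defined and nonzero.
  The definition is meaningful over algebraically closed fields.
\<close>

definition weil_function :: "'a::field weierstrass \<Rightarrow> nat \<Rightarrow> 'a point \<Rightarrow> 'a ratfun \<Rightarrow> bool" where
  "weil_function E m T g \<longleftrightarrow>
     has_divisor E g (\<lambda>P. of_bool (ec_mult E m P = T) - of_bool (ec_mult E m P = Infinity))"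

definition weil_pairing :: "'a::field weierstrass \<Rightarrow> nat \<Rightarrow> 'a point \<Rightarrow> 'a point \<Rightarrow> 'a" where
  "weil_pairing E m S T =
     (THE z. \<exists>g Q v w. weil_function E m T g \<and> on_curve E Q \<and>
        has_value E g Q v \<and> v \<noteq> 0 \<and> has_value E g (ec_add E Q S) w \<and> w \<noteq> 0 \<and> z = w / v)"


section \<open>Subfields of the algebraic closure and Galois groups\<close>

abbreviation closure_ring :: "'k::field alg_closure ring" where
  "closure_ring \<equiv> ring_of_type_algebra"

definition adjoin :: "'k::field alg_closure set \<Rightarrow> 'k alg_closure set" where
  "adjoin S = generate_field closure_ring (range to_ac \<union> S)"

definition coordinates :: "'a point set \<Rightarrow> 'a set" where
  "coordinates S = (\<Union>P\<in>S. set_point P)"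

definition torsion_field :: "'k::field weierstrass \<Rightarrow> nat \<Rightarrow> 'k alg_closure set" where
  "torsion_field E n = adjoin (coordinates (torsion E n))"

text \<open>
  \<open>galois_group L F\<close> is the group of field automorphisms of \<open>L\<close> fixing \<open>F\<close> pointwise, under
  composition; as in \<^const>\<open>Bij\<close>, its elements are extensional functions.
\<close>

definition galois_group ::
    "'k::field alg_closure set \<Rightarrow> 'k alg_closure set \<Rightarrow> ('k alg_closure \<Rightarrow> 'k alg_closure) monoid"
  where
  "galois_group L F = (BijGroup L)
     \<lparr>carrier := {\<sigma> \<in> Bij L.
        \<sigma> \<in> ring_iso (closure_ring\<lparr>carrier := L\<rparr>) (closure_ring\<lparr>carrier := L\<rparr>) \<and>
        (\<forall>x\<in>F. \<sigma> x = x)}\<rparr>"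

end

theory Submission
  imports Defs
begin

text \<open>
  An automorphism \<open>\<sigma>\<close> of the algebraic closure over \<open>F\<close> fixes \<open>P\<^sub>1\<close> and \<open>\<zeta>\<^sub>m\<close>, so by the
  non-degeneracy of the Weil pairing \<open>\<sigma> P\<^sub>2 = a P\<^sub>1 + P\<^sub>2\<close> for some \<open>a\<close>. All conjugates of \<open>P\<^sub>2\<close> lie
  on the line \<open>y = y\<^sub>2\<close>, which meets the curve in at most three points. If \<open>m\<close> does not divide \<open>2 a\<close>, then
  \<open>P\<^sub>2\<close>, \<open>\<sigma> P\<^sub>2\<close> and \<open>\<sigma>\<^sup>2 P\<^sub>2\<close> are distinct and collinear, hence \<open>3 P\<^sub>2 + 3 a P\<^sub>1 = O\<close>, which is
  impossible for \<open>m \<ge> 4\<close>. So \<open>\<sigma> P\<^sub>2\<close> is \<open>P\<^sub>2\<close> or \<open>(m/2) P\<^sub>1 + P\<^sub>2\<close>. The minimal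
  polynomial of \<open>x\<^sub>2\<close> over \<open>F\<close> has no repeated root: otherwise the line would be tangent at \<open>P\<^sub>2\<close>.

  The properties of the Weil pairing are obtained from the action of translations on the function
  field: translation by \<open>S \<in> E[m]\<close> multiplies a function \<open>g\<close> with divisor \<open>[m]\<^sup>*(T) - [m]\<^sup>*(O)\<close> by
  the constant \<open>e\<^sub>m(S, T)\<close>.
\<close>

section \<open>Evaluation of polynomials in two variables\<close>

text \<open>Automorphisms of the closure detect an element only up to purely inseparable extensions,
  so being fixed by all of them does not by itself put \<open>x2\<close> into \<open>F\<close>;
  tangency of the line is the obstruction. If the minimal polynomial of \<open>x2\<close> has degree
  three, a repeated root collapses all three roots and makes the line a flex tangent, so 3 P2 = O.
  In degree two a repeated root gives a horizontal tangent at P2 and puts 2 \<open>x2\<close> into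
  \<open>F\<close>; dividing by 2 settles every characteristic except 2, and there m is odd, so that
  P2 is a multiple of 2 P2, which is defined over \<open>F\<close>. The assertion on E[m/2] comes
  from the third point of the line: its abscissa is \<open>- a2 - (x2 + r)\<close>, with
  \<open>r\<close> the conjugate of \<open>x2\<close>, hence it lies in \<open>F\<close>, and so do
  the coordinates of 2 P2. The pairing rests on divisors alone. Associativity of addition is the
  absence of functions with a single simple zero and a single simple pole. Surjectivity of [m]
  follows from finiteness of E[m], because a nonconstant function takes every value. That
  \<open>\<zeta>\<close> lies in \<open>Km\<close> combines Galois equivariance of the pairing with
  separability of X^m - 1.\<close>

locale rhom =
  fixes h :: "'a::comm_ring_1 \<Rightarrow> 'b::comm_ring_1"
  assumes add: "h (x + y) = h x + h y"
    and mult: "h (x * y) = h x * h y"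
    and one: "h 1 = 1"
begin

lemma zero: "h 0 = 0"
  using add[of 0 0] by simp

lemma uminus: "h (- x) = - h x"
  using add[of x "- x"] by (simp add: zero eq_neg_iff_add_eq_0 add.commute)

lemma diff: "h (x - y) = h x - h y"
  using add[of x "- y"] by (simp add: uminus)

lemma power: "h (x ^ n) = h x ^ n"
  by (induction n) (simp_all add: one mult)

lemma of_nat: "h (of_nat n) = of_nat n"
  by (induction n) (simp_all add: zero one add)

lemma numeral: "h (numeral n) = numeral n"
  using of_nat[of "numeral n"] by simp

lemma sum: "h (sum f A) = (\<Sum>x\<in>A. h (f x))"
  by (induction A rule: infinite_finite_induct) (simp_all add: zero add)

lemma map_poly_pCons: "map_poly h (pCons a p) = pCons (h a) (map_poly h p)"
  by (simp add: zero map_poly_pCons)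

lemma coeff_map: "Polynomial.coeff (map_poly h p) n = h (Polynomial.coeff p n)"
  by (simp add: coeff_map_poly zero)

lemma map_poly_add: "map_poly h (p + q) = map_poly h p + map_poly h q"
  by (intro poly_eqI) (simp add: coeff_map add)

lemma map_poly_smult: "map_poly h (Polynomial.smult c p) = Polynomial.smult (h c) (map_poly h p)"
  by (intro poly_eqI) (simp add: coeff_map mult)

lemma map_poly_mult: "map_poly h (p * q) = map_poly h p * map_poly h q"
  by (induction p) (simp_all add: map_poly_pCons map_poly_add map_poly_smult zero)

lemma poly_map: "poly (map_poly h p) (h x) = h (poly p x)"
  by (induction p) (simp_all add: map_poly_pCons zero add mult)

lemma rhom_map_poly: "rhom (map_poly h)"
  by unfold_locales (simp_all add: map_poly_add map_poly_mult one)

lemmas simps = add mult one zero uminus diff power numeral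

end

lemma rhom_divide:
  fixes h :: "'a::field \<Rightarrow> 'b::field"
  assumes "rhom h"
  shows "h (x / y) = h x / h y" and "h (inverse x) = inverse (h x)" and "h x = 0 \<longleftrightarrow> x = 0"
    and "h x = h y \<longleftrightarrow> x = y"
proof -
  interpret rhom h by fact
  show inv: "h (inverse x) = inverse (h x)" for x
  proof (cases "x = 0")
    case False
    then have "h x * h (inverse x) = 1" by (metis mult one right_inverse)
    then show ?thesis by (metis inverse_unique)
  qed (simp add: zero)
  show "h (x / y) = h x / h y" by (simp add: divide_inverse mult inv)
  show eq0: "h x = 0 \<longleftrightarrow> x = 0" for x
    by (metis inv mult one right_inverse zero mult_zero_left zero_neq_one)
  show "h x = h y \<longleftrightarrow> x = y" using eq0[of "x - y"] by (simp add: diff)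
qed

text \<open>Constants and the two variables generate the ring, so a property stable under sums and
  products need only be checked on them.\<close>

lemma poly_poly_induct [case_names const varX varY add mult]:
  fixes P :: "'a::comm_ring_1 poly poly \<Rightarrow> bool"
  assumes const: "\<And>c. P [:[:c:]:]" and X: "P [:[:0, 1:]:]" and Y: "P [:0, 1:]"
    and add: "\<And>a b. P a \<Longrightarrow> P b \<Longrightarrow> P (a + b)" and mult: "\<And>a b. P a \<Longrightarrow> P b \<Longrightarrow> P (a * b)"
  shows "P a"
proof -
  have inner: "P [:p:]" for p
  proof (induction p)
    case 0
    show ?case using const[of 0] by simp
  next
    case (pCons c p)
    have "[:pCons c p:] = [:[:c:]:] + [:[:0, 1:]:] * [:p:]" by simp
    then show ?case using const add mult[OF X pCons.IH] by metis
  qed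
  show ?thesis
  proof (induction a)
    case 0
    show ?case using inner[of 0] by simp
  next
    case (pCons p a)
    have "pCons p a = [:p:] + [:0, 1:] * a" by simp
    then show ?case using inner add mult[OF Y pCons.IH] by metis
  qed
qed

lemma eval2_simps [simp]:
  "eval2 (a + b) x y = eval2 a x y + eval2 b x y"
  "eval2 (a - b) x y = eval2 a x y - eval2 b x y"
  "eval2 (- a) x y = - eval2 a x y"
  "eval2 (a * b) x y = eval2 a x y * eval2 b x y"
  "eval2 (a ^ n) x y = eval2 a x y ^ n"
  "eval2 0 x y = 0"
  "eval2 1 x y = 1"
  "eval2 (pCons p a) x y = poly p x + y * eval2 a x y"
  by (simp_all add: eval2_def)

text \<open>
  All function fields live in one fixed algebraic closure of \<open>k(x)\<close>; \<open>kc\<close> embeds the constants,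
  \<open>gX\<close> and (for a curve) \<open>gY\<close> are the coordinates of the generic point.
\<close>

type_synonym 'a ff = "'a poly fract alg_closure"

definition pX :: "'a::field poly \<Rightarrow> 'a ff" where
  "pX p = to_ac (to_fract p)"

definition kc :: "'a::field \<Rightarrow> 'a ff" where
  "kc c = pX [:c:]"

definition gX :: "'a::field ff" where
  "gX = pX [:0, 1:]"

definition ev1 :: "'a::field poly \<Rightarrow> 'a ff \<Rightarrow> 'a ff" where
  "ev1 p x = poly (map_poly kc p) x"

text \<open>Substitutes functions for the variables, whereas \<open>eval2\<close> substitutes
  constants. The point stays a parameter because it will be the generic point, its translates, or
  the chart at infinity.\<close>

definition ev2 :: "'a::field poly poly \<Rightarrow> 'a ff \<Rightarrow> 'a ff \<Rightarrow> 'a ff" where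
  "ev2 a x y = poly (map_poly (\<lambda>p. ev1 p x) a) y"

interpretation pX: rhom pX
  by unfold_locales (simp_all add: pX_def flip: One_fract_def to_fract_def)

lemma pX_eq_0_iff [simp]: "pX p = 0 \<longleftrightarrow> p = 0"
  by (simp add: pX_def)

lemma pX_eq_iff [simp]: "pX p = pX q \<longleftrightarrow> p = q"
  by (simp add: pX_def)

interpretation kc: rhom kc
  by unfold_locales (simp_all add: kc_def one_pCons flip: pX.add pX.mult pX.one)

lemmas kc_divide [simp] = rhom_divide(1,2)[OF kc.rhom_axioms]

lemma kc_eq_iff [simp]: "kc x = kc y \<longleftrightarrow> x = y" "kc x = 0 \<longleftrightarrow> x = 0" "kc x = 1 \<longleftrightarrow> x = 1"
  using rhom_divide(3,4)[OF kc.rhom_axioms] kc.one by metis+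

declare kc.simps [simp]

interpretation ev1: rhom "\<lambda>p. ev1 p x" for x
  by unfold_locales (simp_all add: ev1_def kc.map_poly_add kc.map_poly_mult)

interpretation ev2: rhom "\<lambda>a. ev2 a x y" for x y
  by unfold_locales (simp_all add: ev2_def ev1.map_poly_add ev1.map_poly_mult ev1.one)

declare ev1.simps [simp] ev2.simps [simp] pX.simps [simp]

lemma ev_pCons [simp]:
  "ev1 (pCons c p) x = kc c + x * ev1 p x"
  "ev2 (pCons p a) x y = ev1 p x + y * ev2 a x y"
proof -
  show "ev1 (pCons c p) x = kc c + x * ev1 p x"
    by (simp add: ev1_def kc.map_poly_pCons)
  show "ev2 (pCons p a) x y = ev1 p x + y * ev2 a x y"
    by (simp add: ev2_def ev1.map_poly_pCons)
qed

lemma ev_smult [simp]: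
  "ev1 (Polynomial.smult c p) x = kc c * ev1 p x"
  "ev2 (Polynomial.smult p a) x y = ev1 p x * ev2 a x y"
  "eval2 (Polynomial.smult q b) u v = poly q u * eval2 b u v"
proof -
  show "ev1 (Polynomial.smult c p) x = kc c * ev1 p x"
    by (simp add: ev1_def kc.map_poly_smult)
  show "ev2 (Polynomial.smult p a) x y = ev1 p x * ev2 a x y"
    by (simp add: ev2_def ev1.map_poly_smult)
  show "eval2 (Polynomial.smult q b) u v = poly q u * eval2 b u v"
    by (simp add: eval2_def)
qed

lemma ev1_gX [simp]: "ev1 p gX = pX p"
proof (induction p)
  case (pCons c p)
  have "pX (pCons c p) = pX ([:c:] + [:0,1:] * p)" by simp
  then show ?case using pCons.IH by (simp only: ev_pCons kc_def gX_def pX.add pX.mult)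
qed simp

lemma pX_pCons [simp]: "pX (pCons c p) = kc c + gX * pX p"
  by (metis ev1_gX ev_pCons(1))

lemma pX_smult [simp]: "pX (Polynomial.smult c p) = kc c * pX p"
  by (metis ev1_gX ev_smult(1))

lemma gX_neq_const [simp]: "gX \<noteq> kc c"
  by (simp add: gX_def kc_def del: pX_pCons)

lemma gX_nonzero [simp]: "gX \<noteq> 0"
  using gX_neq_const[of 0] by simp

lemma eval_monom:
  "ev2 (Polynomial.monom (Polynomial.monom c i) j) x y = kc c * x ^ i * y ^ j"
  "eval2 (Polynomial.monom (Polynomial.monom d i) j) u v = d * u ^ i * v ^ j"
proof -
  have "ev1 (Polynomial.monom c i) x = kc c * x ^ i"
    by (simp add: ev1_def map_poly_monom poly_monom)
  then show "ev2 (Polynomial.monom (Polynomial.monom c i) j) x y = kc c * x ^ i * y ^ j"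
    by (simp add: ev2_def map_poly_monom poly_monom)
  show "eval2 (Polynomial.monom (Polynomial.monom d i) j) u v = d * u ^ i * v ^ j"
    by (simp add: eval2_def poly_monom)
qed

section \<open>Total degree and the chart at infinity\<close>

lemma total_degree_le_add: "total_degree_le a N \<Longrightarrow> total_degree_le b N \<Longrightarrow> total_degree_le (a + b) N"
  unfolding total_degree_le_def by (metis Polynomial.coeff_add add_0)

lemma coeff_coeff_mult:
  "Polynomial.coeff (Polynomial.coeff (a * b) n) i =
     (\<Sum>j\<le>n. \<Sum>k\<le>i. Polynomial.coeff (Polynomial.coeff a j) k *
        Polynomial.coeff (Polynomial.coeff b (n - j)) (i - k))"
  by (simp add: Polynomial.coeff_mult Polynomial.coeff_sum)

text \<open>In terms of homogeneous forms, the coefficient of Y^N is the value at (0 : 1 : 0), and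
  values multiply.\<close>

lemma total_degree_le_mult:
  assumes a: "total_degree_le a N" and b: "total_degree_le b M"
  shows "total_degree_le (a * b) (N + M)"
    and "Polynomial.coeff (Polynomial.coeff (a * b) (N + M)) 0 =
      Polynomial.coeff (Polynomial.coeff a N) 0 * Polynomial.coeff (Polynomial.coeff b M) 0"
proof -
  have z: "Polynomial.coeff (Polynomial.coeff a j) k * Polynomial.coeff (Polynomial.coeff b j') k' = 0"
    if "j + k > N \<or> j' + k' > M" for j k j' k'
    using a b that unfolding total_degree_le_def by (metis add.commute leD mult_eq_0_iff)
  show "total_degree_le (a * b) (N + M)"
    unfolding total_degree_le_def coeff_coeff_mult
  proof (intro allI impI)
    fix i n
    assume nz: "(\<Sum>j\<le>n. \<Sum>k\<le>i. Polynomial.coeff (Polynomial.coeff a j) k *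
      Polynomial.coeff (Polynomial.coeff b (n - j)) (i - k)) \<noteq> 0"
    show "i + n \<le> N + M"
    proof (rule ccontr)
      assume "\<not> i + n \<le> N + M"
      then have "(\<Sum>j\<le>n. \<Sum>k\<le>i. Polynomial.coeff (Polynomial.coeff a j) k *
        Polynomial.coeff (Polynomial.coeff b (n - j)) (i - k)) = 0"
        by (intro sum.neutral ballI z) auto
      with nz show False by simp
    qed
  qed
  have "(\<Sum>j\<le>N + M. Polynomial.coeff (Polynomial.coeff a j) 0 *
      Polynomial.coeff (Polynomial.coeff b (N + M - j)) 0) =
    (\<Sum>j\<in>{N}. Polynomial.coeff (Polynomial.coeff a j) 0 *
      Polynomial.coeff (Polynomial.coeff b (N + M - j)) 0)"
    by (rule sum.mono_neutral_right) (auto intro!: z simp del: mult_eq_0_iff)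
  then show "Polynomial.coeff (Polynomial.coeff (a * b) (N + M)) 0 =
      Polynomial.coeff (Polynomial.coeff a N) 0 * Polynomial.coeff (Polynomial.coeff b M) 0"
    unfolding coeff_coeff_mult by simp
qed

text \<open>
  Passing between the affine chart and the chart \<open>(z, w) = (x / y, 1 / y)\<close> around the point at
  infinity, where \<open>(z, w) = (0, 0)\<close>.
\<close>

lemma to_infinity_chart:
  assumes "total_degree_le a N"
  obtains b where "\<And>x y. y \<noteq> 0 \<Longrightarrow> ev2 a x y = y ^ N * ev2 b (x / y) (1 / y)"
    and "eval2 b 0 0 = Polynomial.coeff (Polynomial.coeff a N) 0"
proof -
  define c where "c j i = Polynomial.coeff (Polynomial.coeff a j) i" for j i
  define b where "b = (\<Sum>j\<le>N. \<Sum>i\<le>N-j. Polynomial.monom (Polynomial.monom (c j i) i) (N - i - j))"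
  have "Polynomial.coeff (Polynomial.coeff a j) i = Polynomial.coeff (Polynomial.coeff
      (\<Sum>j\<le>N. \<Sum>i\<le>N-j. Polynomial.monom (Polynomial.monom (c j i) i) j) j) i" for i j
  proof -
    have "Polynomial.coeff (Polynomial.coeff
        (\<Sum>j\<le>N. \<Sum>i\<le>N-j. Polynomial.monom (Polynomial.monom (c j i) i) j) j) i =
      (\<Sum>j'\<le>N. \<Sum>i'\<le>N-j'. if j' = j then if i' = i then c j' i' else 0 else 0)"
      by (auto simp: Polynomial.coeff_sum intro!: sum.cong)
    also have "\<dots> = (\<Sum>j'\<le>N. if j' = j then \<Sum>i'\<le>N-j. if i' = i then c j i' else 0 else 0)"
      by (intro sum.cong) auto
    also have "\<dots> = c j i"
      using assms unfolding total_degree_le_def c_def by (auto simp: le_diff_conv2)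
    finally show ?thesis by (simp add: c_def)
  qed
  then have a: "a = (\<Sum>j\<le>N. \<Sum>i\<le>N-j. Polynomial.monom (Polynomial.monom (c j i) i) j)"
    by (intro poly_eqI) simp
  have "ev2 a x y = y ^ N * ev2 b (x / y) (1 / y)" if "y \<noteq> 0" for x y
  proof -
    have *: "kc (c j i) * x ^ i * y ^ j = y ^ N * (kc (c j i) * (x / y) ^ i * (1 / y) ^ (N - i - j))"
      if "j \<le> N" "i \<le> N - j" for i j
    proof -
      have "N = i + j + (N - i - j)" using that by simp
      then have "y ^ N = y ^ i * y ^ j * y ^ (N - i - j)" by (metis power_add)
      then show ?thesis using \<open>y \<noteq> 0\<close> by (simp add: field_simps)
    qed
    show ?thesis
      unfolding a b_def ev2.sum eval_monom sum_distrib_left by (intro sum.cong refl *) simp_all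
  qed
  moreover have "eval2 b 0 0 = c N 0"
  proof -
    have e: "eval2 (sum f A) x y = (\<Sum>i\<in>A. eval2 (f i) x y)" for f :: "nat \<Rightarrow> 'a poly poly" and A x y
      by (induction A rule: infinite_finite_induct) auto
    have "eval2 b 0 0 = (\<Sum>j\<le>N. \<Sum>i\<le>N-j. c j i * 0 ^ i * 0 ^ (N - i - j))"
      unfolding b_def by (simp add: e eval_monom)
    also have "\<dots> = (\<Sum>j\<le>N. if j = N then c N 0 else 0)"
    proof (intro sum.cong refl)
      fix j assume "j \<in> {..N}"
      have "(\<Sum>i\<le>N-j. c j i * 0 ^ i * 0 ^ (N - i - j)) = (\<Sum>i\<le>N-j. if i = 0 then c j 0 * 0 ^ (N - j) else 0)"
        by (intro sum.cong) auto
      also have "\<dots> = c j 0 * 0 ^ (N - j)" by simp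
      finally show "(\<Sum>i\<le>N-j. c j i * 0 ^ i * 0 ^ (N - i - j)) = (if j = N then c N 0 else 0)"
        using \<open>j \<in> {..N}\<close> by (auto simp: power_0_left)
    qed
    finally show ?thesis by simp
  qed
  ultimately show ?thesis using that c_def by metis
qed

text \<open>Quantifying over all large \<open>N\<close> lets a numerator and a denominator be
  homogenized to one common degree.\<close>

lemma from_infinity_chart:
  "\<exists>N\<^sub>0. \<forall>N\<ge>N\<^sub>0. \<exists>a. total_degree_le a N \<and>
     (\<forall>x y. y \<noteq> 0 \<longrightarrow> ev2 a x y = y ^ N * ev2 b (x / y) (1 / y)) \<and>
     Polynomial.coeff (Polynomial.coeff a N) 0 = eval2 b 0 0"
proof (induction b rule: poly_poly_induct)
  case (const c)
  have "\<exists>a. total_degree_le a N \<and>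
     (\<forall>x y. y \<noteq> 0 \<longrightarrow> ev2 a x y = y ^ N * ev2 [:[:c:]:] (x / y) (1 / y)) \<and>
     Polynomial.coeff (Polynomial.coeff a N) 0 = eval2 [:[:c:]:] 0 0" for N
    by (rule exI[of _ "Polynomial.monom (Polynomial.monom c 0) N"])
      (simp add: eval_monom total_degree_le_def)
  then show ?case by blast
next
  case varX
  have "\<exists>a. total_degree_le a N \<and>
     (\<forall>x y. y \<noteq> 0 \<longrightarrow> ev2 a x y = y ^ N * ev2 [:[:0,1:]:] (x / y) (1 / y)) \<and>
     Polynomial.coeff (Polynomial.coeff a N) 0 = eval2 [:[:0,1:]:] 0 0" if "N \<ge> 1" for N
    by (rule exI[of _ "Polynomial.monom (Polynomial.monom 1 1) (N - 1)"])
      (use that in \<open>cases N; auto simp: eval_monom total_degree_le_def split: if_splits\<close>)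
  then show ?case by blast
next
  case varY
  have "\<exists>a. total_degree_le a N \<and>
     (\<forall>x y. y \<noteq> 0 \<longrightarrow> ev2 a x y = y ^ N * ev2 [:0,1:] (x / y) (1 / y)) \<and>
     Polynomial.coeff (Polynomial.coeff a N) 0 = eval2 [:0,1:] 0 0" if "N \<ge> 1" for N
    by (rule exI[of _ "Polynomial.monom (Polynomial.monom 1 0) (N - 1)"])
      (use that eval_monom(1)[of 1 0 "N - 1"] in \<open>cases N; auto simp: eval_monom total_degree_le_def split: if_splits\<close>)
  then show ?case by blast
next
  case (add a b)
  from add(1) obtain N1 where N1: "\<And>N. N \<ge> N1 \<Longrightarrow> \<exists>a'. total_degree_le a' N \<and>
     (\<forall>x y. y \<noteq> 0 \<longrightarrow> ev2 a' x y = y ^ N * ev2 a (x / y) (1 / y)) \<and>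
     Polynomial.coeff (Polynomial.coeff a' N) 0 = eval2 a 0 0" by blast
  from add(2) obtain N2 where N2: "\<And>N. N \<ge> N2 \<Longrightarrow> \<exists>a'. total_degree_le a' N \<and>
     (\<forall>x y. y \<noteq> 0 \<longrightarrow> ev2 a' x y = y ^ N * ev2 b (x / y) (1 / y)) \<and>
     Polynomial.coeff (Polynomial.coeff a' N) 0 = eval2 b 0 0" by blast
  have "\<exists>c. total_degree_le c N \<and>
     (\<forall>x y. y \<noteq> 0 \<longrightarrow> ev2 c x y = y ^ N * ev2 (a + b) (x / y) (1 / y)) \<and>
     Polynomial.coeff (Polynomial.coeff c N) 0 = eval2 (a + b) 0 0" if N: "N \<ge> max N1 N2" for N
  proof -
    obtain a' b' where "total_degree_le a' N" "total_degree_le b' N"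
      "\<forall>x y. y \<noteq> 0 \<longrightarrow> ev2 a' x y = y ^ N * ev2 a (x / y) (1 / y)"
      "\<forall>x y. y \<noteq> 0 \<longrightarrow> ev2 b' x y = y ^ N * ev2 b (x / y) (1 / y)"
      "Polynomial.coeff (Polynomial.coeff a' N) 0 = eval2 a 0 0"
      "Polynomial.coeff (Polynomial.coeff b' N) 0 = eval2 b 0 0"
      using N1[of N] N2[of N] N by auto
    then show ?thesis
      by (intro exI[of _ "a' + b'"]) (simp add: total_degree_le_add algebra_simps)
  qed
  then show ?case by blast
next
  case (mult a b)
  from mult(1) obtain N1 where N1: "\<And>N. N \<ge> N1 \<Longrightarrow> \<exists>a'. total_degree_le a' N \<and>
     (\<forall>x y. y \<noteq> 0 \<longrightarrow> ev2 a' x y = y ^ N * ev2 a (x / y) (1 / y)) \<and>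
     Polynomial.coeff (Polynomial.coeff a' N) 0 = eval2 a 0 0" by blast
  from mult(2) obtain N2 where N2: "\<And>N. N \<ge> N2 \<Longrightarrow> \<exists>a'. total_degree_le a' N \<and>
     (\<forall>x y. y \<noteq> 0 \<longrightarrow> ev2 a' x y = y ^ N * ev2 b (x / y) (1 / y)) \<and>
     Polynomial.coeff (Polynomial.coeff a' N) 0 = eval2 b 0 0" by blast
  have "\<exists>c. total_degree_le c N \<and>
     (\<forall>x y. y \<noteq> 0 \<longrightarrow> ev2 c x y = y ^ N * ev2 (a * b) (x / y) (1 / y)) \<and>
     Polynomial.coeff (Polynomial.coeff c N) 0 = eval2 (a * b) 0 0" if N: "N \<ge> N1 + N2" for N
  proof -
    define M where "M = N - N1"
    have NM: "N = N1 + M" "M \<ge> N2" using N by (auto simp: M_def)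
    obtain a' b' where "total_degree_le a' N1" "total_degree_le b' M"
      "\<forall>x y. y \<noteq> 0 \<longrightarrow> ev2 a' x y = y ^ N1 * ev2 a (x / y) (1 / y)"
      "\<forall>x y. y \<noteq> 0 \<longrightarrow> ev2 b' x y = y ^ M * ev2 b (x / y) (1 / y)"
      "Polynomial.coeff (Polynomial.coeff a' N1) 0 = eval2 a 0 0"
      "Polynomial.coeff (Polynomial.coeff b' M) 0 = eval2 b 0 0"
      using N1[of N1] N2[of M] NM by auto
    then show ?thesis unfolding NM
      by (intro exI[of _ "a' * b'"]) (simp add: total_degree_le_mult power_add)
  qed
  then show ?case by blast
qed

lemma total_degree_le_exists: "\<exists>N. total_degree_le (a :: 'a::field poly poly) N"
proof (induction a rule: poly_poly_induct)
  case (add a b)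
  then obtain N M where "total_degree_le a N" "total_degree_le b M" by blast
  then have "total_degree_le (a + b) (max N M)"
    unfolding total_degree_le_def by (metis Polynomial.coeff_add add_0 le_max_iff_disj)
  then show ?case by blast
next
  case (mult a b)
  then show ?case using total_degree_le_mult(1) by blast
next
  case (const c)
  have "total_degree_le [:[:c:]:] 0"
    by (auto simp: total_degree_le_def Polynomial.coeff_pCons split: nat.splits)
  then show ?case by blast
next
  case varX
  have "total_degree_le [:[:0,1:]:] 1"
    by (auto simp: total_degree_le_def Polynomial.coeff_pCons split: nat.splits)
  then show ?case by blast
next
  case varY
  have "total_degree_le [:0,1:] 1"
    by (auto simp: total_degree_le_def Polynomial.coeff_pCons split: nat.splits if_splits)
  then show ?case by blast
qed

section \<open>Multiples of the Weierstrass polynomial at infinity\<close>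

lemma coeff_weier_poly_mult:
  "Polynomial.coeff (weier_poly E * q) j =
     - [:wa6 E, wa4 E, wa2 E, 1:] * Polynomial.coeff q j
     + (if j \<ge> 1 then [:wa3 E, wa1 E:] * Polynomial.coeff q (j - 1) else 0)
     + (if j \<ge> 2 then Polynomial.coeff q (j - 2) else 0)"
  by (cases j rule: nat.exhaust; cases "j - 1" rule: nat.exhaust)
    (simp_all add: weier_poly_def Polynomial.coeff_pCons)

lemma coeff_cubic_mult:
  fixes p :: "'a::comm_ring_1 poly"
  shows "Polynomial.coeff ([:a, b, c, d:] * p) i = a * Polynomial.coeff p i
     + (if i \<ge> 1 then b * Polynomial.coeff p (i - 1) else 0)
     + (if i \<ge> 2 then c * Polynomial.coeff p (i - 2) else 0)
     + (if i \<ge> 3 then d * Polynomial.coeff p (i - 3) else 0)"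
  by (auto simp: Polynomial.coeff_pCons numeral_2_eq_2 numeral_3_eq_3 split: nat.split)

text \<open>The curve passes through (0 : 1 : 0), as its cubic form has no Y^3 term. The leading
  form -X^3 makes \<open>N\<close> exceed the total degree of \<open>q\<close> by at least three,
  while the Y-degree of the Weierstrass polynomial is only two, so no term of \<open>q\<close>
  reaches Y^N.\<close>

lemma weier_poly_mult_top:
  assumes "total_degree_le (weier_poly E * q) N"
  shows "Polynomial.coeff (Polynomial.coeff (weier_poly E * q) N) 0 = 0"
proof (cases "q = 0")
  case False
  define c where "c j i = Polynomial.coeff (Polynomial.coeff q j) i" for j i
  define d where "d = (LEAST N. total_degree_le q N)"
  have d: "total_degree_le q d"
    unfolding d_def using total_degree_le_exists by (metis LeastI)
  have big: "c j i = 0" if "i + j > d" for i j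
    using d that unfolding total_degree_le_def c_def by (meson leD)
  obtain i j where ij: "c j i \<noteq> 0" "i + j = d"
  proof (cases "d = 0")
    case True
    have "\<exists>j i. c j i \<noteq> 0" using False unfolding c_def by (metis leading_coeff_neq_0)
    then obtain i j where ij: "c j i \<noteq> 0" by blast
    then have "i + j = d" using big[of i j] True by force
    with ij show ?thesis using that by blast
  next
    case False
    have "\<not> total_degree_le q (d - 1)"
      using not_less_Least[of "d - 1" "total_degree_le q"] False unfolding d_def by linarith
    then obtain i j where "c j i \<noteq> 0" "i + j > d - 1"
      unfolding total_degree_le_def c_def by (auto simp: not_le)
    then have "i + j = d" using big[of i j] by force
    with \<open>c j i \<noteq> 0\<close> show ?thesis using that by blast
  qed
  have lin: "Polynomial.coeff ([:u, v:] * p) k = u * Polynomial.coeff p k +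
      (if k \<ge> 1 then v * Polynomial.coeff p (k - 1) else 0)" for u v :: 'a and p k
    by (auto simp: Polynomial.coeff_pCons split: nat.split)
  have "Polynomial.coeff (Polynomial.coeff (weier_poly E * q) j) (i + 3) = - c j i"
    unfolding coeff_weier_poly_mult Polynomial.coeff_add minus_mult_left[symmetric]
      Polynomial.coeff_minus coeff_cubic_mult
    using big ij(2) by (simp add: lin c_def del: mult_pCons_left)
  then have N: "d + 3 \<le> N" using assms ij unfolding total_degree_le_def
    by (metis add.commute add.left_commute neg_equal_0_iff_equal)
  have "c N 0 = 0" "c (N - 1) 0 = 0" "c (N - 2) 0 = 0" using N big by auto
  then show ?thesis
    unfolding coeff_weier_poly_mult Polynomial.coeff_add minus_mult_left[symmetric]
      Polynomial.coeff_minus coeff_cubic_mult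
    using N by (simp add: lin c_def del: mult_pCons_left)
qed simp

section \<open>The function field and its valuations\<close>

text \<open>Membership of \<open>f\<close> in a local ring together with its residue
  \<open>c\<close>. Being a relation, it expresses regularity as existence of a value.\<close>

definition lval :: "'a::field ff \<Rightarrow> 'a ff \<Rightarrow> 'a \<Rightarrow> 'a \<Rightarrow> 'a ff \<Rightarrow> 'a \<Rightarrow> bool" where
  "lval u v u\<^sub>0 v\<^sub>0 f c \<longleftrightarrow>
     (\<exists>a b. eval2 b u\<^sub>0 v\<^sub>0 \<noteq> 0 \<and> f = ev2 a u v / ev2 b u v \<and> c = eval2 a u\<^sub>0 v\<^sub>0 / eval2 b u\<^sub>0 v\<^sub>0)"

text \<open>The assumption says that every polynomial relation between the functions
  \<open>u\<close>, \<open>v\<close> survives specialization, that is, the point lies on the curve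
  with generic point \<open>(u, v)\<close>.\<close>

locale chart =
  fixes u v :: "'a::field ff" and u\<^sub>0 v\<^sub>0 :: 'a
  assumes spec: "ev2 a u v = 0 \<Longrightarrow> eval2 a u\<^sub>0 v\<^sub>0 = 0"
begin

abbreviation "lv \<equiv> lval u v u\<^sub>0 v\<^sub>0"

lemma lval_ev2: "lv (ev2 a u v) (eval2 a u\<^sub>0 v\<^sub>0)"
  unfolding lval_def by (rule exI[of _ a], rule exI[of _ 1]) simp

lemma lval_const: "lv (kc c) c"
  using lval_ev2[of "[:[:c:]:]"] by simp

lemma lval_add: "lv f c \<Longrightarrow> lv g d \<Longrightarrow> lv (f + g) (c + d)"
  unfolding lval_def
proof (elim exE conjE)
  fix a b a' b'
  assume *: "eval2 b u\<^sub>0 v\<^sub>0 \<noteq> 0" "eval2 b' u\<^sub>0 v\<^sub>0 \<noteq> 0" "f = ev2 a u v / ev2 b u v" "g = ev2 a' u v / ev2 b' u v"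
    "c = eval2 a u\<^sub>0 v\<^sub>0 / eval2 b u\<^sub>0 v\<^sub>0" "d = eval2 a' u\<^sub>0 v\<^sub>0 / eval2 b' u\<^sub>0 v\<^sub>0"
  then have "ev2 b u v \<noteq> 0" "ev2 b' u v \<noteq> 0" using spec by blast+
  then show "\<exists>a b. eval2 b u\<^sub>0 v\<^sub>0 \<noteq> 0 \<and> f + g = ev2 a u v / ev2 b u v \<and> c + d = eval2 a u\<^sub>0 v\<^sub>0 / eval2 b u\<^sub>0 v\<^sub>0"
    using * by (intro exI[of _ "a * b' + a' * b"] exI[of _ "b * b'"]) (simp add: add_frac_eq)
qed

lemma lval_mult: "lv f c \<Longrightarrow> lv g d \<Longrightarrow> lv (f * g) (c * d)"
  unfolding lval_def
proof (elim exE conjE)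
  fix a b a' b'
  assume *: "eval2 b u\<^sub>0 v\<^sub>0 \<noteq> 0" "eval2 b' u\<^sub>0 v\<^sub>0 \<noteq> 0" "f = ev2 a u v / ev2 b u v" "g = ev2 a' u v / ev2 b' u v"
    "c = eval2 a u\<^sub>0 v\<^sub>0 / eval2 b u\<^sub>0 v\<^sub>0" "d = eval2 a' u\<^sub>0 v\<^sub>0 / eval2 b' u\<^sub>0 v\<^sub>0"
  then show "\<exists>a b. eval2 b u\<^sub>0 v\<^sub>0 \<noteq> 0 \<and> f * g = ev2 a u v / ev2 b u v \<and> c * d = eval2 a u\<^sub>0 v\<^sub>0 / eval2 b u\<^sub>0 v\<^sub>0"
    by (intro exI[of _ "a * a'"] exI[of _ "b * b'"]) simp
qed

lemma lval_inverse: "lv f c \<Longrightarrow> c \<noteq> 0 \<Longrightarrow> lv (inverse f) (inverse c)"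
  unfolding lval_def
proof (elim exE conjE)
  fix a b
  assume *: "eval2 b u\<^sub>0 v\<^sub>0 \<noteq> 0" "f = ev2 a u v / ev2 b u v" "c = eval2 a u\<^sub>0 v\<^sub>0 / eval2 b u\<^sub>0 v\<^sub>0" "c \<noteq> 0"
  then show "\<exists>a b. eval2 b u\<^sub>0 v\<^sub>0 \<noteq> 0 \<and> inverse f = ev2 a u v / ev2 b u v \<and> inverse c = eval2 a u\<^sub>0 v\<^sub>0 / eval2 b u\<^sub>0 v\<^sub>0"
    by (intro exI[of _ b] exI[of _ a]) simp
qed

lemma lval_zero: "lv 0 c \<Longrightarrow> c = 0"
  unfolding lval_def using spec by fastforce

lemma lval_unique:
  assumes "lv f c" "lv f d"
  shows "c = d"
proof -
  have "lv (f + kc (-1) * f) (c + (-1) * d)"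
    by (intro lval_add lval_mult lval_const assms)
  then show ?thesis using lval_zero[of "c - d"] by simp
qed

text \<open>A first-order Taylor expansion: the maximal ideal at the point is generated by the two
  coordinate differences.\<close>

lemma ev2_expand:
  "\<exists>A B. ev2 a u v = kc (eval2 a u\<^sub>0 v\<^sub>0) + (u - kc u\<^sub>0) * ev2 A u v + (v - kc v\<^sub>0) * ev2 B u v"
proof (induction a rule: poly_poly_induct)
  case (const c)
  show ?case by (rule exI[of _ 0], rule exI[of _ 0]) simp
next
  case varX
  show ?case by (rule exI[of _ 1], rule exI[of _ 0]) simp
next
  case varY
  show ?case by (rule exI[of _ 0], rule exI[of _ 1]) simp
next
  case (add a b)
  then obtain A B A' B' where
    "ev2 a u v = kc (eval2 a u\<^sub>0 v\<^sub>0) + (u - kc u\<^sub>0) * ev2 A u v + (v - kc v\<^sub>0) * ev2 B u v"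
    "ev2 b u v = kc (eval2 b u\<^sub>0 v\<^sub>0) + (u - kc u\<^sub>0) * ev2 A' u v + (v - kc v\<^sub>0) * ev2 B' u v"
    by blast
  then have "ev2 (a + b) u v = kc (eval2 (a + b) u\<^sub>0 v\<^sub>0)
      + (u - kc u\<^sub>0) * ev2 (A + A') u v + (v - kc v\<^sub>0) * ev2 (B + B') u v"
    by (simp only: ev2.add kc.add eval2_simps distrib_left) simp
  then show ?case by blast
next
  case (mult a b)
  then obtain A B A' B' where *:
    "ev2 a u v = kc (eval2 a u\<^sub>0 v\<^sub>0) + (u - kc u\<^sub>0) * ev2 A u v + (v - kc v\<^sub>0) * ev2 B u v"
    "ev2 b u v = kc (eval2 b u\<^sub>0 v\<^sub>0) + (u - kc u\<^sub>0) * ev2 A' u v + (v - kc v\<^sub>0) * ev2 B' u v"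
    by blast
  have "ev2 (a * b) u v = kc (eval2 (a * b) u\<^sub>0 v\<^sub>0)
      + (u - kc u\<^sub>0) * ev2 (A * b + [:[:eval2 a u\<^sub>0 v\<^sub>0:]:] * A') u v
      + (v - kc v\<^sub>0) * ev2 (B * b + [:[:eval2 a u\<^sub>0 v\<^sub>0:]:] * B') u v"
    by (simp add: *(1)) (simp add: *(2) algebra_simps)
  then show ?case by blast
qed

end

section \<open>The function field of an elliptic curve over an algebraically closed field\<close>

locale ec =
  fixes E :: "'a::alg_closed_field weierstrass"
  assumes nonsingular: "discriminant E \<noteq> 0"
begin

abbreviation "a1 \<equiv> wa1 E"
abbreviation "a2 \<equiv> wa2 E"
abbreviation "a3 \<equiv> wa3 E"
abbreviation "a4 \<equiv> wa4 E"
abbreviation "a6 \<equiv> wa6 E"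

text \<open>At a singular point the equation and its two derivatives determine \<open>a3\<close>,
  \<open>a4\<close> and \<open>a6\<close>. Then b4, b6, b8 become polynomials in \<open>x\<close>
  and b2 for which the discriminant vanishes identically.\<close>

lemma smooth:
  assumes "on_curve E (Affine x y)"
  shows "2 * y + a1 * x + a3 \<noteq> 0 \<or> 3 * x ^ 2 + 2 * a2 * x + a4 - a1 * y \<noteq> 0"
proof (rule ccontr)
  assume "\<not> ?thesis"
  then have a3: "a3 = - 2 * y - a1 * x" and a4: "a4 = a1 * y - 3 * x ^ 2 - 2 * a2 * x"
    by (simp_all add: algebra_simps eq_neg_iff_add_eq_0)
  have a6: "a6 = y ^ 2 + a1 * x * y + a3 * y - x ^ 3 - a2 * x ^ 2 - a4 * x"
    using assms by (simp add: algebra_simps)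
  define b2 where "b2 = a1 ^ 2 + 4 * a2"
  have b4: "2 * a4 + a1 * a3 = - 6 * x ^ 2 - b2 * x"
    unfolding a4 a3 b2_def by Groebner_Basis.algebra
  have b6: "a3 ^ 2 + 4 * a6 = 8 * x ^ 3 + b2 * x ^ 2"
    unfolding a6 unfolding a4 a3 b2_def by Groebner_Basis.algebra
  have b8: "a1 ^ 2 * a6 + 4 * a2 * a6 - a1 * a3 * a4 + a2 * a3 ^ 2 - a4 ^ 2 = - 9 * x ^ 4 - b2 * x ^ 3"
    unfolding a6 unfolding a4 a3 b2_def by Groebner_Basis.algebra
  have "discriminant E = 0"
    unfolding discriminant_def Let_def b2_def[symmetric] b4 b6 b8 by Groebner_Basis.algebra
  with nonsingular show False by simp
qed

definition gY :: "'a ff" where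
  "gY = (SOME y. y ^ 2 + kc a1 * gX * y + kc a3 * y = gX ^ 3 + kc a2 * gX ^ 2 + kc a4 * gX + kc a6)"

lemma gY: "gY ^ 2 + kc a1 * gX * gY + kc a3 * gY = gX ^ 3 + kc a2 * gX ^ 2 + kc a4 * gX + kc a6"
proof -
  let ?p = "[:- (gX ^ 3 + kc a2 * gX ^ 2 + kc a4 * gX + kc a6), kc a1 * gX + kc a3, 1:]"
  have "\<exists>y. poly ?p y = 0" by (rule alg_closed_imp_poly_has_root) simp
  then have "\<exists>y. y ^ 2 + kc a1 * gX * y + kc a3 * y = gX ^ 3 + kc a2 * gX ^ 2 + kc a4 * gX + kc a6"
    by (auto simp: algebra_simps power2_eq_square eq_neg_iff_add_eq_0 neg_eq_iff_add_eq_0)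
  then show ?thesis unfolding gY_def by (rule someI_ex)
qed

abbreviation "ev a \<equiv> ev2 a gX gY"
abbreviation "cub \<equiv> [:a6, a4, a2, 1:]"
abbreviation "lin \<equiv> [:a3, a1:]"

text \<open>
  The norm of \<open>u + v y\<close> does not vanish because \<open>u (u - (a\<^sub>1 x + a\<^sub>3) v)\<close> and the cubic times \<open>v\<^sup>2\<close>
  have different degrees.
\<close>

lemma norm_nonzero:
  fixes u v :: "'a poly"
  assumes "u \<noteq> 0 \<or> v \<noteq> 0"
  shows "u ^ 2 - lin * u * v - cub * v ^ 2 \<noteq> 0"
proof
  assume "u ^ 2 - lin * u * v - cub * v ^ 2 = 0"
  then have eq: "u * (u - lin * v) = cub * v ^ 2" by Groebner_Basis.algebra
  have v: "v \<noteq> 0"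
  proof
    assume "v = 0"
    with eq assms show False by simp
  qed
  have dcub: "Polynomial.degree cub = 3" by simp
  have r: "Polynomial.degree (cub * v ^ 2) = 3 + 2 * Polynomial.degree v"
    using v by (subst degree_mult_eq) (auto simp: degree_power_eq simp del: mult_pCons_left)
  have "u \<noteq> 0" "u - lin * v \<noteq> 0" using eq v by (auto simp del: mult_pCons_left)
  then have l: "Polynomial.degree (u * (u - lin * v)) = Polynomial.degree u + Polynomial.degree (u - lin * v)"
    by (rule degree_mult_eq)
  have lv: "Polynomial.degree (lin * v) \<le> 1 + Polynomial.degree v"
    by (rule order.trans[OF degree_mult_le]) simp
  show False
  proof (cases "Polynomial.degree u \<ge> Polynomial.degree v + 2")
    case True
    then have "Polynomial.degree (u - lin * v) = Polynomial.degree u"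
      using lv degree_add_eq_left[of "- (lin * v)" u] by (simp del: mult_pCons_left)
    then have "2 * Polynomial.degree u = 3 + 2 * Polynomial.degree v" using l r eq by simp
    then show False by presburger
  next
    case False
    have "Polynomial.degree (u - lin * v) \<le> 1 + Polynomial.degree v"
      using False lv by (intro degree_diff_le) auto
    then show False using l r eq False by simp
  qed
qed

text \<open>The second factor is the conjugate of the first under y -> - y - a1 x - a3, the
  substitution given by negation on the curve.\<close>

lemma norm_eq: "(pX u + pX v * gY) * (pX u - pX v * (gY + pX lin)) = pX (u ^ 2 - lin * u * v - cub * v ^ 2)"
proof -
  have "pX lin = kc a3 + kc a1 * gX" "pX cub = kc a6 + kc a4 * gX + kc a2 * gX ^ 2 + gX ^ 3"
    by (simp_all add: algebra_simps power2_eq_square power3_eq_cube)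
  then have "gY * (gY + pX lin) = pX cub" using gY by (simp add: algebra_simps power2_eq_square)
  moreover have "(a + b * c) * (a - b * (c + d)) = a ^ 2 - d * a * b - (c * (c + d)) * b ^ 2"
    for a b c d :: "'a ff" by Groebner_Basis.algebra
  ultimately show ?thesis
    unfolding pX.diff pX.mult pX.power by metis
qed

lemma gY_independent: "pX u + pX v * gY = 0 \<longleftrightarrow> u = 0 \<and> v = 0"
proof (cases "u = 0 \<and> v = 0")
  case False
  then have "pX (u ^ 2 - lin * u * v - cub * v ^ 2) \<noteq> 0"
    using norm_nonzero[of u v] by (simp only: pX_eq_0_iff) blast
  then show ?thesis using norm_eq[of u v] False by (metis mult_zero_left)
qed simp

lemma ev_weier_poly: "ev (weier_poly E) = 0"
  using gY by (simp add: weier_poly_def algebra_simps power2_eq_square power3_eq_cube)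

lemma mod_weier_poly:
  obtains u v q where "a = weier_poly E * q + [:u, v:]" "ev a = pX u + pX v * gY"
proof -
  have "Polynomial.coeff (weier_poly E) (Polynomial.degree (weier_poly E)) = 1" "weier_poly E \<noteq> 0"
    by (auto simp: weier_poly_def)
  then obtain q r where qr: "a = weier_poly E * q + r" "r = 0 \<or> Polynomial.degree r < Polynomial.degree (weier_poly E)"
    using pseudo_divmod[of "weier_poly E" a] by (metis power_one smult_1_left surj_pair)
  then have "Polynomial.degree r \<le> 1" by (auto simp: weier_poly_def)
  then have "r = [:Polynomial.coeff r 0, Polynomial.coeff r 1:]"
    by (intro poly_eqI) (auto simp: Polynomial.coeff_pCons Polynomial.coeff_eq_0 split: nat.split)
  then obtain u v where "r = [:u, v:]" by blast
  then show ?thesis using that qr ev_weier_poly by simp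
qed

text \<open>Identifies the coordinate ring with its image in \<open>ff\<close>, so that
  \<open>ratfun_eq\<close> becomes equality of quotients there.\<close>

lemma ev_eq_0_iff: "ev a = 0 \<longleftrightarrow> weier_poly E dvd a"
proof
  assume "ev a = 0"
  obtain u v q where "a = weier_poly E * q + [:u, v:]" "ev a = pX u + pX v * gY"
    by (rule mod_weier_poly)
  moreover from this have "u = 0 \<and> v = 0" using gY_independent \<open>ev a = 0\<close> by metis
  ultimately show "weier_poly E dvd a" by simp
next
  assume "weier_poly E dvd a"
  then show "ev a = 0" using ev_weier_poly by (auto elim!: dvdE)
qed

lemma gY_nonzero: "gY \<noteq> 0"
  using gY_independent[of 0 1] by simp

definition L :: "'a ff set" where "L = {ev a / ev b | a b. ev b \<noteq> 0}"

lemma L_ev [simp]: "ev a \<in> L"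
  unfolding L_def by (rule CollectI, rule exI[of _ a], rule exI[of _ 1]) simp

lemma L_kc [simp]: "kc c \<in> L"
  using L_ev[of "[:[:c:]:]"] by simp

lemma L_0_1 [simp]: "0 \<in> L" "1 \<in> L"
  using L_kc[of 0] L_kc[of 1] by simp_all

lemma L_gX [simp]: "gX \<in> L" and L_gY [simp]: "gY \<in> L" and L_pX [simp]: "pX p \<in> L"
  using L_ev[of "[:[:0,1:]:]"] L_ev[of "[:0,1:]"] L_ev[of "[:p:]"] by simp_all

lemma L_add [simp]: "f \<in> L \<Longrightarrow> g \<in> L \<Longrightarrow> f + g \<in> L"
  unfolding L_def
proof (elim CollectE exE conjE)
  fix a b c d assume "f = ev a / ev b" "g = ev c / ev d" "ev b \<noteq> 0" "ev d \<noteq> 0"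
  then show "f + g \<in> {ev a / ev b |a b. ev b \<noteq> 0}"
    by (intro CollectI exI[of _ "a * d + c * b"] exI[of _ "b * d"]) (simp add: add_frac_eq)
qed

lemma L_mult [simp]: "f \<in> L \<Longrightarrow> g \<in> L \<Longrightarrow> f * g \<in> L"
  unfolding L_def
proof (elim CollectE exE conjE)
  fix a b c d assume "f = ev a / ev b" "g = ev c / ev d" "ev b \<noteq> 0" "ev d \<noteq> 0"
  then show "f * g \<in> {ev a / ev b |a b. ev b \<noteq> 0}"
    by (intro CollectI exI[of _ "a * c"] exI[of _ "b * d"]) simp
qed

lemma L_inverse [simp]: "f \<in> L \<Longrightarrow> inverse f \<in> L"
proof (cases "f = 0")
  case False
  assume "f \<in> L"
  then obtain a b where "f = ev a / ev b" "ev b \<noteq> 0" unfolding L_def by blast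
  with False show ?thesis unfolding L_def
    by (intro CollectI exI[of _ b] exI[of _ a]) simp
qed simp

lemma L_uminus [simp]: "f \<in> L \<Longrightarrow> - f \<in> L"
  using L_mult[OF L_kc[of "-1"], of f] by simp

lemma L_diff [simp]: "f \<in> L \<Longrightarrow> g \<in> L \<Longrightarrow> f - g \<in> L"
  using L_add[of f "- g"] by simp

lemma L_divide [simp]: "f \<in> L \<Longrightarrow> g \<in> L \<Longrightarrow> f / g \<in> L"
  by (simp add: divide_inverse)

lemma L_power [simp]: "f \<in> L \<Longrightarrow> f ^ n \<in> L"
  by (induction n) simp_all

lemma L_powi [simp]: "f \<in> L \<Longrightarrow> f powi n \<in> L"
  by (simp add: power_int_def)

lemma L_prod [simp]: "(\<And>i. i \<in> A \<Longrightarrow> f i \<in> L) \<Longrightarrow> prod f A \<in> L"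
  by (induction A rule: infinite_finite_induct) simp_all

fun val :: "'a point \<Rightarrow> 'a ff \<Rightarrow> 'a \<Rightarrow> bool" where
  "val (Affine x y) f c = lval gX gY x y f c"
| "val Infinity f c = lval (gX / gY) (1 / gY) 0 0 f c"

lemma chart_affine:
  assumes "on_curve E (Affine x y)"
  shows "chart gX gY x y"
proof
  fix a assume "ev a = 0"
  then obtain q where "a = weier_poly E * q" by (auto simp: ev_eq_0_iff elim!: dvdE)
  moreover have "eval2 (weier_poly E) x y = 0"
    using assms by (simp add: weier_poly_def algebra_simps power2_eq_square power3_eq_cube)
  ultimately show "eval2 a x y = 0" by simp
qed

text \<open>A relation between x / y and 1 / y clears to a multiple of the Weierstrass polynomial,
  and such a multiple vanishes at (0 : 1 : 0) by \<open>weier_poly_mult_top\<close>.\<close>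

lemma chart_infinity: "chart (gX / gY) (1 / gY) 0 0"
proof
  fix b assume b: "ev2 b (gX / gY) (1 / gY) = 0"
  obtain a N where a: "total_degree_le a N" "ev a = gY ^ N * ev2 b (gX / gY) (1 / gY)"
    "Polynomial.coeff (Polynomial.coeff a N) 0 = eval2 b 0 0"
    using from_infinity_chart[of b] gY_nonzero by blast
  then have "weier_poly E dvd a" using b ev_eq_0_iff by simp
  then show "eval2 b 0 0 = 0" using a weier_poly_mult_top by (metis dvdE)
qed

context
  fixes P assumes P: "on_curve E P"
begin

lemma val_const: "val P (kc c) c"
  using P chart.lval_const[OF chart_affine] chart.lval_const[OF chart_infinity] by (cases P) auto

lemma val_0: "val P 0 0" and val_1: "val P 1 1"
  using val_const[of 0] val_const[of 1] by simp_all

lemma val_add: "val P f c \<Longrightarrow> val P g d \<Longrightarrow> val P (f + g) (c + d)"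
  using P chart.lval_add[OF chart_affine] chart.lval_add[OF chart_infinity] by (cases P) auto

lemma val_mult: "val P f c \<Longrightarrow> val P g d \<Longrightarrow> val P (f * g) (c * d)"
  using P chart.lval_mult[OF chart_affine] chart.lval_mult[OF chart_infinity] by (cases P) auto

lemma val_inverse: "val P f c \<Longrightarrow> c \<noteq> 0 \<Longrightarrow> val P (inverse f) (inverse c)"
  using P chart.lval_inverse[OF chart_affine] chart.lval_inverse[OF chart_infinity] by (cases P) auto

lemma val_unique: "val P f c \<Longrightarrow> val P f d \<Longrightarrow> c = d"
  using P chart.lval_unique[OF chart_affine] chart.lval_unique[OF chart_infinity] by (cases P) auto

lemma val_uminus: "val P f c \<Longrightarrow> val P (- f) (- c)"
  using val_mult[OF val_const[of "-1"]] by fastforce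

lemma val_diff: "val P f c \<Longrightarrow> val P g d \<Longrightarrow> val P (f - g) (c - d)"
  using val_add[OF _ val_uminus] by fastforce

lemma val_divide: "val P f c \<Longrightarrow> val P g d \<Longrightarrow> d \<noteq> 0 \<Longrightarrow> val P (f / g) (c / d)"
  using val_mult[OF _ val_inverse] by (simp add: divide_inverse)

lemma val_power: "val P f c \<Longrightarrow> val P (f ^ n) (c ^ n)"
  by (induction n) (auto intro: val_1 val_mult)

lemma val_powi: "val P f c \<Longrightarrow> c \<noteq> 0 \<Longrightarrow> val P (f powi n) (c powi n)"
  by (auto simp: power_int_def intro!: val_power val_inverse)

lemma val_L: "val P f c \<Longrightarrow> f \<in> L"
proof -
  have ev2_L: "u \<in> L \<Longrightarrow> v \<in> L \<Longrightarrow> ev2 a u v \<in> L" for a u v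
    by (induction a rule: poly_poly_induct) simp_all
  show "val P f c \<Longrightarrow> f \<in> L" by (cases P) (auto simp: lval_def ev2_L)
qed

lemma val_nonzero: "val P f c \<Longrightarrow> c \<noteq> 0 \<Longrightarrow> f \<noteq> 0"
  using val_unique val_0 by blast

end

lemma val_ev: "on_curve E (Affine x y) \<Longrightarrow> val (Affine x y) (ev a) (eval2 a x y)"
  using chart.lval_ev2[OF chart_affine] by simp

lemma val_gX: "on_curve E (Affine x y) \<Longrightarrow> val (Affine x y) gX x"
  and val_gY: "on_curve E (Affine x y) \<Longrightarrow> val (Affine x y) gY y"
  and val_pX: "on_curve E (Affine x y) \<Longrightarrow> val (Affine x y) (pX p) (poly p x)"
  using val_ev[of x y "[:[:0,1:]:]"] val_ev[of x y "[:0,1:]"] val_ev[of x y "[:p:]"] by simp_all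

end

text \<open>The two coordinate differences generate the maximal ideal by \<open>ev2_expand\<close>,
  so an element dividing both of them divides everything that vanishes at the point.\<close>

lemma (in chart) uniformizer_factor:
  assumes t: "u - kc u\<^sub>0 = t * g" "v - kc v\<^sub>0 = t * h" and g: "lv g c" and h: "lv h d"
    and f: "lv f 0"
  shows "\<exists>k e. lv k e \<and> f = t * k"
proof -
  obtain a b where ab: "eval2 b u\<^sub>0 v\<^sub>0 \<noteq> 0" "f = ev2 a u v / ev2 b u v" "0 = eval2 a u\<^sub>0 v\<^sub>0 / eval2 b u\<^sub>0 v\<^sub>0"
    using f unfolding lval_def by blast
  obtain A B where "ev2 a u v = kc (eval2 a u\<^sub>0 v\<^sub>0) + (u - kc u\<^sub>0) * ev2 A u v + (v - kc v\<^sub>0) * ev2 B u v"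
    using ev2_expand by blast
  then have "ev2 a u v = t * (g * ev2 A u v + h * ev2 B u v)"
    using ab unfolding t by (simp add: algebra_simps)
  then have "f = t * ((g * ev2 A u v + h * ev2 B u v) * inverse (ev2 b u v))"
    using ab(2) by (simp add: divide_inverse)
  moreover have "lv ((g * ev2 A u v + h * ev2 B u v) * inverse (ev2 b u v))
    ((c * eval2 A u\<^sub>0 v\<^sub>0 + d * eval2 B u\<^sub>0 v\<^sub>0) * inverse (eval2 b u\<^sub>0 v\<^sub>0))"
    by (intro lval_mult lval_add lval_inverse lval_ev2 g h ab(1))
  ultimately show ?thesis by blast
qed

section \<open>Regular functions, units and uniformizers\<close>

context ec
begin

definition reg :: "'a point \<Rightarrow> 'a ff \<Rightarrow> bool" where
  "reg P f \<longleftrightarrow> (\<exists>c. val P f c)"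

definition unit_at :: "'a point \<Rightarrow> 'a ff \<Rightarrow> bool" where
  "unit_at P f \<longleftrightarrow> (\<exists>c. c \<noteq> 0 \<and> val P f c)"

definition unif :: "'a point \<Rightarrow> 'a ff \<Rightarrow> bool" where
  "unif P t \<longleftrightarrow> val P t 0 \<and> (\<forall>f. val P f 0 \<longrightarrow> (\<exists>g. reg P g \<and> f = t * g))"

context
  fixes P assumes P: "on_curve E P"
begin

lemma reg_add: "reg P f \<Longrightarrow> reg P g \<Longrightarrow> reg P (f + g)"
  unfolding reg_def using val_add[OF P] by blast

lemma reg_mult: "reg P f \<Longrightarrow> reg P g \<Longrightarrow> reg P (f * g)"
  unfolding reg_def using val_mult[OF P] by blast

lemma reg_const: "reg P (kc c)"
  unfolding reg_def using val_const[OF P] by blast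

lemma unit_mult: "unit_at P f \<Longrightarrow> unit_at P g \<Longrightarrow> unit_at P (f * g)"
  unfolding unit_at_def using val_mult[OF P] mult_eq_0_iff by metis

lemma unit_inverse: "unit_at P f \<Longrightarrow> unit_at P (inverse f)"
  unfolding unit_at_def using val_inverse[OF P] by (metis inverse_nonzero_iff_nonzero)

lemma unit_powi: "unit_at P f \<Longrightarrow> unit_at P (f powi n)"
  unfolding unit_at_def using val_powi[OF P] by (metis power_int_eq_0_iff)

lemma unit_const: "c \<noteq> 0 \<Longrightarrow> unit_at P (kc c)"
  unfolding unit_at_def using val_const[OF P] by blast

lemma unit_1: "unit_at P 1"
  using unit_const[of 1] by simp

lemma unit_reg: "unit_at P f \<Longrightarrow> reg P f"
  unfolding unit_at_def reg_def by blast

lemma unit_nonzero: "unit_at P f \<Longrightarrow> f \<noteq> 0"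
  unfolding unit_at_def using val_nonzero[OF P] by blast

lemma reg_L: "reg P f \<Longrightarrow> f \<in> L"
  unfolding reg_def using val_L[OF P] by blast

lemma unit_L: "unit_at P f \<Longrightarrow> f \<in> L"
  using reg_L unit_reg by blast

lemma unit_add: "unit_at P f \<Longrightarrow> val P g 0 \<Longrightarrow> unit_at P (f + g)"
  unfolding unit_at_def using val_add[OF P] by (metis add.right_neutral)

lemma val_0_mult_reg: "val P t 0 \<Longrightarrow> reg P g \<Longrightarrow> val P (t * g) 0"
  unfolding reg_def using val_mult[OF P] by (metis mult_zero_left)

lemma not_unit_val_0: "val P f 0 \<Longrightarrow> \<not> unit_at P f"
  unfolding unit_at_def using val_unique[OF P] by blast

lemma reg_cases: "reg P f \<Longrightarrow> unit_at P f \<or> val P f 0"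
  unfolding reg_def unit_at_def by metis

end

lemma unifI:
  assumes "val P t 0" "\<And>f. val P f 0 \<Longrightarrow> \<exists>k e. val P k e \<and> f = t * k"
  shows "unif P t"
  unfolding unif_def reg_def using assms by blast

lemma val_gXgY_infinity: "val Infinity (gX / gY) 0" "val Infinity (1 / gY) 0"
  using chart.lval_ev2[OF chart_infinity, of "[:[:0,1:]:]"] chart.lval_ev2[OF chart_infinity, of "[:0,1:]"]
  by simp_all

text \<open>
  With \<open>z = x / y\<close> and \<open>w = 1 / y\<close> the Weierstrass equation reads
  \<open>w (1 + a\<^sub>1 z + a\<^sub>3 w - a\<^sub>2 z\<^sup>2 - a\<^sub>4 z w - a\<^sub>6 w\<^sup>2) = z\<^sup>3\<close>.
\<close>

lemma infinity_chart_unit: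
  obtains q where "unit_at Infinity q" "1 / gY = (gX / gY) ^ 3 * q"
proof -
  define z w where "z = gX / gY" and "w = 1 / gY"
  define q where "q = 1 + kc a1 * z + kc a3 * w - kc a2 * z ^ 2 - kc a4 * z * w - kc a6 * w ^ 2"
  have O: "on_curve E Infinity" by simp
  have "val Infinity q (1 + a1 * 0 + a3 * 0 - a2 * 0 ^ 2 - a4 * 0 * 0 - a6 * 0 ^ 2)"
    unfolding q_def z_def w_def
    by (intro val_add val_diff val_mult val_power val_const val_1 O val_gXgY_infinity)
  then have q: "val Infinity q 1" by simp
  then have nz: "q \<noteq> 0" using val_nonzero[OF O] by (metis zero_neq_one)
  have "gY * w = 1" "gY * z = gX" using gY_nonzero by (simp_all add: w_def z_def)
  then have "gY ^ 3 * (w * q) = gY ^ 3 * z ^ 3"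
    unfolding q_def using gY by Groebner_Basis.algebra
  then have "w * q = z ^ 3" using gY_nonzero by simp
  then have "w = z ^ 3 * inverse q" using nz by (simp add: field_simps)
  moreover have "unit_at Infinity (inverse q)"
    using q unit_inverse[OF O] unfolding unit_at_def by (metis zero_neq_one)
  ultimately show ?thesis using that by (simp add: z_def w_def)
qed

lemma unif_infinity: "unif Infinity (gX / gY)"
proof -
  interpret chart "gX / gY" "1 / gY" 0 0 by (rule chart_infinity)
  obtain q where q: "unit_at Infinity q" "1 / gY = (gX / gY) ^ 3 * q" by (rule infinity_chart_unit)
  have eq: "gX / gY - kc 0 = (gX / gY) * kc 1" "1 / gY - kc 0 = (gX / gY) * ((gX / gY) ^ 2 * q)"
    using q(2) by (simp_all add: power2_eq_square power3_eq_cube mult_ac)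
  obtain c where "val Infinity q c" using q unfolding unit_at_def by blast
  then have "val Infinity ((gX / gY) ^ 2 * q) (0 ^ 2 * c)"
    by (intro val_mult val_power val_gXgY_infinity) simp_all
  then show ?thesis
    using uniformizer_factor[OF eq lval_const[of 1]] val_gXgY_infinity(1) by (intro unifI) simp_all
qed

text \<open>With x = z / w and y = 1 / w, the relation between w and z^3 yields the pole orders 2
  and 3.\<close>

lemma gX_gY_infinity:
  obtains g h where "unit_at Infinity g" "gX = (gX / gY) powi (-2) * g"
    "unit_at Infinity h" "gY = (gX / gY) powi (-3) * h"
proof -
  obtain q where q: "unit_at Infinity q" "1 / gY = (gX / gY) ^ 3 * q" by (rule infinity_chart_unit)
  have O: "on_curve E Infinity" by simp
  have nz: "q \<noteq> 0" using unit_nonzero[OF O q(1)] .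
  have "gY ^ 2 = gX ^ 3 * q"
    using q(2) gY_nonzero by (simp add: field_simps power2_eq_square power3_eq_cube)
  then have "gY ^ 2 = (gX * q) * gX ^ 2" "gY ^ 3 = (gY * q) * gX ^ 3" by Groebner_Basis.algebra+
  then have "gY ^ 2 / gX ^ 2 = gX * q" "gY ^ 3 / gX ^ 3 = gY * q"
    using gX_nonzero by simp_all
  then have "gX = (gX / gY) powi (-2) * inverse q" "gY = (gX / gY) powi (-3) * inverse q"
    using nz by (simp_all add: power_int_minus power_divide)
  then show ?thesis using that unit_inverse[OF O q(1)] by blast
qed

text \<open>The difference of the Weierstrass equations at the generic point and at the given one.
  The values of the two cofactors at the point are, up to sign, the partial derivatives there, so by
  smoothness one cofactor is a unit.\<close>

lemma affine_factor:
  assumes "on_curve E (Affine x y)"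
  shows "(gY - kc y) * (gY + kc y + kc a1 * gX + kc a3) =
    (gX - kc x) * (gX ^ 2 + gX * kc x + kc x ^ 2 + kc a2 * (gX + kc x) + kc a4 - kc a1 * kc y)"
proof -
  have "kc (y ^ 2 + a1 * x * y + a3 * y) = kc (x ^ 3 + a2 * x ^ 2 + a4 * x + a6)"
    using assms by (simp only: on_curve.simps)
  then have "kc y ^ 2 + kc a1 * kc x * kc y + kc a3 * kc y = kc x ^ 3 + kc a2 * kc x ^ 2 + kc a4 * kc x + kc a6"
    by simp
  then show ?thesis using gY by Groebner_Basis.algebra
qed

lemma unif_affine_generic:
  assumes P: "on_curve E (Affine x y)" and s: "2 * y + a1 * x + a3 \<noteq> 0"
  shows "unif (Affine x y) (gX - kc x)"
proof -
  interpret chart gX gY x y by (rule chart_affine[OF P])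
  define s r where "s = gY + kc y + kc a1 * gX + kc a3"
    and "r = gX ^ 2 + gX * kc x + kc x ^ 2 + kc a2 * (gX + kc x) + kc a4 - kc a1 * kc y"
  have "val (Affine x y) s (y + y + a1 * x + a3)"
    unfolding s_def by (intro val_add val_mult val_const val_gX val_gY P)
  then have vs: "val (Affine x y) s (2 * y + a1 * x + a3)" by (simp only: mult_2)
  have vr: "val (Affine x y) r (x ^ 2 + x * x + x ^ 2 + a2 * (x + x) + a4 - a1 * y)"
    unfolding r_def by (intro val_diff val_add val_mult val_power val_const val_gX val_gY P)
  have snz: "s \<noteq> 0" using vs s val_nonzero[OF P] by blast
  have "(gY - kc y) * s = (gX - kc x) * r"
    unfolding s_def r_def by (rule affine_factor[OF P])
  then have eq: "gX - kc x = (gX - kc x) * kc 1" "gY - kc y = (gX - kc x) * (r / s)"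
    using snz by (simp, metis nonzero_eq_divide_eq times_divide_eq_right)
  obtain c where "val (Affine x y) (r / s) c"
    using val_divide[OF P vr vs s] by blast
  then show ?thesis
    using uniformizer_factor[OF eq lval_const[of 1]] val_diff[OF P val_gX[OF P] val_const[OF P, of x]]
    by (intro unifI) simp_all
qed

lemma unif_affine_2torsion:
  assumes P: "on_curve E (Affine x y)" and s: "2 * y + a1 * x + a3 = 0"
  shows "unif (Affine x y) (gY - kc y)"
    and "\<exists>g. unit_at (Affine x y) g \<and> gX - kc x = (gY - kc y) ^ 2 * g"
proof -
  interpret chart gX gY x y by (rule chart_affine[OF P])
  define s r where "s = gY + kc y + kc a1 * gX + kc a3"
    and "r = gX ^ 2 + gX * kc x + kc x ^ 2 + kc a2 * (gX + kc x) + kc a4 - kc a1 * kc y"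
  have "val (Affine x y) s (y + y + a1 * x + a3)"
    unfolding s_def by (intro val_add val_mult val_const val_gX val_gY P)
  then have vs: "val (Affine x y) s 0" using s by (simp only: mult_2)
  have "val (Affine x y) r (x ^ 2 + x * x + x ^ 2 + a2 * (x + x) + a4 - a1 * y)"
    unfolding r_def by (intro val_diff val_add val_mult val_power val_const val_gX val_gY P)
  then have vr: "val (Affine x y) r (3 * x ^ 2 + 2 * a2 * x + a4 - a1 * y)"
    by (simp add: power2_eq_square algebra_simps)
  have r0: "3 * x ^ 2 + 2 * a2 * x + a4 - a1 * y \<noteq> 0" using smooth[OF P] s by blast
  have rnz: "r \<noteq> 0" using vr r0 val_nonzero[OF P] by blast
  have fact: "(gY - kc y) * s = (gX - kc x) * r"
    unfolding s_def r_def by (rule affine_factor[OF P])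
  then have eq: "gX - kc x = (gY - kc y) * (s / r)" "gY - kc y = (gY - kc y) * kc 1"
    using rnz by (metis nonzero_eq_divide_eq times_divide_eq_right, simp)
  have sr: "val (Affine x y) (s / r) 0" using val_divide[OF P vs vr r0] by simp
  have "val (Affine x y) (gY - kc y) 0"
    using val_diff[OF P val_gY[OF P] val_const[OF P, of y]] by simp
  then show "unif (Affine x y) (gY - kc y)"
    using uniformizer_factor[OF eq _ lval_const[of 1]] sr by (intro unifI) simp_all
  \<comment> \<open>As the derivative in y vanishes, \<open>s\<close> is itself divisible by
    \<open>gY - kc y\<close>; inserted into \<open>gX - kc x = (gY - kc y) * (s / r)\<close> this
    produces the square.\<close>
  have "kc (2 * y + a1 * x + a3) = 0" using s by (simp only: kc.zero)
  then have s': "s = (gY - kc y) + kc a1 * (gX - kc x)"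
    unfolding s_def by (simp add: algebra_simps)
  define k where "k = s / r"
  have "s = (gY - kc y) * (1 + kc a1 * k)"
    using s' eq(1)[folded k_def] by Groebner_Basis.algebra
  then have "s = (gY - kc y) * (1 + kc a1 * (s / r))" by (simp only: k_def)
  then have "gX - kc x = (gY - kc y) ^ 2 * ((1 + kc a1 * (s / r)) / r)"
    using eq(1) by (metis (no_types, lifting) power2_eq_square mult.assoc times_divide_eq_right)
  moreover have "val (Affine x y) ((1 + kc a1 * (s / r)) / r) ((1 + a1 * 0) / (3 * x ^ 2 + 2 * a2 * x + a4 - a1 * y))"
    by (intro val_divide val_add val_mult val_const val_1 P sr vr r0)
  ultimately show "\<exists>g. unit_at (Affine x y) g \<and> gX - kc x = (gY - kc y) ^ 2 * g"
    unfolding unit_at_def using r0 by (metis add.right_neutral divide_eq_0_iff mult_zero_right zero_neq_one)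
qed

lemma unif_exists: "on_curve E P \<Longrightarrow> \<exists>t. unif P t"
proof (cases P)
  case Infinity
  then show ?thesis using unif_infinity by blast
next
  case (Affine x y)
  assume "on_curve E P"
  then show ?thesis unfolding Affine
    using unif_affine_generic unif_affine_2torsion(1) by blast
qed

lemma unif_nonzero:
  assumes P: "on_curve E P" and "unif P t"
  shows "t \<noteq> 0"
proof
  assume "t = 0"
  then have z: "val P f 0 \<Longrightarrow> f = 0" for f using assms unfolding unif_def by auto
  show False
  proof (cases P)
    case Infinity
    then show ?thesis using z[of "gX / gY"] val_gXgY_infinity(1) gX_nonzero gY_nonzero by (metis divide_eq_0_iff)
  next
    case (Affine x y)
    have "val P (gX - kc x) (x - x)"
      unfolding Affine using P Affine by (intro val_diff val_gX val_const) auto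
    then show ?thesis using z gX_neq_const by fastforce
  qed
qed

definition ordt :: "'a point \<Rightarrow> 'a ff \<Rightarrow> int \<Rightarrow> 'a ff \<Rightarrow> bool" where
  "ordt P t n f \<longleftrightarrow> (\<exists>g. unit_at P g \<and> f = t powi n * g)"

context
  fixes P t assumes P: "on_curve E P" and t: "unif P t"
begin

lemma t_nonzero: "t \<noteq> 0"
  by (rule unif_nonzero[OF P t])

lemma t_val: "val P t 0"
  using t unfolding unif_def by blast

lemma t_L: "t \<in> L"
  using val_L[OF P t_val] .

lemma reg_t_power: "reg P (t ^ n)"
  using val_power[OF P t_val] unfolding reg_def by blast

lemma ordt_mult: "ordt P t n f \<Longrightarrow> ordt P t k g \<Longrightarrow> ordt P t (n + k) (f * g)"
  unfolding ordt_def
proof (elim exE conjE)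
  fix u v assume "unit_at P u" "unit_at P v" "f = t powi n * u" "g = t powi k * v"
  then show "\<exists>w. unit_at P w \<and> f * g = t powi (n + k) * w"
    by (intro exI[of _ "u * v"]) (simp add: power_int_add t_nonzero unit_mult[OF P])
qed

lemma ordt_inverse: "ordt P t n f \<Longrightarrow> ordt P t (- n) (inverse f)"
  unfolding ordt_def
proof (elim exE conjE)
  fix u assume "unit_at P u" "f = t powi n * u"
  then show "\<exists>w. unit_at P w \<and> inverse f = t powi (- n) * w"
    by (intro exI[of _ "inverse u"]) (simp add: power_int_minus unit_inverse[OF P])
qed

lemma ordt_unit: "unit_at P u \<Longrightarrow> ordt P t 0 u"
  unfolding ordt_def by (intro exI[of _ u]) simp

lemma ordt_power: "ordt P t n f \<Longrightarrow> ordt P t (int k * n) (f ^ k)"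
proof (induction k)
  case 0
  show ?case using ordt_unit[OF unit_1[OF P]] by simp
next
  case (Suc k)
  then show ?case using ordt_mult[OF Suc.prems Suc.IH[OF Suc.prems]] by (simp add: algebra_simps)
qed

lemma ordt_pos:
  assumes "ordt P t n f" "n > 0"
  shows "val P f 0"
proof -
  obtain u where u: "unit_at P u" "f = t powi n * u" using assms ordt_def by blast
  define k where "k = nat (n - 1)"
  have n: "n = 1 + int k" using assms(2) by (simp add: k_def)
  have "f = t * (t ^ k * u)"
    using u(2) unfolding n by (simp add: power_int_add t_nonzero mult.assoc)
  moreover have "reg P (t ^ k * u)"
    by (intro reg_mult[OF P] unit_reg[OF P u(1)] reg_t_power)
  ultimately show ?thesis using val_0_mult_reg[OF P t_val] by simp
qed

lemma ordt_unique:
  assumes "ordt P t n f" "ordt P t k f"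
  shows "n = k"
proof -
  have aux: "\<not> n < k" if f: "ordt P t n f" "ordt P t k f" for n k
  proof
    assume "n < k"
    obtain u where "unit_at P u" "f = t powi n * u" using f ordt_def by blast
    then have "f \<noteq> 0" using unit_nonzero[OF P] t_nonzero by simp
    have "ordt P t (k + - n) (f * inverse f)" by (intro ordt_mult ordt_inverse f)
    then have "val P 1 0" using ordt_pos[of "k - n" 1] \<open>n < k\<close> \<open>f \<noteq> 0\<close> by simp
    then show False using not_unit_val_0[OF P] unit_1[OF P] by blast
  qed
  show ?thesis using aux[OF assms] aux[OF assms(2,1)] by linarith
qed

text \<open>
  An element of the coordinate ring divides its norm, a polynomial in \<open>x\<close>; hence it can only be
  divided finitely often by \<open>t\<close> if this holds for polynomials in \<open>x\<close>.
\<close>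

lemma ordt_exists_from_polys:
  assumes reg: "\<And>a. \<exists>j. reg P (t ^ j * ev a)"
    and pX: "\<And>p. p \<noteq> 0 \<Longrightarrow> \<exists>n. ordt P t n (pX p)"
    and f: "f \<in> L" "f \<noteq> 0"
  shows "\<exists>n. ordt P t n f"
proof -
  have main: "\<exists>n. ordt P t n (ev a)" if "ev a \<noteq> 0" for a
  proof -
    obtain u v q where "a = weier_poly E * q + [:u, v:]" and uv: "ev a = pX u + pX v * gY"
      by (rule mod_weier_poly)
    define r where "r = ev a"
    define r' where "r' = ev [:u - lin * v, - v:]"
    define p where "p = u ^ 2 - lin * u * v - cub * v ^ 2"
    have "r' = pX u - pX v * (gY + pX lin)"
      unfolding r'_def by (simp add: ring_distribs)
    then have rr': "r * r' = pX p"
      using norm_eq[of u v] by (simp only: r_def uv p_def)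
    have "u \<noteq> 0 \<or> v \<noteq> 0" using that unfolding uv gY_independent by blast
    then have "p \<noteq> 0" unfolding p_def by (rule norm_nonzero)
    then obtain N where N: "ordt P t N (r * r')" using pX rr' by metis
    \<comment> \<open>At infinity elements of the coordinate ring have poles, so the element and its
      conjugate are first multiplied by powers of \<open>t\<close>.\<close>
    obtain j j' where j: "reg P (t ^ j * r)" "reg P (t ^ j' * r')"
      unfolding r_def r'_def using reg by blast
    define R where "R = t ^ j * r"
    define R' where "R' = t ^ j' * r'"
    have "ordt P t (int (j + j')) (t ^ (j + j'))"
      unfolding ordt_def using unit_1[OF P] by (metis mult.right_neutral power_int_of_nat)
    from ordt_mult[OF this N] have N': "ordt P t (int (j + j') + N) (R * R')"
      by (simp add: R_def R'_def power_add algebra_simps)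
    define N'' where "N'' = int (j + j') + N"
    \<comment> \<open>A power of \<open>t\<close> dividing \<open>R\<close> also divides
      \<open>R * R'\<close>, whose order \<open>N''\<close> is known.\<close>
    have bound: "int n \<le> N''" if "R = t ^ n * g" "reg P g" for n g
    proof (rule ccontr)
      assume "\<not> int n \<le> N''"
      obtain w where w: "unit_at P w" "R * R' = t powi N'' * w" using N' unfolding ordt_def N''_def by blast
      define k where "k = nat (int n - N'' - 1)"
      have n: "int n = N'' + (1 + int k)" using \<open>\<not> int n \<le> N''\<close> by (simp add: k_def)
      have "t ^ n = t powi N'' * (t * t ^ k)"
        unfolding power_int_of_nat[of t n, symmetric] n by (simp add: power_int_add t_nonzero)
      then have "t powi N'' * w = t powi N'' * (t * (t ^ k * (g * R')))"
        unfolding w(2)[symmetric] that(1) by (simp only: mult.assoc)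
      then have "w = t * (t ^ k * (g * R'))" using t_nonzero by simp
      moreover have "reg P (t ^ k * (g * R'))"
        using j(2)[folded R'_def] by (intro reg_mult[OF P] reg_t_power that(2))
      ultimately have "val P w 0" using val_0_mult_reg[OF P t_val] by simp
      with w(1) show False using not_unit_val_0[OF P] by blast
    qed
    \<comment> \<open>The largest power of \<open>t\<close> dividing \<open>R\<close>: a cofactor
      that were not a unit would admit a further factor \<open>t\<close>.\<close>
    define n where "n = (GREATEST n. \<exists>g. R = t ^ n * g \<and> reg P g)"
    have bound': "y \<le> nat N''" if "\<exists>g. R = t ^ y * g \<and> reg P g" for y
      using that bound by fastforce
    have "\<exists>g. R = t ^ 0 * g \<and> reg P g" using j(1) by (simp add: R_def)
    then have "\<exists>g. R = t ^ n * g \<and> reg P g"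
      unfolding n_def by (rule GreatestI_nat[OF _ bound'])
    then obtain g where g: "R = t ^ n * g" "reg P g" by blast
    have "unit_at P g"
    proof (rule ccontr)
      assume "\<not> unit_at P g"
      then have "val P g 0" using reg_cases[OF P g(2)] by blast
      then obtain g' where "reg P g'" "g = t * g'" using t unfolding unif_def by blast
      then have "\<exists>g. R = t ^ (Suc n) * g \<and> reg P g" using g(1) by (intro exI[of _ g']) (simp add: algebra_simps)
      then have "Suc n \<le> n" unfolding n_def
        by (rule Greatest_le_nat[OF _ bound'])
      then show False by simp
    qed
    then have "ordt P t (int n - int j) r"
      unfolding ordt_def using g(1) t_nonzero
      by (intro exI[of _ g]) (simp add: R_def power_int_diff field_simps)
    then show ?thesis unfolding r_def by blast
  qed
  obtain a b where ab: "f = ev a / ev b" "ev b \<noteq> 0" using f(1) unfolding L_def by blast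
  then obtain n k where "ordt P t n (ev a)" "ordt P t k (ev b)" using main f(2) by force
  then have "ordt P t (n + - k) (ev a * inverse (ev b))" by (intro ordt_mult ordt_inverse)
  then show ?thesis unfolding ab(1) divide_inverse by blast
qed

end

end

section \<open>The order function at a point\<close>

context ec
begin

lemma unif_change:
  assumes P: "on_curve E P" and t: "unif P t" "unif P t'"
  shows "\<exists>g. unit_at P g \<and> t' = t * g"
proof -
  obtain g g' where g: "reg P g" "t' = t * g" "reg P g'" "t = t' * g'"
    using t unfolding unif_def by meson
  then have "t * (g * g') = t * 1" by (metis mult.assoc mult.right_neutral)
  then have "g * g' = 1" using unif_nonzero[OF P t(1)] by simp
  moreover obtain c c' where c: "val P g c" "val P g' c'" using g unfolding reg_def by blast
  ultimately have "val P 1 (c * c')" using val_mult[OF P c] by simp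
  then have "c \<noteq> 0" using val_unique[OF P _ val_1[OF P]] by fastforce
  then show ?thesis using g(2) c unfolding unit_at_def by blast
qed

lemma ordt_change:
  assumes P: "on_curve E P" and t: "unif P t" "unif P t'" and f: "ordt P t' n f"
  shows "ordt P t n f"
proof -
  obtain g where g: "unit_at P g" "t' = t * g" using unif_change[OF P t] by blast
  obtain h where h: "unit_at P h" "f = t' powi n * h" using f unfolding ordt_def by blast
  have "f = t powi n * (g powi n * h)" using g h by (simp add: power_int_mult_distrib)
  then show ?thesis unfolding ordt_def using unit_mult[OF P unit_powi[OF P g(1)] h(1)] by blast
qed

lemma ordt_exists_infinity:
  assumes f: "f \<in> L" "f \<noteq> 0"
  shows "\<exists>n. ordt Infinity (gX / gY) n f"
proof -
  have O: "on_curve E Infinity" by simp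
  define t where "t = gX / gY"
  have t: "unif Infinity t" unfolding t_def by (rule unif_infinity)
  note nz = unif_nonzero[OF O t]
  obtain g h where gh: "unit_at Infinity g" "gX = t powi (-2) * g" "unit_at Infinity h" "gY = t powi (-3) * h"
    unfolding t_def by (rule gX_gY_infinity)
  have oX: "ordt Infinity t (-2) gX" and oY: "ordt Infinity t (-3) gY"
    unfolding ordt_def using gh by blast+
  have reg: "\<exists>j. reg Infinity (t ^ j * ev a)" for a
  proof (induction a rule: poly_poly_induct)
    case (const c)
    show ?case by (rule exI[of _ 0]) (simp add: reg_const[OF O])
  next
    case varX
    have "t ^ 2 * gX = g" using gh(2) nz by (simp add: power_int_minus field_simps)
    then show ?case using unit_reg[OF O gh(1)] by (intro exI[of _ 2]) simp
  next
    case varY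
    have "t ^ 3 * gY = h" using gh(4) nz by (simp add: power_int_minus field_simps)
    then show ?case using unit_reg[OF O gh(3)] by (intro exI[of _ 3]) simp
  next
    case (add a b)
    then obtain j k where jk: "reg Infinity (t ^ j * ev a)" "reg Infinity (t ^ k * ev b)" by blast
    have "reg Infinity (t ^ k * (t ^ j * ev a) + t ^ j * (t ^ k * ev b))"
      by (intro reg_add[OF O] reg_mult[OF O] jk reg_t_power[OF O t])
    then show ?case by (intro exI[of _ "j + k"]) (simp add: power_add algebra_simps)
  next
    case (mult a b)
    then obtain j k where jk: "reg Infinity (t ^ j * ev a)" "reg Infinity (t ^ k * ev b)" by blast
    have "reg Infinity ((t ^ j * ev a) * (t ^ k * ev b))" by (intro reg_mult[OF O] jk)
    then show ?case by (intro exI[of _ "j + k"]) (simp add: power_add algebra_simps)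
  qed
  have pX: "\<exists>n. ordt Infinity t n (pX p)" if "p \<noteq> 0" for p
  proof -
    have "ordt Infinity t (- 2 * int (Polynomial.degree p)) (pX p)" using that
    proof (induction p)
      case (pCons c p)
      show ?case
      proof (cases "p = 0")
        case True
        then show ?thesis using pCons.prems ordt_unit[OF O t unit_const[OF O, of c]] by simp
      next
        case False
        define d where "d = Polynomial.degree p"
        have "ordt Infinity t (-2 + - 2 * int d) (gX * pX p)"
          unfolding d_def by (intro ordt_mult[OF O t] oX pCons.IH False)
        then obtain u where u: "unit_at Infinity u" "gX * pX p = t powi (-2 + - 2 * int d) * u"
          unfolding ordt_def by blast
        \<comment> \<open>Once the pole of \<open>gX * pX p\<close> is factored out, the constant
          \<open>c\<close> carries the factor t^(2 d + 2); it vanishes at infinity and cannot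
          destroy the unit.\<close>
        have "val Infinity (t ^ (2 * d + 2) * kc c) (0 ^ (2 * d + 2) * c)"
          by (intro val_mult[OF O] val_power[OF O] t_val[OF O t] val_const[OF O])
        then have "unit_at Infinity (u + t ^ (2 * d + 2) * kc c)"
          by (intro unit_add[OF O u(1)]) simp
        moreover have tc: "t powi (-2 + - 2 * int d) * (t ^ (2 * d + 2) * kc c) = kc c"
        proof -
          have "t powi (-2 + - 2 * int d) * t powi (int (2 * d + 2)) = t powi 0"
            by (subst power_int_add[symmetric]) (use nz in auto)
          then have "t powi (-2 + - 2 * int d) * t ^ (2 * d + 2) = 1"
            by (simp only: power_int_of_nat power_int_0_right)
          then show ?thesis by (simp only: mult.assoc[symmetric] mult_1_left)
        qed
        moreover have "kc c + gX * pX p = t powi (-2 + - 2 * int d) * (u + t ^ (2 * d + 2) * kc c)"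
          unfolding u(2) distrib_left tc by (rule add.commute)
        ultimately have "ordt Infinity t (-2 + - 2 * int d) (kc c + gX * pX p)"
          unfolding ordt_def by blast
        then show ?thesis using False by (simp add: d_def)
      qed
    qed simp
    then show ?thesis by blast
  qed
  show ?thesis using ordt_exists_from_polys[OF O t reg pX f] unfolding t_def .
qed

lemma ordt_exists_affine:
  assumes P: "on_curve E (Affine x y)" and t: "unif (Affine x y) t"
    and e: "ordt (Affine x y) t e (gX - kc x)" and f: "f \<in> L" "f \<noteq> 0"
  shows "\<exists>n. ordt (Affine x y) t n f"
proof (rule ordt_exists_from_polys[OF P t _ _ f])
  show "\<exists>j. reg (Affine x y) (t ^ j * ev a)" for a
    using val_ev[OF P] by (intro exI[of _ 0]) (auto simp: reg_def)
  fix p :: "'a poly" assume "p \<noteq> 0"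
  then obtain q where q: "p = [:- x, 1:] ^ order x p * q" "\<not> [:- x, 1:] dvd q"
    using order_decomp by blast
  have "unit_at (Affine x y) (pX q)"
    using q(2) val_pX[OF P, of q] unfolding unit_at_def poly_eq_0_iff_dvd[symmetric] by blast
  then have "ordt (Affine x y) t (int (order x p) * e + 0) ((gX - kc x) ^ order x p * pX q)"
    by (intro ordt_mult[OF P t] ordt_power[OF P t] ordt_unit[OF P t] e)
  moreover have "pX p = (gX - kc x) ^ order x p * pX q"
    by (subst q(1)) simp
  ultimately show "\<exists>n. ordt (Affine x y) t n (pX p)" by metis
qed

lemma ordt_exists:
  assumes P: "on_curve E P" and t: "unif P t" and f: "f \<in> L" "f \<noteq> 0"
  shows "\<exists>n. ordt P t n f"
proof -
  have "\<exists>t'. unif P t' \<and> (\<exists>n. ordt P t' n f)"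
  proof (cases P)
    case Infinity
    then show ?thesis using unif_infinity ordt_exists_infinity[OF f] by blast
  next
    case (Affine x y)
    note P = P[unfolded Affine]
    show ?thesis
    proof (cases "2 * y + a1 * x + a3 = 0")
      case True
      note t = unif_affine_2torsion[OF P True]
      have "ordt (Affine x y) (gY - kc y) 2 (gX - kc x)" using t(2) unfolding ordt_def by simp
      then show ?thesis using ordt_exists_affine[OF P t(1) _ f] t(1) unfolding Affine by blast
    next
      case False
      note t = unif_affine_generic[OF P False]
      have "ordt (Affine x y) (gX - kc x) 1 (gX - kc x)" using unit_1[OF P] unfolding ordt_def by fastforce
      then show ?thesis using ordt_exists_affine[OF P t _ f] t unfolding Affine by blast
    qed
  qed
  then show ?thesis using ordt_change[OF P t] by blast
qed

text \<open>At the zero function no order exists and \<open>THE\<close> yields an unspecified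
  integer; hence the conditions \<open>f \<noteq> 0\<close> and the disjunctions starting with
  \<open>f = 0\<close> below.\<close>

definition ord :: "'a point \<Rightarrow> 'a ff \<Rightarrow> int" where
  "ord P f = (THE n. \<exists>t. unif P t \<and> ordt P t n f)"

lemma ord_eqI:
  assumes "on_curve E P" "unif P t" "ordt P t n f"
  shows "ord P f = n"
  unfolding ord_def using assms ordt_change ordt_unique by (intro the_equality) blast+

context
  fixes P assumes P: "on_curve E P"
begin

lemma ordt_ord: "unif P t \<Longrightarrow> f \<in> L \<Longrightarrow> f \<noteq> 0 \<Longrightarrow> ordt P t (ord P f) f"
  using ordt_exists[OF P] ord_eqI[OF P] by metis

lemma ord_unif: "unif P t \<Longrightarrow> ord P t = 1"
  by (rule ord_eqI[OF P]) (auto simp: ordt_def intro!: exI[of _ 1] unit_1[OF P])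

lemma ord_mult: "f \<in> L \<Longrightarrow> f \<noteq> 0 \<Longrightarrow> g \<in> L \<Longrightarrow> g \<noteq> 0 \<Longrightarrow> ord P (f * g) = ord P f + ord P g"
  using unif_exists[OF P] ord_eqI[OF P] ordt_mult[OF P] ordt_ord by metis

lemma ord_inverse: "f \<in> L \<Longrightarrow> ord P (inverse f) = - ord P f" if "f \<noteq> 0"
  using unif_exists[OF P] ord_eqI[OF P] ordt_inverse[OF P] ordt_ord that by metis

lemma ord_divide: "f \<in> L \<Longrightarrow> f \<noteq> 0 \<Longrightarrow> g \<in> L \<Longrightarrow> g \<noteq> 0 \<Longrightarrow> ord P (f / g) = ord P f - ord P g"
  by (simp add: divide_inverse ord_mult ord_inverse)

lemma ord_unit: "unit_at P f \<Longrightarrow> ord P f = 0"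
  using unif_exists[OF P] ord_eqI[OF P] ordt_unit[OF P] by metis

lemma ord_const: "c \<noteq> 0 \<Longrightarrow> ord P (kc c) = 0"
  by (rule ord_unit[OF unit_const[OF P]])

lemma ord_power: "f \<in> L \<Longrightarrow> f \<noteq> 0 \<Longrightarrow> ord P (f ^ n) = int n * ord P f"
proof (induction n)
  case 0
  show ?case using ord_const[of 1] by simp
next
  case (Suc n)
  then show ?case by (simp add: ord_mult algebra_simps)
qed

lemma ord_prod:
  "finite A \<Longrightarrow> (\<And>i. i \<in> A \<Longrightarrow> f i \<in> L) \<Longrightarrow> (\<And>i. i \<in> A \<Longrightarrow> f i \<noteq> 0) \<Longrightarrow> ord P (prod f A) = (\<Sum>i\<in>A. ord P (f i))"
proof (induction A rule: finite_induct)
  case empty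
  show ?case using ord_const[of 1] by simp
next
  case (insert i A)
  then show ?case by (simp add: ord_mult)
qed

lemma val_0_iff: "f \<in> L \<Longrightarrow> f \<noteq> 0 \<Longrightarrow> val P f 0 \<longleftrightarrow> ord P f > 0"
  and unit_iff: "f \<in> L \<Longrightarrow> f \<noteq> 0 \<Longrightarrow> unit_at P f \<longleftrightarrow> ord P f = 0"
  and reg_iff: "f \<in> L \<Longrightarrow> f \<noteq> 0 \<Longrightarrow> reg P f \<longleftrightarrow> ord P f \<ge> 0"
proof -
  assume f: "f \<in> L" "f \<noteq> 0"
  obtain t where t: "unif P t" using unif_exists[OF P] by blast
  have pos: "ord P f > 0 \<Longrightarrow> val P f 0" using ordt_pos[OF P t] ordt_ord[OF t f] by blast
  have zero: "ord P f = 0 \<Longrightarrow> unit_at P f" using ordt_ord[OF t f] unfolding ordt_def by auto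
  have neg: "\<not> reg P f" if "ord P f < 0"
  proof
    assume r: "reg P f"
    have "val P (inverse f) 0"
      using ordt_pos[OF P t] ordt_inverse[OF P t ordt_ord[OF t f]] that by simp
    then have "val P (inverse f * f) 0" using val_0_mult_reg[OF P] r by blast
    then show False using f not_unit_val_0[OF P] unit_1[OF P] by simp
  qed
  have reg0: "val P f 0 \<Longrightarrow> reg P f" unfolding reg_def by blast
  show "val P f 0 \<longleftrightarrow> ord P f > 0"
    using pos zero neg reg0 not_unit_val_0[OF P] by (metis linorder_neqE)
  show "unit_at P f \<longleftrightarrow> ord P f = 0" using zero ord_unit by blast
  show "reg P f \<longleftrightarrow> ord P f \<ge> 0"
    using pos zero neg reg0 unit_reg[OF P] by (metis linorder_neqE not_le order.strict_iff_order)
qed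

text \<open>Scaling by \<open>t powi (- n)\<close> reduces the ultrametric inequality to closure of
  the local ring under addition.\<close>

lemma ord_add_ge:
  assumes "f \<in> L" "g \<in> L" "f + g \<noteq> 0" "f = 0 \<or> ord P f \<ge> n" "g = 0 \<or> ord P g \<ge> n"
  shows "ord P (f + g) \<ge> n"
proof -
  obtain t where t: "unif P t" using unif_exists[OF P] by blast
  note tn = t_nonzero[OF P t] and tL = t_L[OF P t]
  have s: "t powi (- n) \<in> L" "t powi (- n) \<noteq> 0" using tn tL by simp_all
  have "ordt P t (- n) (t powi (- n))" unfolding ordt_def using unit_1[OF P] by (metis mult.right_neutral)
  then have o: "ord P (t powi (- n)) = - n" using ord_eqI[OF P t] by blast
  have r: "reg P (t powi (- n) * h)" if "h \<in> L" "h = 0 \<or> ord P h \<ge> n" for h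
  proof (cases "h = 0")
    case True
    then show ?thesis using reg_const[OF P, of 0] by simp
  next
    case False
    then show ?thesis using that s o reg_iff ord_mult by simp
  qed
  have "reg P (t powi (- n) * f + t powi (- n) * g)"
    by (intro reg_add[OF P] r assms)
  then have "reg P (t powi (- n) * (f + g))" by (simp add: distrib_left)
  then show ?thesis using reg_iff[of "t powi (- n) * (f + g)"] ord_mult[of "t powi (- n)" "f + g"] s o assms by simp
qed

lemma ord_uminus: "f \<in> L \<Longrightarrow> f \<noteq> 0 \<Longrightarrow> ord P (- f) = ord P f"
  using ord_mult[of "kc (-1)" f] ord_const[of "-1"] L_kc[of "-1"] by simp

lemma ord_add_less:
  assumes "f \<in> L" "g \<in> L" "f \<noteq> 0" "g = 0 \<or> ord P f < ord P g"
  shows "f + g \<noteq> 0" "ord P (f + g) = ord P f"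
proof -
  show nz: "f + g \<noteq> 0"
  proof
    assume "f + g = 0"
    then have "g = - f" by (simp add: add_eq_0_iff)
    then show False using assms ord_uminus by auto
  qed
  have "ord P (f + g) \<ge> ord P f" using assms nz by (intro ord_add_ge) auto
  moreover have "\<not> ord P (f + g) > ord P f"
  proof
    assume a: "ord P (f + g) > ord P f"
    have "- g = 0 \<or> ord P (- g) \<ge> ord P f + 1"
      using assms(4) ord_uminus[OF assms(2)] by (cases "g = 0") auto
    then have "ord P ((f + g) + (- g)) \<ge> ord P f + 1"
      by (intro ord_add_ge) (use assms a in auto)
    then show False by simp
  qed
  ultimately show "ord P (f + g) = ord P f" by simp
qed

end

end

section \<open>Vertical lines and functions without affine poles\<close>

lemma infinite_UNIV_alg_closed: "infinite (UNIV :: 'a::alg_closed_field set)"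
proof
  assume fin: "finite (UNIV :: 'a set)"
  define p where "p = (\<Prod>a\<in>(UNIV :: 'a set). [:- a, 1:]) + 1"
  have d: "Polynomial.degree (\<Prod>a\<in>(UNIV :: 'a set). [:- a, 1:]) > 0"
    using fin by (subst degree_prod_eq_sum_degree) (auto simp: card_gt_0_iff)
  then have "Polynomial.degree p > 0" unfolding p_def by (subst degree_add_eq_left) auto
  then obtain x where "poly p x = 0" using alg_closed_imp_poly_has_root by blast
  moreover have "poly (\<Prod>a\<in>(UNIV :: 'a set). [:- a, 1:]) x = 0"
    using fin by (subst poly_prod, intro prod_zero) auto
  ultimately show False by (simp add: p_def)
qed

fun ec_neg :: "'a::field weierstrass \<Rightarrow> 'a point \<Rightarrow> 'a point" where
  "ec_neg E Infinity = Infinity"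
| "ec_neg E (Affine x y) = Affine x (- y - wa1 E * x - wa3 E)"

context ec
begin

abbreviation neg where "neg \<equiv> ec_neg E"

lemma point_above: "\<exists>y. on_curve E (Affine x y)"
proof -
  let ?p = "[:- (x ^ 3 + a2 * x ^ 2 + a4 * x + a6), a1 * x + a3, 1:]"
  have "\<exists>y. poly ?p y = 0" by (rule alg_closed_imp_poly_has_root) simp
  then show ?thesis
    by (auto simp: algebra_simps power2_eq_square eq_neg_iff_add_eq_0 neg_eq_iff_add_eq_0)
qed

lemma infinite_points: "infinite {P. on_curve E P}"
proof
  assume "finite {P. on_curve E P}"
  then have "finite ((\<lambda>P. case P of Affine x y \<Rightarrow> x | Infinity \<Rightarrow> 0) ` {P. on_curve E P})" by (rule finite_imageI)
  moreover have "x \<in> (\<lambda>P. case P of Affine x y \<Rightarrow> x | Infinity \<Rightarrow> 0) ` {P. on_curve E P}" for x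
  proof -
    obtain y where "on_curve E (Affine x y)" using point_above by blast
    then show ?thesis by (intro image_eqI[of _ _ "Affine x y"]) auto
  qed
  ultimately show False using infinite_UNIV_alg_closed by (metis UNIV_eq_I)
qed

lemma on_curve_neg [simp]: "on_curve E (neg P) \<longleftrightarrow> on_curve E P"
proof (cases P)
  case (Affine x y)
  have "(- y - a1 * x - a3) ^ 2 + a1 * x * (- y - a1 * x - a3) + a3 * (- y - a1 * x - a3) =
      y ^ 2 + a1 * x * y + a3 * y" by Groebner_Basis.algebra
  then show ?thesis by (simp add: Affine)
qed simp

lemma neg_neg [simp]: "neg (neg P) = P"
  by (cases P) simp_all

lemma on_curve_same_x:
  assumes "on_curve E (Affine x y)" "on_curve E (Affine x y')"
  shows "y' = y \<or> y' = - y - a1 * x - a3"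
proof -
  have "(y' - y) * (y' - (- y - a1 * x - a3)) = 0"
    using assms unfolding on_curve.simps by Groebner_Basis.algebra
  then show ?thesis by (simp only: mult_eq_0_iff right_minus_eq)
qed

lemma ord_gX_infinity: "ord Infinity gX = -2" and ord_gY_infinity: "ord Infinity gY = -3"
proof -
  have O: "on_curve E Infinity" by simp
  obtain g h where gh: "unit_at Infinity g" "gX = (gX / gY) powi (-2) * g"
    "unit_at Infinity h" "gY = (gX / gY) powi (-3) * h"
    by (rule gX_gY_infinity)
  then show "ord Infinity gX = -2" "ord Infinity gY = -3"
    using ord_eqI[OF O unif_infinity] unfolding ordt_def by blast+
qed

lemma ord_add_const:
  assumes "on_curve E P" "f \<in> L" "f \<noteq> 0" "ord P f < 0"
  shows "ord P (f + kc c) = ord P f"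
  using ord_add_less(2)[OF assms(1,2) L_kc assms(3), of c] ord_const[OF assms(1), of c] assms(4)
  by (cases "c = 0") auto

text \<open>A point equal to its negative is counted by both indicators, which matches the double
  zero of the vertical line at a 2-torsion point.\<close>

lemma ord_vertical:
  assumes Q: "on_curve E (Affine x\<^sub>0 y\<^sub>0)" and P: "on_curve E P"
  shows "ord P (gX - kc x\<^sub>0) = of_bool (P = Affine x\<^sub>0 y\<^sub>0) + of_bool (P = neg (Affine x\<^sub>0 y\<^sub>0))
    - 2 * of_bool (P = Infinity)"
proof (cases P)
  case Infinity
  have "ord P (gX + - kc x\<^sub>0) = ord P gX"
    using ord_add_const[OF P, of gX "- x\<^sub>0"] ord_gX_infinity unfolding Infinity by simp
  then show ?thesis using ord_gX_infinity Infinity by simp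
next
  case (Affine x y)
  note P = P[unfolded Affine]
  show ?thesis
  proof (cases "x = x\<^sub>0")
    case False
    then have "unit_at P (gX - kc x\<^sub>0)"
      using val_diff[OF P val_gX[OF P] val_const[OF P, of x\<^sub>0]] unfolding unit_at_def Affine
      by (metis eq_iff_diff_eq_0)
    then show ?thesis using ord_unit[OF P] False unfolding Affine by simp
  next
    case x: True
    note y = on_curve_same_x[OF Q P[unfolded x]]
    show ?thesis
    proof (cases "2 * y + a1 * x + a3 = 0")
      case True
      obtain g where "unit_at (Affine x y) g" "gX - kc x = (gY - kc y) ^ 2 * g"
        using unif_affine_2torsion[OF P True] by blast
      then have "ord P (gX - kc x) = 2"
        unfolding Affine
        by (intro ord_eqI[OF P unif_affine_2torsion(1)[OF P True]]) (auto simp: ordt_def)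
      moreover have self: "- y - a1 * x\<^sub>0 - a3 = y"
        using True x by (simp add: algebra_simps eq_neg_iff_add_eq_0)
      moreover have "y = y\<^sub>0"
      proof (rule disjE[OF y])
        assume "y = - y\<^sub>0 - a1 * x\<^sub>0 - a3"
        then have "- y - a1 * x\<^sub>0 - a3 = y\<^sub>0" by simp
        then show ?thesis using self by simp
      qed
      ultimately show ?thesis using x unfolding Affine by simp
    next
      case False
      have "ord P (gX - kc x) = 1"
        unfolding Affine by (rule ord_unif[OF P unif_affine_generic[OF P False]])
      moreover have ne: "- y - a1 * x\<^sub>0 - a3 \<noteq> y"
        using False x by (auto simp: algebra_simps neg_eq_iff_add_eq_0)
      moreover have "- y\<^sub>0 - a1 * x\<^sub>0 - a3 \<noteq> y\<^sub>0"
        using y ne by metis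
      ultimately show ?thesis using x y unfolding Affine by auto
    qed
  qed
qed

lemma ord_pX_infinity:
  assumes "p \<noteq> 0" shows "ord Infinity (pX p) = - 2 * int (Polynomial.degree p)"
  using assms
proof (induction p)
  case (pCons c p)
  have O: "on_curve E Infinity" by simp
  show ?case
  proof (cases "p = 0")
    case True
    then show ?thesis using pCons ord_const[OF O, of c] by simp
  next
    case False
    then have o: "ord Infinity (gX * pX p) = -2 - 2 * int (Polynomial.degree p)"
      using pCons.IH by (subst ord_mult[OF O]) (auto simp: ord_gX_infinity)
    have "ord Infinity (gX * pX p + kc c) = ord Infinity (gX * pX p)"
      using o False by (intro ord_add_const[OF O]) auto
    then show ?thesis using o False by (simp add: add.commute)
  qed
qed simp

text \<open>The two summands have orders of opposite parity at infinity, so their poles never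
  cancel.\<close>

lemma ord_coordinate_ring_infinity:
  fixes u v defines "f \<equiv> pX u + pX v * gY"
  shows "u \<noteq> 0 \<Longrightarrow> v \<noteq> 0 \<Longrightarrow> ord Infinity f = min (- 2 * int (Polynomial.degree u)) (- 2 * int (Polynomial.degree v) - 3)"
    and "v = 0 \<Longrightarrow> u \<noteq> 0 \<Longrightarrow> ord Infinity f = - 2 * int (Polynomial.degree u)"
    and "u = 0 \<Longrightarrow> v \<noteq> 0 \<Longrightarrow> ord Infinity f = - 2 * int (Polynomial.degree v) - 3"
proof -
  have O: "on_curve E Infinity" by simp
  have o: "ord Infinity (pX v * gY) = - 2 * int (Polynomial.degree v) - 3" if "v \<noteq> 0"
    using that gY_nonzero by (subst ord_mult[OF O]) (auto simp: ord_gY_infinity ord_pX_infinity)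
  show "v = 0 \<Longrightarrow> u \<noteq> 0 \<Longrightarrow> ord Infinity f = - 2 * int (Polynomial.degree u)"
    by (simp add: f_def ord_pX_infinity)
  show "u = 0 \<Longrightarrow> v \<noteq> 0 \<Longrightarrow> ord Infinity f = - 2 * int (Polynomial.degree v) - 3"
    by (simp add: f_def o)
  assume uv: "u \<noteq> 0" "v \<noteq> 0"
  show "ord Infinity f = min (- 2 * int (Polynomial.degree u)) (- 2 * int (Polynomial.degree v) - 3)"
  proof (cases "- 2 * int (Polynomial.degree u) < - 2 * int (Polynomial.degree v) - 3")
    case True
    have "ord Infinity f = ord Infinity (pX u)" unfolding f_def
      by (rule ord_add_less[OF O]) (use uv o True ord_pX_infinity gY_nonzero in auto)
    then show ?thesis using True uv by (simp add: ord_pX_infinity)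
  next
    case False
    moreover have "- 2 * int (Polynomial.degree u) \<noteq> - 2 * int (Polynomial.degree v) - 3" by presburger
    ultimately have l: "- 2 * int (Polynomial.degree v) - 3 < - 2 * int (Polynomial.degree u)" by linarith
    have "ord Infinity (pX v * gY + pX u) = ord Infinity (pX v * gY)"
      by (rule ord_add_less[OF O]) (use uv o l ord_pX_infinity gY_nonzero in auto)
    then show ?thesis using l uv o by (simp add: f_def add.commute)
  qed
qed

text \<open>Multiplication by the conjugate of the denominator turns the denominator into a
  polynomial in x.\<close>

lemma L_over_polys:
  assumes "f \<in> L"
  obtains u v r where "r \<noteq> 0" "f * pX r = pX u + pX v * gY"
proof -
  obtain a b where ab: "f = ev a / ev b" "ev b \<noteq> 0" using assms unfolding L_def by blast
  obtain u v q where "b = weier_poly E * q + [:u, v:]" and uv: "ev b = pX u + pX v * gY"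
    by (rule mod_weier_poly)
  define b' where "b' = [:u - lin * v, - v:]"
  define r where "r = u ^ 2 - lin * u * v - cub * v ^ 2"
  have "ev b' = pX u - pX v * (gY + pX lin)"
    unfolding b'_def by (simp add: ring_distribs)
  then have r: "ev b * ev b' = pX r" using norm_eq[of u v] by (simp only: uv r_def)
  have "u \<noteq> 0 \<or> v \<noteq> 0" using ab(2) unfolding uv gY_independent by blast
  then have "r \<noteq> 0" unfolding r_def by (rule norm_nonzero)
  obtain u' v' q' where "a * b' = weier_poly E * q' + [:u', v':]" and uv': "ev (a * b') = pX u' + pX v' * gY"
    by (rule mod_weier_poly)
  have "f * pX r = ev (a * b')" unfolding r[symmetric] using ab by simp
  then show ?thesis using that \<open>r \<noteq> 0\<close> uv' by metis
qed

text \<open>Each root of the denominator \<open>r\<close> is cancelled against \<open>u\<close> and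
  \<open>v\<close>: as \<open>u + v y\<close> vanishes at the points above the root, two distinct
  points force \<open>u\<close> and \<open>v\<close> to vanish at the root. Where the only point
  above is a 2-torsion point, its second-order information replaces the missing second
  point.\<close>

lemma affine_regular:
  assumes f: "f \<in> L" and reg: "\<And>x y. on_curve E (Affine x y) \<Longrightarrow> reg (Affine x y) f"
  obtains u v where "f = pX u + pX v * gY"
proof -
  have "\<exists>u v. f = pX u + pX v * gY" if "r \<noteq> 0" "f * pX r = pX u + pX v * gY" for r u v
    using that
  proof (induction "Polynomial.degree r" arbitrary: r u v rule: less_induct)
    case less
    show ?case
    proof (cases "Polynomial.degree r = 0")
      case True
      then obtain c where c: "r = [:c:]" by (metis degree_eq_zeroE)
      then have "c \<noteq> 0" using less.prems by auto
      have "f = kc (1 / c) * (pX u + pX v * gY)"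
        using less.prems(2) c \<open>c \<noteq> 0\<close> by (simp add: field_simps)
      also have "\<dots> = pX (Polynomial.smult (1 / c) u) + pX (Polynomial.smult (1 / c) v) * gY"
        by (simp add: ring_distribs)
      finally show ?thesis by blast
    next
      case False
      then obtain x\<^sub>0 where "poly r x\<^sub>0 = 0" using alg_closed_imp_poly_has_root by blast
      then obtain r1 where r1: "r = [:- x\<^sub>0, 1:] * r1" by (auto simp: poly_eq_0_iff_dvd elim: dvdE)
      have r1nz: "r1 \<noteq> 0" using r1 less.prems by auto
      have deg: "Polynomial.degree r1 < Polynomial.degree r"
        unfolding r1 using r1nz by (subst degree_mult_eq) auto
      define g where "g = pX u + pX v * gY"
      have g: "g = f * ((gX - kc x\<^sub>0) * pX r1)"
        unfolding g_def less.prems(2)[symmetric] r1 pX.mult by simp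
      obtain y\<^sub>0 where Q: "on_curve E (Affine x\<^sub>0 y\<^sub>0)" using point_above by blast
      have zero: "poly u x\<^sub>0 + poly v x\<^sub>0 * y = 0" if Q: "on_curve E (Affine x\<^sub>0 y)" for y
      proof -
        have "val (Affine x\<^sub>0 y) g (poly u x\<^sub>0 + poly v x\<^sub>0 * y)"
          unfolding g_def by (intro val_add val_mult val_pX val_gY Q)
        moreover have "val (Affine x\<^sub>0 y) g 0"
        proof -
          obtain c where "val (Affine x\<^sub>0 y) f c" using reg[OF Q] unfolding reg_def by blast
          then have "val (Affine x\<^sub>0 y) g (c * ((x\<^sub>0 - x\<^sub>0) * poly r1 x\<^sub>0))"
            unfolding g by (intro val_diff val_mult val_pX val_gX val_const Q)
          then show ?thesis by simp
        qed
        ultimately show ?thesis using val_unique[OF Q] by blast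
      qed
      have v0: "poly v x\<^sub>0 = 0"
      proof (cases "2 * y\<^sub>0 + a1 * x\<^sub>0 + a3 = 0")
        case False
        have Q': "on_curve E (Affine x\<^sub>0 (- y\<^sub>0 - a1 * x\<^sub>0 - a3))"
          using Q on_curve_neg[of "Affine x\<^sub>0 y\<^sub>0"] by (simp only: ec_neg.simps)
        have "poly v x\<^sub>0 * (2 * y\<^sub>0 + a1 * x\<^sub>0 + a3) = 0"
          using zero[OF Q] zero[OF Q'] by Groebner_Basis.algebra
        then show ?thesis using False by simp
      next
        case True
        obtain u1 v1 where uv: "u = [:- x\<^sub>0, 1:] * u1 + [:poly u x\<^sub>0:]" "v = [:- x\<^sub>0, 1:] * v1 + [:poly v x\<^sub>0:]"
          by (metis synthetic_div_correct' add.commute)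
        obtain q where q: "unit_at (Affine x\<^sub>0 y\<^sub>0) q" "gX - kc x\<^sub>0 = (gY - kc y\<^sub>0) ^ 2 * q"
          using unif_affine_2torsion[OF Q True] by blast
        have t: "gY - kc y\<^sub>0 \<noteq> 0" using unif_nonzero[OF Q unif_affine_2torsion(1)[OF Q True]] .
        have pu: "pX u = (gX - kc x\<^sub>0) * pX u1 + kc (poly u x\<^sub>0)" "pX v = (gX - kc x\<^sub>0) * pX v1 + kc (poly v x\<^sub>0)"
          by (subst uv(1), simp only: pX.add pX.mult, simp)
            (subst uv(2), simp only: pX.add pX.mult, simp)
        have z: "kc (poly u x\<^sub>0) + kc (poly v x\<^sub>0) * kc y\<^sub>0 = 0"
          using zero[OF Q] by (metis kc.add kc.mult kc.zero)
        have e: "f * ((gX - kc x\<^sub>0) * pX r1) = pX u + pX v * gY" using g g_def by simp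
        \<comment> \<open>Here x - x0 is the square of the uniformizer times \<open>q\<close>. All
          terms of \<open>e\<close> except v(x0) (y - y0) contain that square, so v(x0) is divisible
          by the uniformizer and its value is zero.\<close>
        have "(gY - kc y\<^sub>0) * kc (poly v x\<^sub>0) = (gY - kc y\<^sub>0) * ((gY - kc y\<^sub>0) * (q * (f * pX r1 - (pX u1 + pX v1 * gY))))"
          using e z q(2) unfolding pu by Groebner_Basis.algebra
        then have eq: "kc (poly v x\<^sub>0) = (gY - kc y\<^sub>0) * (q * (f * pX r1 - (pX u1 + pX v1 * gY)))"
          using t by simp
        obtain c d where c: "val (Affine x\<^sub>0 y\<^sub>0) q c" "val (Affine x\<^sub>0 y\<^sub>0) f d"
          using q(1) reg[OF Q] unfolding unit_at_def reg_def by blast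
        have "val (Affine x\<^sub>0 y\<^sub>0) (kc (poly v x\<^sub>0)) ((y\<^sub>0 - y\<^sub>0) * (c * (d * poly r1 x\<^sub>0 - (poly u1 x\<^sub>0 + poly v1 x\<^sub>0 * y\<^sub>0))))"
          unfolding eq by (intro val_diff val_add val_mult val_pX val_gX val_gY val_const Q c)
        then show ?thesis using val_unique[OF Q val_const[OF Q]] by fastforce
      qed
      then have "poly u x\<^sub>0 = 0" using zero[OF Q] by simp
      then obtain u1 v1 where uv: "u = [:- x\<^sub>0, 1:] * u1" "v = [:- x\<^sub>0, 1:] * v1"
        using v0 by (auto simp: poly_eq_0_iff_dvd elim!: dvdE)
      have "(gX - kc x\<^sub>0) * (f * pX r1) = (gX - kc x\<^sub>0) * (pX u1 + pX v1 * gY)"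
        using g unfolding g_def uv pX.mult by (simp add: algebra_simps)
      then have "f * pX r1 = pX u1 + pX v1 * gY" using gX_neq_const[of x\<^sub>0] by simp
      then show ?thesis using less.hyps[OF deg r1nz] by blast
    qed
  qed
  then show ?thesis using L_over_polys[OF f] that by metis
qed

text \<open>The Riemann-Roch space of 2 (O) is spanned by 1 and x, because a term
  \<open>pX v * gY\<close> has a pole of order at least three. In particular order -1 at infinity
  cannot occur.\<close>

lemma affine_regular_low_pole:
  assumes f: "f \<in> L" "f \<noteq> 0" and reg: "\<And>x y. on_curve E (Affine x y) \<Longrightarrow> reg (Affine x y) f"
    and o: "ord Infinity f \<ge> -2"
  obtains \<alpha> \<beta> where "f = kc \<alpha> + kc \<beta> * gX" "ord Infinity f = (if \<beta> = 0 then 0 else - 2)"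
proof -
  obtain u v where uv: "f = pX u + pX v * gY" using affine_regular[OF f(1) reg] by blast
  note oo = ord_coordinate_ring_infinity[where u = u and v = v, folded uv]
  have v: "v = 0"
  proof (rule ccontr)
    assume "v \<noteq> 0"
    then show False using oo o by (cases "u = 0") auto
  qed
  then have "u \<noteq> 0" using f uv by auto
  then have ou: "ord Infinity f = - 2 * int (Polynomial.degree u)" using oo v by blast
  then have d: "Polynomial.degree u \<le> 1" using o by simp
  then have u: "u = [:Polynomial.coeff u 0, Polynomial.coeff u 1:]"
    by (intro poly_eqI) (auto simp: Polynomial.coeff_pCons Polynomial.coeff_eq_0 split: nat.split)
  have "f = kc (Polynomial.coeff u 0) + kc (Polynomial.coeff u 1) * gX"
    unfolding uv v by (subst u) (simp add: mult.commute)
  moreover have "ord Infinity f = (if Polynomial.coeff u 1 = 0 then 0 else - 2)"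
  proof (cases "Polynomial.coeff u 1 = 0")
    case True
    then have "u = [:Polynomial.coeff u 0:]" using u by simp
    then have "Polynomial.degree u = 0" by (metis degree_pCons_0)
    then show ?thesis using True ou by simp
  next
    case False
    then have "Polynomial.degree u = 1" using d le_degree[of u 1] by simp
    then show ?thesis using False ou by simp
  qed
  ultimately show ?thesis using that by blast
qed

lemma regular_const:
  assumes f: "f \<in> L" and reg: "\<And>P. on_curve E P \<Longrightarrow> reg P f"
  obtains c where "f = kc c"
proof (cases "f = 0")
  case True
  then show ?thesis using that[of 0] by simp
next
  case False
  have o: "ord Infinity f \<ge> 0" using reg_iff[of Infinity f] reg f False by simp
  obtain \<alpha> \<beta> where ab: "f = kc \<alpha> + kc \<beta> * gX" "ord Infinity f = (if \<beta> = 0 then 0 else - 2)"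
    using affine_regular_low_pole[OF f False reg] o by auto
  then have "\<beta> = 0" using o by (auto split: if_splits)
  then show ?thesis using that ab by simp
qed

end

context ec
begin

section \<open>Lines and the group law\<close>

abbreviation pt_add (infixl "\<boxplus>" 65) where "P \<boxplus> Q \<equiv> ec_add E P Q"

text \<open>On the line the Weierstrass equation becomes a monic cubic in x. \<open>R(1)\<close>
  prescribes the sum of its roots and \<open>B\<close> their second symmetric function. Chord and
  tangent satisfy both, so coinciding points are covered by the same argument.\<close>

lemma ord_line:
  assumes P: "on_curve E (Affine x1 y1)" and Q: "on_curve E (Affine x2 y2)"
    and l: "y2 = y1 + l * (x2 - x1)"
    and R: "x3 = l ^ 2 + a1 * l - a2 - x1 - x2" "y3 = y1 + l * (x3 - x1)"
    and B: "x1 ^ 2 + x1 * x2 + x2 ^ 2 - (x1 + x2 + x3) * (x1 + x2)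
      + (a4 - (2 * l + a1) * (y1 - l * x1) - a3 * l) = 0"
  shows "on_curve E (Affine x3 y3)"
    and "gY - kc y1 - kc l * (gX - kc x1) \<noteq> 0"
    and "on_curve E A \<Longrightarrow> ord A (gY - kc y1 - kc l * (gX - kc x1)) =
      of_bool (A = Affine x1 y1) + of_bool (A = Affine x2 y2) + of_bool (A = Affine x3 y3)
      - 3 * of_bool (A = Infinity)"
proof -
  define b c where "b = a4 - (2 * l + a1) * (y1 - l * x1) - a3 * l"
    and "c = a6 - (y1 - l * x1) ^ 2 - a3 * (y1 - l * x1)"
  have b: "b = x1 * x2 + x3 * (x1 + x2)" using B unfolding b_def by Groebner_Basis.algebra
  have c: "c = - (x1 * x2 * x3)"
    using P b R(1) unfolding b_def c_def on_curve.simps by Groebner_Basis.algebra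
  show R': "on_curve E (Affine x3 y3)"
    using b c R unfolding b_def c_def on_curve.simps by Groebner_Basis.algebra
  \<comment> \<open>\<open>h'\<close> is \<open>h\<close> composed with negation on the curve; their
    product is therefore a polynomial in x, namely the cubic up to sign.\<close>
  define h h' where "h = gY - kc y1 - kc l * (gX - kc x1)"
    and "h' = - gY - kc a1 * gX - kc a3 - kc y1 - kc l * (gX - kc x1)"
  have "h = pX [:l * x1 - y1, - l:] + pX 1 * gY" "h' = pX [:l * x1 - y1 - a3, - l - a1:] + pX (-1) * gY"
    by (simp_all add: h_def h'_def algebra_simps)
  then have nz: "h \<noteq> 0" "h' \<noteq> 0" using gY_independent by (metis one_neq_zero, metis one_neq_zero neg_equal_0_iff_equal)
  then show "gY - kc y1 - kc l * (gX - kc x1) \<noteq> 0" by (simp add: h_def)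
  have hL: "h \<in> L" "h' \<in> L" by (simp_all add: h_def h'_def)
  have hh': "h * h' = - ((gX - kc x1) * (gX - kc x2) * (gX - kc x3))"
  proof -
    have "kc b = kc x1 * kc x2 + kc x3 * (kc x1 + kc x2)" unfolding b by simp
    moreover have "kc c = - (kc x1 * kc x2 * kc x3)" unfolding c by simp
    moreover have "kc x3 = kc l ^ 2 + kc a1 * kc l - kc a2 - kc x1 - kc x2" unfolding R(1) by simp
    moreover have "kc b = kc a4 - (2 * kc l + kc a1) * (kc y1 - kc l * kc x1) - kc a3 * kc l" by (simp add: b_def)
    moreover have "kc c = kc a6 - (kc y1 - kc l * kc x1) ^ 2 - kc a3 * (kc y1 - kc l * kc x1)" by (simp add: c_def)
    ultimately show ?thesis unfolding h_def h'_def using gY by Groebner_Basis.algebra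
  qed
  show "ord A (gY - kc y1 - kc l * (gX - kc x1)) =
      of_bool (A = Affine x1 y1) + of_bool (A = Affine x2 y2) + of_bool (A = Affine x3 y3)
      - 3 * of_bool (A = Infinity)" if A: "on_curve E A"
    unfolding h_def[symmetric]
  proof (cases A)
    case Infinity
    have h: "h = pX [:l * x1 - y1, - l:] + pX 1 * gY" by (simp add: h_def algebra_simps)
    have o: "ord Infinity (pX p + pX 1 * gY) = -3" if "Polynomial.degree p \<le> 1" for p
      using that ord_coordinate_ring_infinity(1,3)[where u = p and v = 1] by (cases "p = 0") auto
    have "ord Infinity h = -3" unfolding h by (rule o) simp
    then show "ord A h = of_bool (A = Affine x1 y1) + of_bool (A = Affine x2 y2) + of_bool (A = Affine x3 y3)
      - 3 * of_bool (A = Infinity)" using Infinity by simp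
  next
    case (Affine x y)
    note A = A[unfolded Affine]
    have vh: "val (Affine x y) h (y - y1 - l * (x - x1))"
      unfolding h_def by (intro val_diff val_mult val_gX val_gY val_const A)
    have vh': "val (Affine x y) h' (- y - a1 * x - a3 - y1 - l * (x - x1))"
      unfolding h'_def by (intro val_diff val_uminus val_mult val_gX val_gY val_const A)
    define S where "S = of_bool (A = Affine x1 y1) + of_bool (A = Affine x2 y2) + (of_bool (A = Affine x3 y3) :: int)"
    have "ord A h = S"
    proof (cases "y = y1 + l * (x - x1)")
      case False
      then have "y - y1 - l * (x - x1) \<noteq> 0" by (simp add: diff_diff_eq)
      then have "unit_at (Affine x y) h" using vh unfolding unit_at_def by blast
      then have "ord A h = 0" using ord_unit[OF A] Affine by simp
      moreover have "A \<noteq> Affine x1 y1" "A \<noteq> Affine x2 y2" "A \<noteq> Affine x3 y3"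
        using False l R(2) unfolding Affine by auto
      then have "S = 0" unfolding S_def by simp
      ultimately show ?thesis by simp
    next
      case True
      have nX: "gX - kc d \<noteq> 0" for d :: 'a using gX_neq_const by simp
      have "ord A h + ord A h' = ord A (h * h')"
        using ord_mult[OF A hL(1) nz(1) hL(2) nz(2)] unfolding Affine by simp
      also have "\<dots> = ord A (gX - kc x1) + ord A (gX - kc x2) + ord A (gX - kc x3)"
        unfolding hh' Affine using nX by (simp add: ord_uminus[OF A] ord_mult[OF A])
      also have "\<dots> = S + (of_bool (A = neg (Affine x1 y1)) + of_bool (A = neg (Affine x2 y2)) + of_bool (A = neg (Affine x3 y3)))"
        unfolding Affine S_def ord_vertical[OF P A] ord_vertical[OF Q A] ord_vertical[OF R' A] by simp
      finally have sum: "ord A h + ord A h' = S + (of_bool (A = neg (Affine x1 y1)) + of_bool (A = neg (Affine x2 y2)) + of_bool (A = neg (Affine x3 y3)))" .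
      show ?thesis
      proof (cases "2 * y + a1 * x + a3 = 0")
        case False
        have "- y - a1 * x - a3 \<noteq> y" using False by (auto simp: algebra_simps neg_eq_iff_add_eq_0)
        \<comment> \<open>A nonvertical line has one point for each abscissa, and \<open>A\<close>
          differs from its own negative, so the negatives of points on the line miss
          \<open>A\<close>.\<close>
        then have off: "A \<noteq> neg (Affine x' y')" if "y' = y1 + l * (x' - x1)" for x' y'
          using that True unfolding Affine by auto
        have "A \<noteq> neg (Affine x1 y1)" by (rule off) simp
        then have "ord A h + ord A h' = S" using sum off[OF l] off[OF R(2)] by (simp del: ec_neg.simps)
        moreover have "- y - a1 * x - a3 - y1 - l * (x - x1) = - (2 * y + a1 * x + a3)" using True by simp
        then have "ord A h' = 0"
          using vh' False ord_unit[OF A] unfolding unit_at_def Affine by (metis neg_equal_0_iff_equal)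
        ultimately show ?thesis by simp
      next
        \<comment> \<open>At a 2-torsion point \<open>gY - kc y\<close> is a uniformizer and
          \<open>gX - kc x\<close> has order two, so \<open>h\<close> and \<open>h'\<close> both
          have simple zeros. Their orders add up to \<open>2 * S\<close>, which gives
          \<open>S = 1\<close>.\<close>
        case 2: True
        then have self: "- y - a1 * x - a3 = y" by (simp add: algebra_simps neg_eq_iff_add_eq_0)
        then have "neg A = A" by (simp add: Affine)
        then have self': "A = neg B \<longleftrightarrow> A = B" for B by (metis neg_neg)
        have "ord A h + ord A h' = 2 * S"
          using sum unfolding self'[of "Affine x1 y1"] self'[of "Affine x2 y2"] self'[of "Affine x3 y3"] S_def by simp
        obtain g where g: "unit_at (Affine x y) g" "gX - kc x = (gY - kc y) ^ 2 * g"
          using unif_affine_2torsion[OF A 2] by blast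
        note t = unif_affine_2torsion(1)[OF A 2]
        have one: "ord A ((gY - kc y) * kc d + kc e * (gX - kc x)) = 1" if "d \<noteq> 0" for d e
        proof -
          have "(gY - kc y) * kc d + kc e * (gX - kc x) = (gY - kc y) * (kc d + (gY - kc y) * (kc e * g))"
            unfolding g(2) by (simp add: power2_eq_square ring_distribs mult_ac)
          moreover have "unit_at (Affine x y) (kc d + (gY - kc y) * (kc e * g))"
            using that t_val[OF A t] unit_reg[OF A g(1)]
            by (intro unit_add[OF A] val_0_mult_reg[OF A] reg_mult[OF A] unit_const[OF A] reg_const[OF A])
          ultimately show ?thesis
            unfolding Affine by (intro ord_eqI[OF A t]) (auto simp: ordt_def)
        qed
        have kt: "kc y = kc y1 + kc l * (kc x - kc x1)" using True by simp
        have "h = (gY - kc y) * kc 1 + kc (- l) * (gX - kc x)"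
          unfolding h_def kt by (simp add: algebra_simps)
        then have "ord A h = 1" using one[of 1 "- l"] by simp
        moreover have "h' = (gY - kc y) * kc (- 1) + kc (- l - a1) * (gX - kc x)"
        proof -
          have "kc (- y - a1 * x - a3) = kc y" unfolding self by (rule refl)
          then have s: "- kc y - kc a1 * kc x - kc a3 = kc y" by (simp only: kc.diff kc.uminus kc.mult)
          show ?thesis unfolding h'_def kc.diff kc.uminus kc.one using kt s by Groebner_Basis.algebra
        qed
        then have "ord A h' = 1" using one[of "- 1" "- l - a1"] by simp
        ultimately show ?thesis using \<open>ord A h + ord A h' = 2 * S\<close> by simp
      qed
    qed
    then show "ord A h = of_bool (A = Affine x1 y1) + of_bool (A = Affine x2 y2) + of_bool (A = Affine x3 y3)
      - 3 * of_bool (A = Infinity)" unfolding S_def using Affine by simp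
  qed
qed

text \<open>Brings both slopes in \<open>ec_add\<close> into the symmetric form that
  \<open>ord_line\<close> expects, with the sum as the negative of the third intersection
  point.\<close>

lemma chord_tangent_cases:
  assumes P: "on_curve E P" and Q: "on_curve E Q"
  obtains "P = Infinity" "P \<boxplus> Q = Q" | "Q = Infinity" "P \<boxplus> Q = P"
  | "Q = neg P" "P \<boxplus> Q = Infinity"
  | x1 y1 x2 y2 l x3 y3 where "P = Affine x1 y1" "Q = Affine x2 y2" "y2 = y1 + l * (x2 - x1)"
    "x3 = l ^ 2 + a1 * l - a2 - x1 - x2" "y3 = y1 + l * (x3 - x1)"
    "x1 ^ 2 + x1 * x2 + x2 ^ 2 - (x1 + x2 + x3) * (x1 + x2)
      + (a4 - (2 * l + a1) * (y1 - l * x1) - a3 * l) = 0"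
    "P \<boxplus> Q = neg (Affine x3 y3)"
proof (cases P)
  case Infinity
  then show ?thesis using that(1) by simp
next
  case P': (Affine x1 y1)
  show ?thesis
  proof (cases Q)
    case Infinity
    then show ?thesis using that(2) P' by simp
  next
    case Q': (Affine x2 y2)
    note P = P[unfolded P'] and Q = Q[unfolded Q']
    show ?thesis
    proof (cases "x1 = x2 \<and> y1 + y2 + a1 * x2 + a3 = 0")
      case True
      then have "y2 = - y1 - a1 * x1 - a3" by (simp add: algebra_simps eq_neg_iff_add_eq_0)
      then show ?thesis using that(3) True P' Q' by simp
    next
      case ndef: False
      define l where "l = (if x1 = x2
                 then (3 * x1 ^ 2 + 2 * a2 * x1 + a4 - a1 * y1) / (2 * y1 + a1 * x1 + a3)
                 else (y2 - y1) / (x2 - x1))"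
      define x3 where "x3 = l ^ 2 + a1 * l - a2 - x1 - x2"
      have sum: "P \<boxplus> Q = neg (Affine x3 (y1 + l * (x3 - x1)))"
      proof -
        have "P \<boxplus> Q = Affine x3 (- (l + a1) * x3 - (y1 - l * x1) - a3)"
          unfolding P' Q' ec_add.simps Let_def if_not_P[OF ndef] l_def[symmetric] x3_def[symmetric] by (rule refl)
        moreover have "- (l + a1) * x3 - (y1 - l * x1) - a3 = - (y1 + l * (x3 - x1)) - a1 * x3 - a3"
          by (simp add: algebra_simps)
        ultimately show ?thesis by (simp only: ec_neg.simps)
      qed
      show ?thesis
      proof (cases "x1 = x2")
        case True
        then have y: "y2 = y1" using on_curve_same_x[OF P, of y2] Q ndef
          by (auto simp: algebra_simps)
        have d: "2 * y1 + a1 * x1 + a3 \<noteq> 0" using ndef True y by (simp add: algebra_simps)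
        have "l * (2 * y1 + a1 * x1 + a3) = 3 * x1 ^ 2 + 2 * a2 * x1 + a4 - a1 * y1"
          using d True by (simp add: l_def)
        then have "x1 ^ 2 + x1 * x2 + x2 ^ 2 - (x1 + x2 + x3) * (x1 + x2)
            + (a4 - (2 * l + a1) * (y1 - l * x1) - a3 * l) = 0"
          using True unfolding x3_def by Groebner_Basis.algebra
        then show ?thesis using that(4)[OF P' Q', of l x3] y True x3_def sum by simp
      next
        case False
        then have l: "y2 = y1 + l * (x2 - x1)" by (simp add: l_def field_simps)
        \<comment> \<open>The difference of the two curve equations along the chord is divisible by
          x1 - x2.\<close>
        have "(x1 - x2) * (x1 ^ 2 + x1 * x2 + x2 ^ 2 - (x1 + x2 + x3) * (x1 + x2)
            + (a4 - (2 * l + a1) * (y1 - l * x1) - a3 * l)) = 0"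
          using P Q l unfolding x3_def on_curve.simps by Groebner_Basis.algebra
        then show ?thesis using that(4)[OF P' Q' l x3_def refl] False sum by simp
      qed
    qed
  qed
qed

lemma on_curve_add [simp]:
  assumes "on_curve E P" "on_curve E Q"
  shows "on_curve E (P \<boxplus> Q)"
  using assms
proof (cases rule: chord_tangent_cases)
  case (4 x1 y1 x2 y2 l x3 y3)
  show ?thesis unfolding 4(7) on_curve_neg
    by (rule ord_line(1)[OF assms(1)[unfolded 4(1)] assms(2)[unfolded 4(2)] 4(3-6)])
qed (use assms in simp_all)

text \<open>The line through P and Q divided by the vertical line through their third intersection
  point. It turns addition of points into a relation between divisors.\<close>

lemma chord_function:
  assumes P: "on_curve E P" and Q: "on_curve E Q"
  obtains f where "f \<in> L" "f \<noteq> 0" "\<And>R. on_curve E R \<Longrightarrow>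
    ord R f = of_bool (R = P) + of_bool (R = Q) - of_bool (R = P \<boxplus> Q) - of_bool (R = Infinity)"
  using P Q
proof (cases rule: chord_tangent_cases)
  case 1
  then show ?thesis using that[of 1] ord_unit[OF _ unit_1] by simp
next
  case 2
  then show ?thesis using that[of 1] ord_unit[OF _ unit_1] by simp
next
  case 3
  show ?thesis
  proof (cases P)
    case Infinity
    then show ?thesis using that[of 1] ord_unit[OF _ unit_1] 3 by simp
  next
    case (Affine x y)
    then show ?thesis using that[of "gX - kc x"] ord_vertical[of x y] 3 P gX_neq_const[of x] by simp
  qed
next
  case (4 x1 y1 x2 y2 l x3 y3)
  note h = ord_line[OF P[unfolded 4(1)] Q[unfolded 4(2)] 4(3,4,5,6)]
  have nX: "gX - kc x3 \<noteq> 0" using gX_neq_const by simp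
  show ?thesis
  proof (rule that)
    show "(gY - kc y1 - kc l * (gX - kc x1)) / (gX - kc x3) \<in> L" by simp
    show "(gY - kc y1 - kc l * (gX - kc x1)) / (gX - kc x3) \<noteq> 0" using h(2) nX by simp
    fix R assume R: "on_curve E R"
    show "ord R ((gY - kc y1 - kc l * (gX - kc x1)) / (gX - kc x3)) =
      of_bool (R = P) + of_bool (R = Q) - of_bool (R = P \<boxplus> Q) - of_bool (R = Infinity)"
      unfolding 4(7) using ord_vertical[OF h(1) R] h(3)[OF R] 4(1,2) h(2) nX by (subst ord_divide[OF R]) simp_all
  qed
qed

text \<open>This is the nonrationality of the curve. Multiplication by the vertical line through
  \<open>Q\<close> moves the pole to infinity and leaves a pole of order two there, so the product
  is itself a vertical line; comparing its zeros P and -P with P and -Q gives P = Q.\<close>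

lemma no_degree_one:
  assumes f: "f \<in> L" "f \<noteq> 0" and P: "on_curve E P" "on_curve E Q"
    and o: "\<And>R. on_curve E R \<Longrightarrow> ord R f = of_bool (R = P) - of_bool (R = Q)"
  shows "P = Q"
proof (rule ccontr)
  assume ne: "P \<noteq> Q"
  have aux: False if f: "f \<in> L" "f \<noteq> 0" and P: "on_curve E P" and ne: "P \<noteq> Infinity"
    and o: "\<And>R. on_curve E R \<Longrightarrow> ord R f = of_bool (R = P) - of_bool (R = Infinity)" for f P
  proof -
    have r: "reg (Affine x y) f" if "on_curve E (Affine x y)" for x y
      using reg_iff[OF that f] o[OF that] by simp
    have "ord Infinity f = -1" using o[of Infinity] ne by simp
    then show False using affine_regular_low_pole[OF f r] by (metis (mono_tags, opaque_lifting) neg_equal_iff_equal numeral_eq_one_iff order.refl verit_eq_simplify(10) zero_neq_neg_one neg_numeral_le_neg_one)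
  qed
  show False
  proof (cases Q)
    case Infinity
    then show ?thesis using aux[OF f P(1)] o ne by simp
  next
    case Q': (Affine x\<^sub>0 y\<^sub>0)
    show ?thesis
    proof (cases P)
      case Infinity
      show ?thesis
      proof (rule aux[of "inverse f" Q])
        show "ord R (inverse f) = of_bool (R = Q) - of_bool (R = Infinity)" if "on_curve E R" for R
          using ord_inverse[OF that f(2,1)] o[OF that] Infinity by simp
      qed (use f P ne Infinity in auto)
    next
      case P': (Affine x y)
      have nX: "gX - kc d \<noteq> 0" for d :: 'a using gX_neq_const by simp
      define g where "g = f * (gX - kc x\<^sub>0)"
      have g: "g \<in> L" "g \<noteq> 0" using f nX by (simp_all add: g_def)
      have og: "ord R g = of_bool (R = P) + of_bool (R = neg Q) - 2 * of_bool (R = Infinity)" if "on_curve E R" for R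
        unfolding g_def by (subst ord_mult[OF that f])
          (simp_all add: o[OF that] ord_vertical[OF P(2)[unfolded Q'] that] Q')
      have r: "reg (Affine x y) g" if "on_curve E (Affine x y)" for x y
        using reg_iff[OF that g] og[OF that] by simp
      have "ord Infinity g = -2" using og[of Infinity] P' Q' by simp
      then obtain \<alpha> \<beta> where ab: "g = kc \<alpha> + kc \<beta> * gX" "\<beta> \<noteq> 0"
        using affine_regular_low_pole[OF g r] by (metis order.refl zero_neq_neg_numeral)
      have "val P g 0" using val_0_iff[OF P(1) g] og[OF P(1)] P' by simp
      moreover have "val P g (\<alpha> + \<beta> * x)"
        unfolding ab P' using P(1)[unfolded P'] by (intro val_add val_mult val_const val_gX)
      ultimately have z: "\<alpha> + \<beta> * x = 0" using val_unique[OF P(1)] by blast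
      have gx: "g = kc \<beta> * (gX - kc x)"
      proof -
        have "kc \<alpha> = - (kc \<beta> * kc x)" using z by (metis add_eq_0_iff2 kc.mult kc.uminus)
        then show ?thesis unfolding ab by (simp add: algebra_simps)
      qed
      have nP: "on_curve E (neg P)" using P by simp
      have "ord (neg P) g = ord (neg P) (gX - kc x)"
        unfolding gx using ab(2) nX ord_const[OF nP, of \<beta>] ord_mult[OF nP, of "kc \<beta>" "gX - kc x"] by simp
      then have "of_bool (neg P = P) + of_bool (neg P = neg Q) = (of_bool (neg P = P) + 1 :: int)"
        using og[OF nP] ord_vertical[OF P(1)[unfolded P'] nP] P' by simp
      then have "neg P = neg Q" by (auto split: if_splits)
      then show False using ne by (metis neg_neg)
    qed
  qed
qed

text \<open>Four chord functions combine so that all divisor terms cancel except the two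
  bracketings.\<close>

lemma pt_add_assoc:
  assumes P: "on_curve E P" and Q: "on_curve E Q" and R: "on_curve E R"
  shows "P \<boxplus> Q \<boxplus> R = P \<boxplus> (Q \<boxplus> R)"
proof -
  obtain f1 where f1: "f1 \<in> L" "f1 \<noteq> 0" "\<And>A. on_curve E A \<Longrightarrow>
    ord A f1 = of_bool (A = P) + of_bool (A = Q) - of_bool (A = P \<boxplus> Q) - of_bool (A = Infinity)"
    using chord_function[OF P Q] by blast
  obtain f2 where f2: "f2 \<in> L" "f2 \<noteq> 0" "\<And>A. on_curve E A \<Longrightarrow>
    ord A f2 = of_bool (A = P \<boxplus> Q) + of_bool (A = R) - of_bool (A = P \<boxplus> Q \<boxplus> R) - of_bool (A = Infinity)"
    using chord_function[OF on_curve_add[OF P Q] R] by blast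
  obtain f3 where f3: "f3 \<in> L" "f3 \<noteq> 0" "\<And>A. on_curve E A \<Longrightarrow>
    ord A f3 = of_bool (A = Q) + of_bool (A = R) - of_bool (A = Q \<boxplus> R) - of_bool (A = Infinity)"
    using chord_function[OF Q R] by blast
  obtain f4 where f4: "f4 \<in> L" "f4 \<noteq> 0" "\<And>A. on_curve E A \<Longrightarrow>
    ord A f4 = of_bool (A = P) + of_bool (A = Q \<boxplus> R) - of_bool (A = P \<boxplus> (Q \<boxplus> R)) - of_bool (A = Infinity)"
    using chord_function[OF P on_curve_add[OF Q R]] by blast
  have "ord A (f3 * f4 / (f1 * f2)) = of_bool (A = P \<boxplus> Q \<boxplus> R) - of_bool (A = P \<boxplus> (Q \<boxplus> R))" if A: "on_curve E A" for A
    using f1(1,2) f2(1,2) f3(1,2) f4(1,2)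
    by (simp add: ord_divide[OF A] ord_mult[OF A] f1(3)[OF A] f2(3)[OF A] f3(3)[OF A] f4(3)[OF A])
  then show ?thesis
    by (intro no_degree_one[of "f3 * f4 / (f1 * f2)"]) (use f1 f2 f3 f4 assms in auto)
qed

lemma pt_add_commute:
  assumes P: "on_curve E P" and Q: "on_curve E Q"
  shows "P \<boxplus> Q = Q \<boxplus> P"
proof -
  obtain f1 where f1: "f1 \<in> L" "f1 \<noteq> 0" "\<And>A. on_curve E A \<Longrightarrow>
    ord A f1 = of_bool (A = P) + of_bool (A = Q) - of_bool (A = P \<boxplus> Q) - of_bool (A = Infinity)"
    using chord_function[OF P Q] by blast
  obtain f2 where f2: "f2 \<in> L" "f2 \<noteq> 0" "\<And>A. on_curve E A \<Longrightarrow>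
    ord A f2 = of_bool (A = Q) + of_bool (A = P) - of_bool (A = Q \<boxplus> P) - of_bool (A = Infinity)"
    using chord_function[OF Q P] by blast
  have "ord A (f2 / f1) = of_bool (A = P \<boxplus> Q) - of_bool (A = Q \<boxplus> P)" if A: "on_curve E A" for A
    using f1(1,2) f2(1,2) by (simp add: ord_divide[OF A] f1(3)[OF A] f2(3)[OF A])
  then show ?thesis
    by (intro no_degree_one[of "f2 / f1"]) (use f1 f2 assms in auto)
qed

lemma pt_add_Infinity [simp]: "P \<boxplus> Infinity = P" "Infinity \<boxplus> P = P"
  by (cases P; simp)+

lemma pt_add_neg: "P \<boxplus> neg P = Infinity"
  by (cases P) simp_all

end

section \<open>Identities at almost all points\<close>

context ec
begin

lemma val_ev2:
  assumes P: "on_curve E P" and "val P u u\<^sub>0" "val P v v\<^sub>0"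
  shows "val P (ev2 a u v) (eval2 a u\<^sub>0 v\<^sub>0)"
proof (induction a rule: poly_poly_induct)
  case (const c)
  show ?case using val_const[OF P] by simp
next
  case (add a b)
  then show ?case using val_add[OF P] by simp
next
  case (mult a b)
  then show ?case using val_mult[OF P] by simp
qed (use assms in simp_all)

lemma ev2_L: "u \<in> L \<Longrightarrow> v \<in> L \<Longrightarrow> ev2 a u v \<in> L"
  by (induction a rule: poly_poly_induct) simp_all

text \<open>Cofinite sets of points. Since a nonzero function has finitely many zeros, identities in
  \<open>L\<close> can be checked along this filter, away from the exceptional cases of the addition
  formulas.\<close>

definition AE :: "'a point filter" where
  "AE = inf cofinite (principal {P. on_curve E P})"

lemma eventually_AE: "eventually \<Phi> AE \<longleftrightarrow> finite {P. on_curve E P \<and> \<not> \<Phi> P}"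
  unfolding AE_def eventually_inf_principal eventually_cofinite by simp

lemma AE_nontrivial: "AE \<noteq> bot"
  using infinite_points unfolding trivial_limit_def[symmetric] eventually_AE by (simp add: trivial_limit_def eventually_AE)

lemma AE_on_curve: "\<forall>\<^sub>F P in AE. on_curve E P"
  unfolding eventually_AE by simp

lemma AE_neq: "\<forall>\<^sub>F P in AE. P \<noteq> Q"
  unfolding eventually_AE by (rule finite_subset[of _ "{Q}"]) auto

lemma neg_add: "on_curve E P \<Longrightarrow> neg P \<boxplus> P = Infinity"
  using pt_add_commute[of P "neg P"] pt_add_neg by simp

lemma add_neg_cancel: "on_curve E P \<Longrightarrow> on_curve E S \<Longrightarrow> P \<boxplus> S \<boxplus> neg S = P" "on_curve E P \<Longrightarrow> on_curve E S \<Longrightarrow> P \<boxplus> neg S \<boxplus> S = P"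
  by (simp_all add: pt_add_assoc pt_add_neg neg_add)

lemma add_eq_Infinity_iff: "on_curve E P \<Longrightarrow> on_curve E S \<Longrightarrow> P \<boxplus> S = Infinity \<longleftrightarrow> P = neg S"
  using add_neg_cancel(1)[of P S] neg_add[of S] by force

lemma add_right_cancel: "on_curve E P \<Longrightarrow> on_curve E Q \<Longrightarrow> on_curve E S \<Longrightarrow> P \<boxplus> S = Q \<boxplus> S \<longleftrightarrow> P = Q"
  using add_neg_cancel(1) by metis

lemma AE_shift:
  assumes S: "on_curve E S" and ev: "\<forall>\<^sub>F P in AE. \<Phi> P"
  shows "\<forall>\<^sub>F P in AE. \<Phi> (P \<boxplus> S)"
proof -
  have "inj_on (\<lambda>P. P \<boxplus> S) {P. on_curve E P \<and> \<not> \<Phi> (P \<boxplus> S)}"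
    using add_right_cancel S by (auto simp: inj_on_def)
  moreover have "(\<lambda>P. P \<boxplus> S) ` {P. on_curve E P \<and> \<not> \<Phi> (P \<boxplus> S)} \<subseteq> {P. on_curve E P \<and> \<not> \<Phi> P}"
    using S by auto
  ultimately show ?thesis using ev unfolding eventually_AE by (meson finite_imageD finite_subset)
qed

lemma AE_unshift:
  assumes S: "on_curve E S" and ev: "\<forall>\<^sub>F P in AE. \<Phi> (P \<boxplus> S)"
  shows "\<forall>\<^sub>F P in AE. \<Phi> P"
proof -
  have "\<forall>\<^sub>F P in AE. \<Phi> (P \<boxplus> neg S \<boxplus> S)" using AE_shift[of "neg S" "\<lambda>P. \<Phi> (P \<boxplus> S)"] S ev by simp
  then show ?thesis using AE_on_curve by eventually_elim (simp add: add_neg_cancel S)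
qed

lemma AE_reg:
  assumes "f \<in> L" shows "\<forall>\<^sub>F P in AE. reg P f"
proof -
  obtain u v r where r: "r \<noteq> 0" "f * pX r = pX u + pX v * gY" by (rule L_over_polys[OF assms])
  have fin: "finite {y. on_curve E (Affine x y)}" for x
  proof -
    obtain y\<^sub>0 where y0: "on_curve E (Affine x y\<^sub>0)" using point_above by blast
    have "{y. on_curve E (Affine x y)} \<subseteq> {y\<^sub>0, - y\<^sub>0 - a1 * x - a3}" using on_curve_same_x[OF y0] by blast
    then show ?thesis by (rule finite_subset) simp
  qed
  have "{P. on_curve E P \<and> \<not> reg P f} \<subseteq> insert Infinity (\<Union>x\<in>{x. poly r x = 0}. Affine x ` {y. on_curve E (Affine x y)})"
  proof
    fix P assume "P \<in> {P. on_curve E P \<and> \<not> reg P f}"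
    then have P: "on_curve E P" and nr: "\<not> reg P f" by auto
    show "P \<in> insert Infinity (\<Union>x\<in>{x. poly r x = 0}. Affine x ` {y. on_curve E (Affine x y)})"
    proof (cases P)
      case (Affine x y)
      note P = P[unfolded Affine]
      have "poly r x = 0"
      proof (rule ccontr)
        assume r0: "poly r x \<noteq> 0"
        have "val P ((pX u + pX v * gY) / pX r) ((poly u x + poly v x * y) / poly r x)"
          unfolding Affine by (intro val_divide val_add val_mult val_pX val_gY P r0)
        moreover have "(pX u + pX v * gY) / pX r = f" using r by (simp flip: r(2))
        ultimately show False using nr unfolding reg_def by auto
      qed
      then show ?thesis using P Affine by blast
    qed simp
  qed
  moreover have "finite (insert Infinity (\<Union>x\<in>{x. poly r x = 0}. Affine x ` {y. on_curve E (Affine x y)}))"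
    using fin poly_roots_finite[OF r(1)] by simp
  ultimately show ?thesis unfolding eventually_AE by (rule finite_subset)
qed

lemma AE_unit:
  assumes f: "f \<in> L" "f \<noteq> 0" shows "\<forall>\<^sub>F P in AE. unit_at P f"
  using AE_reg[OF f(1)] AE_reg[OF L_inverse[OF f(1)]] AE_on_curve
proof eventually_elim
  case (elim P)
  then show ?case using reg_iff[OF elim(3) f] reg_iff[OF elim(3), of "inverse f"] f
      ord_inverse[OF elim(3) f(2,1)] unit_iff[OF elim(3) f] by simp
qed

lemma AE_val_0:
  assumes "f \<in> L" "\<forall>\<^sub>F P in AE. val P f 0"
  shows "f = 0"
proof (rule ccontr)
  assume "f \<noteq> 0"
  have "\<forall>\<^sub>F P in AE. False"
    using AE_unit[OF assms(1) \<open>f \<noteq> 0\<close>] assms(2) AE_on_curve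
    by eventually_elim (use not_unit_val_0 in blast)
  then show False using AE_nontrivial by (simp add: trivial_limit_def)
qed

lemma AE_val_eq:
  assumes "f \<in> L" "g \<in> L" "\<forall>\<^sub>F P in AE. \<exists>c. val P f c \<and> val P g c"
  shows "f = g"
proof -
  have "\<forall>\<^sub>F P in AE. val P (f - g) 0"
    using assms(3) AE_on_curve
    by eventually_elim (use val_diff in fastforce)
  then have "f - g = 0" using assms by (intro AE_val_0) simp_all
  then show ?thesis by simp
qed

section \<open>Translations\<close>

text \<open>The sum of the generic point and the constant point \<open>S\<close>: its coordinates
  are those of the generic point pulled back along translation by \<open>S\<close>.\<close>

definition genS :: "'a point \<Rightarrow> 'a ff point" where
  "genS S = ec_add (map_weierstrass kc E) (Affine gX gY) (map_point kc S)"

definition tX :: "'a point \<Rightarrow> 'a ff" where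
  "tX S = (case genS S of Affine x y \<Rightarrow> x | Infinity \<Rightarrow> 0)"

definition tY :: "'a point \<Rightarrow> 'a ff" where
  "tY S = (case genS S of Affine x y \<Rightarrow> y | Infinity \<Rightarrow> 0)"

lemma t_Infinity: "tX Infinity = gX" "tY Infinity = gY"
  by (simp_all add: tX_def tY_def genS_def)

lemma t_Affine:
  fixes s t :: 'a
  defines "l \<equiv> (kc t - gY) / (kc s - gX)"
  shows "tX (Affine s t) = l ^ 2 + kc a1 * l - kc a2 - gX - kc s"
    and "tY (Affine s t) = - (l + kc a1) * tX (Affine s t) - (gY - l * gX) - kc a3"
proof -
  have "genS (Affine s t) = Affine (l ^ 2 + kc a1 * l - kc a2 - gX - kc s)
      (- (l + kc a1) * (l ^ 2 + kc a1 * l - kc a2 - gX - kc s) - (gY - l * gX) - kc a3)"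
    by (simp add: genS_def l_def Let_def weierstrass.map_sel)
  then show "tX (Affine s t) = l ^ 2 + kc a1 * l - kc a2 - gX - kc s"
    "tY (Affine s t) = - (l + kc a1) * tX (Affine s t) - (gY - l * gX) - kc a3"
    by (simp_all add: tX_def tY_def)
qed

lemma tXY_L [simp]: "tX S \<in> L" "tY S \<in> L"
proof -
  show "tX S \<in> L" by (cases S) (simp_all add: t_Infinity t_Affine)
  then show "tY S \<in> L" by (cases S) (simp_all add: t_Infinity t_Affine(2))
qed

lemma val_t_affine:
  assumes P: "on_curve E (Affine x y)" and ne: "x \<noteq> s"
  obtains x' y' where "Affine x y \<boxplus> Affine s t = Affine x' y'"
    "val (Affine x y) (tX (Affine s t)) x'" "val (Affine x y) (tY (Affine s t)) y'"
proof -
  define l where "l = (t - y) / (s - x)"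
  define x' where "x' = l ^ 2 + a1 * l - a2 - x - s"
  have vl: "val (Affine x y) ((kc t - gY) / (kc s - gX)) l"
    unfolding l_def using ne by (intro val_divide val_diff val_gX val_gY val_const P) simp
  have vx: "val (Affine x y) (tX (Affine s t)) x'"
    unfolding t_Affine x'_def by (intro val_diff val_add val_mult val_power vl val_gX val_gY val_const P)
  have "val (Affine x y) (tY (Affine s t)) (- (l + a1) * x' - (y - l * x) - a3)"
    unfolding t_Affine(2) by (intro val_diff val_uminus val_add val_mult vx vl val_gX val_gY val_const P)
  moreover have "Affine x y \<boxplus> Affine s t = Affine x' (- (l + a1) * x' - (y - l * x) - a3)"
    using ne by (simp add: l_def x'_def Let_def)
  ultimately show ?thesis using that vx by blast
qed

text \<open>The slope has a pole at infinity, so the addition formula cannot be specialized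
  directly. Clearing denominators and dividing by powers of \<open>gX\<close> leaves expressions in
  1 / x and y / x^2, which vanish at infinity, and y^2 / x^3, which takes the value 1.\<close>

lemma val_t_infinity:
  assumes S: "on_curve E (Affine s t)"
  shows "val Infinity (tX (Affine s t)) s" "val Infinity (tY (Affine s t)) t"
proof -
  have O: "on_curve E Infinity" by simp
  define p q r d where "p = 1 / gX" and "q = gY / gX ^ 2" and "r = gY ^ 2 / gX ^ 3" and "d = 1 - kc s * p"
  have vp: "val Infinity p 0"
    unfolding p_def by (subst val_0_iff[OF O]) (auto simp: ord_divide[OF O] ord_gX_infinity ord_unit[OF O unit_1[OF O]])
  have vq: "val Infinity q 0"
    unfolding q_def using gY_nonzero
    by (subst val_0_iff[OF O]) (auto simp: ord_divide[OF O] ord_power[OF O] ord_gX_infinity ord_gY_infinity)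
  have pX1: "gX * p = 1" by (simp add: p_def)
  have qX: "q = gY * p ^ 2" and rX: "r = gY ^ 2 * p ^ 3" by (simp_all add: q_def r_def p_def power_divide)
  have r: "r = 1 + kc a2 * p + kc a4 * p ^ 2 + kc a6 * p ^ 3 - kc a1 * q - kc a3 * (q * p)"
    unfolding rX qX using gY pX1 by Groebner_Basis.algebra
  have "val Infinity r (1 + a2 * 0 + a4 * 0 ^ 2 + a6 * 0 ^ 3 - a1 * 0 - a3 * (0 * 0))"
    unfolding r by (intro val_diff val_add val_mult val_power val_const val_1 vp vq O)
  then have vr: "val Infinity r 1" by simp
  have "val Infinity d (1 - s * 0)"
    unfolding d_def by (intro val_diff val_mult val_const val_1 vp O)
  then have vd: "val Infinity d 1" by simp
  have dnz: "d \<noteq> 0" using val_nonzero[OF O vd] by simp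
  have dX: "gX * d = gX - kc s" unfolding d_def using pX1 by Groebner_Basis.algebra
  define l where "l = (kc t - gY) / (kc s - gX)"
  have nz: "gX - kc s \<noteq> 0" by simp
  have lD: "l * (gX - kc s) = gY - kc t"
  proof -
    have "l = (gY - kc t) / (gX - kc s)" unfolding l_def by (metis minus_diff_eq minus_divide_divide)
    then show ?thesis using nz by simp
  qed
  define n b c where "n = kc (2 * t + a1 * s + a3)" and "b = kc (a4 - a1 * t + 2 * a2 * s + s ^ 2)"
    and "c = kc (a6 + t ^ 2 + a1 * s * t - a2 * s ^ 2 - s ^ 3)"
  note X = t_Affine(1)[of s t, folded l_def] and Y = t_Affine(2)[of s t, folded l_def]
  \<comment> \<open>The terms of degree three in x cancel by the Weierstrass equation.\<close>
  have Xeq: "tX (Affine s t) * (gX - kc s) ^ 2 = kc s * gX ^ 2 - n * gY + b * gX + c"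
    unfolding X n_def b_def c_def kc.simps using lD gY by Groebner_Basis.algebra
  have "tX (Affine s t) * d ^ 2 = kc s - n * q + b * p + c * p ^ 2"
    unfolding qX using Xeq pX1 dX by Groebner_Basis.algebra
  then have "tX (Affine s t) = (kc s - n * q + b * p + c * p ^ 2) / d ^ 2"
    using dnz by (simp add: nonzero_eq_divide_eq)
  moreover have "val Infinity ((kc s - n * q + b * p + c * p ^ 2) / d ^ 2)
    ((s - (2 * t + a1 * s + a3) * 0 + (a4 - a1 * t + 2 * a2 * s + s ^ 2) * 0 + (a6 + t ^ 2 + a1 * s * t - a2 * s ^ 2 - s ^ 3) * 0 ^ 2) / 1 ^ 2)"
    unfolding n_def b_def c_def
    by (intro val_divide val_diff val_add val_mult val_power val_const vp vq vd O) simp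
  ultimately show vX: "val Infinity (tX (Affine s t)) s" by simp
  define b' c' where "b' = b + 2 * kc s ^ 2" and "c' = c - kc s ^ 3"
  \<comment> \<open>Collinearity makes the first factor equal to - l (tX - s), so \<open>Xeq\<close>
    applies once more. The terms a1 tX and a3 account for the negation in the addition
    formula.\<close>
  have Yeq: "(tY (Affine s t) + kc a1 * tX (Affine s t) + kc t + kc a3) * (gX - kc s) ^ 3 =
      - ((gY - kc t) * (- n * gY + b' * gX + c'))"
    unfolding Y b'_def c'_def using Xeq lD by Groebner_Basis.algebra
  define v where "v = - (- n * r + b' * q + c' * (q * p) + kc t * n * (q * p) - kc t * b' * p ^ 2 - kc t * c' * p ^ 3)"
  have "(tY (Affine s t) + kc a1 * tX (Affine s t) + kc t + kc a3) * d ^ 3 = v"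
    unfolding qX rX v_def using Yeq pX1 dX by Groebner_Basis.algebra
  then have "tY (Affine s t) + kc a1 * tX (Affine s t) + kc t + kc a3 = v / d ^ 3"
    using dnz by (simp add: nonzero_eq_divide_eq)
  then have Yeq': "tY (Affine s t) = v / d ^ 3 - kc a1 * tX (Affine s t) - kc t - kc a3" by (simp add: algebra_simps)
  define b0 c0 where "b0 = a4 - a1 * t + 2 * a2 * s + s ^ 2 + 2 * s ^ 2"
    and "c0 = a6 + t ^ 2 + a1 * s * t - a2 * s ^ 2 - s ^ 3 - s ^ 3"
  have b'c': "b' = kc b0" "c' = kc c0" by (simp_all add: b'_def c'_def b_def c_def b0_def c0_def)
  have "val Infinity v (- (- (2 * t + a1 * s + a3) * 1 + b0 * 0 + c0 * (0 * 0)
      + t * (2 * t + a1 * s + a3) * (0 * 0) - t * b0 * 0 ^ 2 - t * c0 * 0 ^ 3))"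
    unfolding v_def b'c' n_def
    by (intro val_uminus val_diff val_add val_mult val_power val_const vp vq vr O)
  then have vv: "val Infinity v (2 * t + a1 * s + a3)" by (simp add: algebra_simps)
  have "val Infinity (tY (Affine s t)) ((2 * t + a1 * s + a3) / 1 ^ 3 - a1 * s - t - a3)"
    unfolding Yeq' by (intro val_divide val_diff val_mult val_power val_const vv vd vX O) simp
  then show "val Infinity (tY (Affine s t)) t" by simp
qed

lemma val_t:
  assumes P: "on_curve E P" and S: "on_curve E S" and "P \<noteq> neg S" "P \<noteq> S" "S \<noteq> Infinity"
  obtains x y where "P \<boxplus> S = Affine x y" "val P (tX S) x" "val P (tY S) y"
proof -
  obtain s t where S': "S = Affine s t" using assms(5) by (cases S) auto
  show ?thesis
  proof (cases P)
    case Infinity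
    then show ?thesis using that[of s t] val_t_infinity[of s t] S S' by simp
  next
    case (Affine x y)
    have "x \<noteq> s" using on_curve_same_x[of x t y] assms Affine S' by auto
    then show ?thesis using val_t_affine[of x y s t] P Affine S' that by metis
  qed
qed

lemma AE_val_t:
  assumes S: "on_curve E S"
  shows "\<forall>\<^sub>F P in AE. \<exists>x y. on_curve E P \<and> on_curve E (Affine x y) \<and> P \<boxplus> S = Affine x y \<and> val P (tX S) x \<and> val P (tY S) y"
proof (cases "S = Infinity")
  case True
  show ?thesis using AE_on_curve AE_neq[of Infinity]
  proof eventually_elim
    case (elim P)
    then show ?case using True val_gX val_gY by (cases P) (auto simp: t_Infinity)
  qed
next
  case False
  show ?thesis using AE_on_curve AE_neq[of "neg S"] AE_neq[of S]
    by eventually_elim (metis val_t[OF _ S _ _ False] on_curve_add S)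
qed

lemma AE_val_ev2_t:
  assumes S: "on_curve E S"
  shows "\<forall>\<^sub>F P in AE. on_curve E P \<and> (\<exists>c. val P (ev2 a (tX S) (tY S)) c \<and> val (P \<boxplus> S) (ev a) c)"
  using AE_val_t[OF S]
proof eventually_elim
  case (elim P)
  then obtain x y where "on_curve E P" "on_curve E (Affine x y)" "P \<boxplus> S = Affine x y" "val P (tX S) x" "val P (tY S) y" by blast
  then show ?case using val_ev2[of P "tX S" x "tY S" y a] val_ev[of x y a] by auto
qed

text \<open>Vanishing of a function is vanishing at almost all points, and translation preserves
  cofinite sets.\<close>

lemma ev2_t_eq_0_iff:
  assumes S: "on_curve E S"
  shows "ev2 a (tX S) (tY S) = 0 \<longleftrightarrow> ev a = 0"
proof
  assume z: "ev2 a (tX S) (tY S) = 0"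
  have "\<forall>\<^sub>F P in AE. val (P \<boxplus> S) (ev a) 0"
    using AE_val_ev2_t[OF S, of a] by eventually_elim (use z val_unique[OF _ val_0] in auto)
  then have "\<forall>\<^sub>F P in AE. val P (ev a) 0" by (rule AE_unshift[OF S])
  then show "ev a = 0" by (intro AE_val_0) simp_all
next
  assume z: "ev a = 0"
  have "\<forall>\<^sub>F P in AE. val P (ev2 a (tX S) (tY S)) 0"
    using AE_val_ev2_t[OF S, of a]
  proof eventually_elim
    case (elim P)
    then obtain c where c: "val P (ev2 a (tX S) (tY S)) c" "val (P \<boxplus> S) 0 c" and P: "on_curve E P" using z by auto
    then have "c = 0" using val_unique[OF on_curve_add[OF P S] _ val_0[OF on_curve_add[OF P S]]] by blast
    then show ?case using c by simp
  qed
  then show "ev2 a (tX S) (tY S) = 0" by (intro AE_val_0 ev2_L) simp_all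
qed

text \<open>Pullback along translation, by substituting the translated coordinates.
  \<open>ev2_t_eq_0_iff\<close> makes the result independent of the chosen quotient.\<close>

definition tr :: "'a point \<Rightarrow> 'a ff \<Rightarrow> 'a ff" where
  "tr S f = (THE g. \<exists>a b. ev b \<noteq> 0 \<and> f = ev a / ev b \<and> g = ev2 a (tX S) (tY S) / ev2 b (tX S) (tY S))"

context
  fixes S assumes S: "on_curve E S"
begin

lemma tr_ev:
  assumes "ev b \<noteq> 0"
  shows "tr S (ev a / ev b) = ev2 a (tX S) (tY S) / ev2 b (tX S) (tY S)"
  unfolding tr_def
proof (rule the_equality)
  show "\<exists>a' b'. ev b' \<noteq> 0 \<and> ev a / ev b = ev a' / ev b' \<and>
     ev2 a (tX S) (tY S) / ev2 b (tX S) (tY S) = ev2 a' (tX S) (tY S) / ev2 b' (tX S) (tY S)"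
    using assms by blast
next
  fix g assume "\<exists>a' b'. ev b' \<noteq> 0 \<and> ev a / ev b = ev a' / ev b' \<and> g = ev2 a' (tX S) (tY S) / ev2 b' (tX S) (tY S)"
  then obtain a' b' where *: "ev b' \<noteq> 0" "ev a / ev b = ev a' / ev b'" "g = ev2 a' (tX S) (tY S) / ev2 b' (tX S) (tY S)" by blast
  then have "ev (a * b' - a' * b) = 0" using assms by (simp add: frac_eq_eq)
  then have "ev2 (a * b' - a' * b) (tX S) (tY S) = 0" using ev2_t_eq_0_iff[OF S] by blast
  moreover have "ev2 b (tX S) (tY S) \<noteq> 0" "ev2 b' (tX S) (tY S) \<noteq> 0" using ev2_t_eq_0_iff[OF S] assms * by blast+
  ultimately show "g = ev2 a (tX S) (tY S) / ev2 b (tX S) (tY S)" using * by (simp add: frac_eq_eq)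
qed

lemma tr_L [simp]: "f \<in> L \<Longrightarrow> tr S f \<in> L"
proof -
  assume "f \<in> L"
  then obtain a b where "f = ev a / ev b" "ev b \<noteq> 0" unfolding L_def by blast
  then show ?thesis using ev2_L by (simp add: tr_ev)
qed

lemma tr_kc [simp]: "tr S (kc c) = kc c"
  using tr_ev[of 1 "[:[:c:]:]"] by simp

lemma tr_1 [simp]: "tr S 1 = 1" and tr_0 [simp]: "tr S 0 = 0"
  using tr_kc[of 1] tr_kc[of 0] by (simp_all del: tr_kc)

lemma tr_add: "f \<in> L \<Longrightarrow> g \<in> L \<Longrightarrow> tr S (f + g) = tr S f + tr S g"
proof -
  assume "f \<in> L" "g \<in> L"
  then obtain a b c d where f: "f = ev a / ev b" "ev b \<noteq> 0" and g: "g = ev c / ev d" "ev d \<noteq> 0"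
    unfolding L_def by blast
  have nz: "ev2 b (tX S) (tY S) \<noteq> 0" "ev2 d (tX S) (tY S) \<noteq> 0" using ev2_t_eq_0_iff[OF S] f g by blast+
  have "f + g = ev (a * d + c * b) / ev (b * d)" using f g by (simp add: add_frac_eq)
  then have "tr S (f + g) = ev2 (a * d + c * b) (tX S) (tY S) / ev2 (b * d) (tX S) (tY S)"
    using f g by (simp only:, intro tr_ev) simp
  then show ?thesis using nz f g by (simp add: tr_ev add_frac_eq)
qed

lemma tr_mult: "f \<in> L \<Longrightarrow> g \<in> L \<Longrightarrow> tr S (f * g) = tr S f * tr S g"
proof -
  assume "f \<in> L" "g \<in> L"
  then obtain a b c d where f: "f = ev a / ev b" "ev b \<noteq> 0" and g: "g = ev c / ev d" "ev d \<noteq> 0"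
    unfolding L_def by blast
  have "f * g = ev (a * c) / ev (b * d)" using f g by simp
  then have "tr S (f * g) = ev2 (a * c) (tX S) (tY S) / ev2 (b * d) (tX S) (tY S)"
    using f g by (simp only:, intro tr_ev) simp
  then show ?thesis using f g by (simp add: tr_ev)
qed

lemma tr_inverse: "f \<in> L \<Longrightarrow> f \<noteq> 0 \<Longrightarrow> tr S (inverse f) = inverse (tr S f)"
  by (metis L_inverse inverse_unique right_inverse tr_1 tr_mult)

lemma tr_nonzero: "f \<in> L \<Longrightarrow> f \<noteq> 0 \<Longrightarrow> tr S f \<noteq> 0"
  by (metis L_inverse mult_zero_left right_inverse tr_1 tr_mult zero_neq_one)

lemma tr_diff: "f \<in> L \<Longrightarrow> g \<in> L \<Longrightarrow> tr S (f - g) = tr S f - tr S g"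
  using tr_add[of "f - g" g] by simp

lemma val_tr_generic:
  assumes P: "on_curve E P" and "P \<noteq> neg S" "P \<noteq> S" "S \<noteq> Infinity" and f: "val (P \<boxplus> S) f c"
  shows "val P (tr S f) c"
proof -
  obtain x y where xy: "P \<boxplus> S = Affine x y" "val P (tX S) x" "val P (tY S) y"
    using val_t[OF P S] assms by blast
  then obtain a b where ab: "eval2 b x y \<noteq> 0" "f = ev a / ev b" "c = eval2 a x y / eval2 b x y"
    using f by (auto simp: lval_def)
  have "val P (ev2 b (tX S) (tY S)) (eval2 b x y)" "val P (ev2 a (tX S) (tY S)) (eval2 a x y)"
    using val_ev2[OF P xy(2,3)] by blast+
  then have v: "val P (ev2 a (tX S) (tY S) / ev2 b (tX S) (tY S)) c" unfolding ab(3)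
    by (intro val_divide[OF P] ab)
  have "on_curve E (Affine x y)" using on_curve_add[OF P S] xy by simp
  then have "ev b \<noteq> 0" using ab(1) val_nonzero[OF _ val_ev] by blast
  then show ?thesis using v ab(2) tr_ev by simp
qed

end

lemma tr_Infinity: "f \<in> L \<Longrightarrow> tr Infinity f = f"
  unfolding L_def using tr_ev[of Infinity] by (auto simp: t_Infinity)

lemma AE_val_tr:
  assumes S: "on_curve E S" and f: "f \<in> L"
  shows "\<forall>\<^sub>F P in AE. \<forall>c. val (P \<boxplus> S) f c \<longrightarrow> val P (tr S f) c"
proof (cases "S = Infinity")
  case True
  then show ?thesis using tr_Infinity f by simp
next
  case False
  show ?thesis using AE_on_curve AE_neq[of "neg S"] AE_neq[of S]
    by eventually_elim (use val_tr_generic[OF S] False in blast)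
qed

text \<open>At almost all points both sides take the value of \<open>f\<close> at P + R + S, by
  associativity.\<close>

lemma tr_tr:
  assumes R: "on_curve E R" and S: "on_curve E S" and f: "f \<in> L"
  shows "tr R (tr S f) = tr (R \<boxplus> S) f"
proof (rule AE_val_eq)
  show "tr R (tr S f) \<in> L" "tr (R \<boxplus> S) f \<in> L" using assms by simp_all
  have RS: "on_curve E (R \<boxplus> S)" using R S by simp
  show "\<forall>\<^sub>F P in AE. \<exists>c. val P (tr R (tr S f)) c \<and> val P (tr (R \<boxplus> S) f) c"
    using AE_val_tr[OF RS f] AE_val_tr[OF R tr_L[OF S f]] AE_shift[OF R AE_val_tr[OF S f]]
      AE_shift[OF RS AE_reg[OF f]] AE_on_curve
  proof eventually_elim
    case (elim P)
    then show ?case using pt_add_assoc[OF _ R S, of P] unfolding reg_def by auto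
  qed
qed

text \<open>
  The remaining places \<open>P = - S\<close> and \<open>P = S\<close> are reached through \<open>\<tau>\<^sub>S = \<tau>\<^sub>-\<^sub>S\<inverse>\<close> and
  \<open>\<tau>\<^sub>S = \<tau>\<^sub>-\<^sub>S \<tau>\<^sub>2\<^sub>S\<close>.
\<close>

lemma val_tr_neg:
  assumes S: "on_curve E S" and f: "val Infinity f c"
  shows "val (neg S) (tr S f) c"
proof (cases "S = Infinity")
  case True
  then show ?thesis using f tr_Infinity[OF val_L[OF _ f]] by simp
next
  case False
  have O: "on_curve E Infinity" by simp
  have fL: "f \<in> L" using val_L[OF O f] .
  define h where "h = tr S f"
  have nS: "on_curve E (neg S)" using S by simp
  have ne: "neg S \<noteq> Infinity" using False by (cases S) auto
  have hL: "h \<in> L" using fL S by (simp add: h_def)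
  have fh: "tr (neg S) h = f" unfolding h_def using tr_tr[OF nS S fL] tr_Infinity[OF fL] neg_add[OF S] by simp
  have inv: "val Infinity (tr (neg S) k) d" if "val (neg S) k d" for k d
    using val_tr_generic[OF nS O] ne that False by simp
  show ?thesis
  proof (cases "reg (neg S) h")
    case True
    then obtain d where d: "val (neg S) h d" unfolding reg_def by blast
    then have "val Infinity f d" using inv fh by metis
    then have "d = c" using val_unique[OF O f] by simp
    then show ?thesis using d h_def by simp
  next
    \<comment> \<open>A pole of \<open>h\<close> at - S would be a zero of its inverse; translated
      back, 1 / f would vanish at infinity although \<open>f\<close> has a finite value
      there.\<close>
    case False
    have hnz: "h \<noteq> 0" using False val_0[OF nS] unfolding reg_def by blast
    have "val (neg S) (inverse h) 0"
      using False reg_iff[OF nS hL hnz] hL hnz by (subst val_0_iff[OF nS]) (auto simp: ord_inverse[OF nS])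
    then have "val Infinity (inverse f) 0" using inv tr_inverse[OF nS hL hnz] fh by metis
    then have "val Infinity (inverse f * f) (0 * c)" using val_mult[OF O _ f] by blast
    moreover have "f \<noteq> 0" using hnz S by (auto simp: h_def)
    ultimately show ?thesis using val_unique[OF O _ val_1[OF O]] by fastforce
  qed
qed

theorem val_tr:
  assumes S: "on_curve E S" and P: "on_curve E P" and f: "val (P \<boxplus> S) f c"
  shows "val P (tr S f) c"
proof -
  have fL: "f \<in> L" using val_L[OF _ f] P S by simp
  consider "S = Infinity" | "P = neg S" | "P = S" "P \<noteq> neg S" "S \<noteq> Infinity" | "P \<noteq> neg S" "P \<noteq> S" "S \<noteq> Infinity" by blast
  then show ?thesis
  proof cases
    case 1
    then show ?thesis using f tr_Infinity[OF fL] by simp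
  next
    case 2
    then show ?thesis using val_tr_neg[OF S] f neg_add[OF S] by simp
  next
    case 3
    have O: "on_curve E Infinity" by simp
    have nS: "on_curve E (neg S)" and SS: "on_curve E (S \<boxplus> S)" using S by simp_all
    have ne: "S \<boxplus> S \<noteq> Infinity" using 3 add_eq_Infinity_iff[OF S S] by simp
    then have "neg (S \<boxplus> S) \<noteq> Infinity" by (cases "S \<boxplus> S") auto
    then have "val Infinity (tr (S \<boxplus> S) f) c"
      using val_tr_generic[OF SS O] ne f 3(1) by simp
    then have "val S (tr (neg S) (tr (S \<boxplus> S) f)) c" using val_tr_neg[OF nS] by simp
    moreover have "neg S \<boxplus> (S \<boxplus> S) = S" using pt_add_assoc[OF nS S S] neg_add[OF S] by simp
    ultimately show ?thesis using tr_tr[OF nS SS fL] 3(1) by simp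
  next
    case 4
    then show ?thesis using val_tr_generic[OF S P] f by blast
  qed
qed

lemma unif_tr:
  assumes S: "on_curve E S" and P: "on_curve E P" and t: "unif (P \<boxplus> S) t"
  shows "unif P (tr S t)"
proof (rule unifI)
  have PS: "on_curve E (P \<boxplus> S)" and nS: "on_curve E (neg S)" using P S by simp_all
  show "val P (tr S t) 0" using val_tr[OF S P] t unfolding unif_def by blast
  fix h assume h: "val P h 0"
  have hL: "h \<in> L" using val_L[OF P h] .
  have "val (P \<boxplus> S) (tr (neg S) h) 0" using val_tr[OF nS PS] h add_neg_cancel(1)[OF P S] by simp
  then obtain g where g: "reg (P \<boxplus> S) g" "tr (neg S) h = t * g" using t unfolding unif_def by blast
  then obtain c where c: "val (P \<boxplus> S) g c" unfolding reg_def by blast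
  have "h = tr S (tr (neg S) h)" using tr_tr[OF S nS hL] pt_add_neg tr_Infinity[OF hL] by simp
  also have "\<dots> = tr S t * tr S g" unfolding g(2)
    using t val_L[OF PS] c by (intro tr_mult[OF S]) (auto simp: unif_def)
  finally show "\<exists>k e. val P k e \<and> h = tr S t * k" using val_tr[OF S P c] by blast
qed

lemma ord_tr:
  assumes S: "on_curve E S" and P: "on_curve E P" and f: "f \<in> L" "f \<noteq> 0"
  shows "ord P (tr S f) = ord (P \<boxplus> S) f"
proof -
  have PS: "on_curve E (P \<boxplus> S)" using P S by simp
  obtain t where t: "unif (P \<boxplus> S) t" using unif_exists[OF PS] by blast
  obtain g where g: "unit_at (P \<boxplus> S) g" "f = t powi (ord (P \<boxplus> S) f) * g"
    using ordt_ord[OF PS t f] unfolding ordt_def by blast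
  have tL: "t \<in> L" "t \<noteq> 0" using t_L[OF PS t] unif_nonzero[OF PS t] by simp_all
  have pw: "tr S (t ^ n) = tr S t ^ n" for n by (induction n) (simp_all add: S tr_mult[OF S] tL)
  have pwi: "tr S (t powi n) = tr S t powi n" for n
    by (simp add: power_int_def pw tr_inverse[OF S] tL flip: power_inverse) (simp add: pw tr_inverse[OF S] tL power_inverse)
  have "tr S f = tr S t powi (ord (P \<boxplus> S) f) * tr S g"
    by (subst g(2)) (simp add: tr_mult[OF S] tL unit_L[OF PS g(1)] pwi)
  moreover have "unit_at P (tr S g)" using g(1) val_tr[OF S P] unfolding unit_at_def by blast
  ultimately show ?thesis
    by (intro ord_eqI[OF P unif_tr[OF S P t]]) (auto simp: ordt_def)
qed

end

section \<open>Multiplication by integers\<close>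

lemma ec_mult_0 [simp]: "ec_mult E 0 P = Infinity"
  and ec_mult_Suc: "ec_mult E (Suc n) P = ec_add E P (ec_mult E n P)"
  by (simp_all add: ec_mult_def)

context ec
begin

lemma on_curve_mult [simp]: "on_curve E P \<Longrightarrow> on_curve E (ec_mult E n P)"
  by (induction n) (simp_all add: ec_mult_Suc)

lemma ec_mult_1 [simp]: "ec_mult E (Suc 0) P = P"
  by (simp add: ec_mult_Suc)

lemma ec_mult_Infinity [simp]: "ec_mult E n Infinity = Infinity"
  by (induction n) (simp_all add: ec_mult_Suc)

lemma pt_add_left_commute:
  "on_curve E P \<Longrightarrow> on_curve E Q \<Longrightarrow> on_curve E R \<Longrightarrow> P \<boxplus> (Q \<boxplus> R) = Q \<boxplus> (P \<boxplus> R)"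
  using pt_add_assoc pt_add_commute by metis

lemma ec_mult_add: "on_curve E P \<Longrightarrow> ec_mult E (n + k) P = ec_mult E n P \<boxplus> ec_mult E k P"
  by (induction n) (simp_all add: ec_mult_Suc pt_add_assoc)

lemma ec_mult_distrib:
  "on_curve E P \<Longrightarrow> on_curve E Q \<Longrightarrow> ec_mult E n (P \<boxplus> Q) = ec_mult E n P \<boxplus> ec_mult E n Q"
  by (induction n) (simp_all add: ec_mult_Suc pt_add_assoc pt_add_left_commute)

lemma ec_mult_mult: "on_curve E P \<Longrightarrow> ec_mult E (n * k) P = ec_mult E n (ec_mult E k P)"
  by (induction n) (simp_all add: ec_mult_Suc ec_mult_add)

lemma ec_mult_neg:
  assumes P: "on_curve E P"
  shows "ec_mult E n (neg P) = neg (ec_mult E n P)"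
proof -
  have "ec_mult E n (neg P) \<boxplus> ec_mult E n P = ec_mult E n (neg P \<boxplus> P)"
    using ec_mult_distrib P by simp
  then show ?thesis using neg_add[OF P] add_eq_Infinity_iff P by simp
qed

section \<open>Surjectivity of multiplication by m\<close>

lemma takes_value:
  assumes f: "f \<in> L" "\<And>c. f \<noteq> kc c"
  obtains P where "on_curve E P" "val P f c"
proof -
  have nz: "f - kc c \<noteq> 0" and fL: "f - kc c \<in> L" using f by simp_all
  \<comment> \<open>If \<open>f\<close> omitted the value \<open>c\<close>, then 1 / (f - c) would
    be regular everywhere and hence constant.\<close>
  have "\<exists>P. on_curve E P \<and> val P (f - kc c) 0"
  proof (rule ccontr)
    assume no: "\<nexists>P. on_curve E P \<and> val P (f - kc c) 0"
    have "reg P (inverse (f - kc c))" if P: "on_curve E P" for P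
    proof -
      have "\<not> ord P (f - kc c) > 0" using no val_0_iff[OF P fL nz] P by blast
      then show ?thesis using reg_iff[OF P L_inverse[OF fL]] nz ord_inverse[OF P nz fL] by simp
    qed
    then obtain d where "inverse (f - kc c) = kc d" using regular_const[OF L_inverse[OF fL]] by blast
    then have "f - kc c = kc (inverse d)" by (metis inverse_inverse_eq kc_divide(2))
    then have "f = kc (inverse d + c)" by (simp add: algebra_simps)
    then show False using f(2) by blast
  qed
  then obtain P where P: "on_curve E P" "val P (f - kc c) 0" by blast
  then have "val P (f - kc c + kc c) (0 + c)" by (intro val_add val_const)
  then show ?thesis using that P by simp
qed

text \<open>Specialization at \<open>P\<close> of a point with coordinates in the function field.
  Points with a pole at \<open>P\<close> get no specialization, which for given coordinates excludes
  finitely many \<open>P\<close>.\<close>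

fun spec :: "'a point \<Rightarrow> 'a ff point \<Rightarrow> 'a point \<Rightarrow> bool" where
  "spec P Infinity Q \<longleftrightarrow> Q = Infinity"
| "spec P (Affine f h) Q \<longleftrightarrow> (\<exists>x y. Q = Affine x y \<and> val P f x \<and> val P h y)"

abbreviation "EM \<equiv> map_weierstrass kc E"

fun pointL :: "'a ff point \<Rightarrow> bool" where
  "pointL Infinity \<longleftrightarrow> True"
| "pointL (Affine f h) \<longleftrightarrow> f \<in> L \<and> h \<in> L"

lemma L_numeral [simp]: "numeral n \<in> L"
  using L_kc[of "numeral n"] by simp

lemma pointL_add: "pointL \<Phi> \<Longrightarrow> pointL \<Psi> \<Longrightarrow> pointL (ec_add EM \<Phi> \<Psi>)"
  by (cases \<Phi>; cases \<Psi>) (auto simp: Let_def weierstrass.map_sel)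

lemma AE_dichotomy:
  assumes "f \<in> L" "f \<noteq> 0"
  shows "\<forall>\<^sub>F P in AE. \<forall>c. val P f c \<longrightarrow> c \<noteq> 0"
  using AE_unit[OF assms] AE_on_curve
  by eventually_elim (use not_unit_val_0 in blast)

text \<open>Each case distinction of \<open>ec_add\<close> asks whether some function vanishes. That
  function is either identically zero or nonzero at almost all points, so both additions follow the
  same branch almost everywhere.\<close>

lemma AE_spec_add:
  assumes L: "pointL \<Phi>" "pointL \<Psi>" and "\<forall>\<^sub>F P in AE. spec P \<Phi> (\<phi> P)" "\<forall>\<^sub>F P in AE. spec P \<Psi> (\<psi> P)"
  shows "\<forall>\<^sub>F P in AE. spec P (ec_add EM \<Phi> \<Psi>) (\<phi> P \<boxplus> \<psi> P)"
proof (cases \<Phi>)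
  case Infinity
  then show ?thesis using assms(3,4) by (auto elim: eventually_elim2)
next
  case \<Phi>: (Affine f1 h1)
  show ?thesis
  proof (cases \<Psi>)
    case Infinity
    show ?thesis using assms(3,4) by eventually_elim (auto simp: \<Phi> Infinity)
  next
    case \<Psi>: (Affine f2 h2)
    have fL: "f1 \<in> L" "f2 \<in> L" "h1 \<in> L" "h2 \<in> L" using L \<Phi> \<Psi> by simp_all
    define v where "v = h1 + h2 + kc a1 * f2 + kc a3"
    have vL: "v \<in> L" using fL by (simp add: v_def)
    have vals: "\<forall>\<^sub>F P in AE. on_curve E P \<and> (\<exists>x1 y1 x2 y2. \<phi> P = Affine x1 y1 \<and> \<psi> P = Affine x2 y2 \<and>
        val P f1 x1 \<and> val P h1 y1 \<and> val P f2 x2 \<and> val P h2 y2)"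
      using assms(3,4) AE_on_curve by eventually_elim (auto simp: \<Phi> \<Psi>)
    have vv: "val P v (y1 + y2 + a1 * x2 + a3)"
      if "on_curve E P" "val P h1 y1" "val P f2 x2" "val P h2 y2" for P y1 x2 y2
      unfolding v_def by (intro val_add val_mult val_const that)
    have step: "spec P (Affine (l ^ 2 + kc a1 * l - kc a2 - f1 - f2)
        (- (l + kc a1) * (l ^ 2 + kc a1 * l - kc a2 - f1 - f2) - (h1 - l * f1) - kc a3))
      (Affine (l0 ^ 2 + a1 * l0 - a2 - x1 - x2)
        (- (l0 + a1) * (l0 ^ 2 + a1 * l0 - a2 - x1 - x2) - (y1 - l0 * x1) - a3))"
      if P: "on_curve E P" and v: "val P f1 x1" "val P h1 y1" "val P f2 x2" "val P l l0" for P x1 y1 x2 l l0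
    proof -
      have "val P (l ^ 2 + kc a1 * l - kc a2 - f1 - f2) (l0 ^ 2 + a1 * l0 - a2 - x1 - x2)"
        by (intro val_add val_diff val_mult val_power val_const v P)
      moreover from this have "val P (- (l + kc a1) * (l ^ 2 + kc a1 * l - kc a2 - f1 - f2) - (h1 - l * f1) - kc a3)
          (- (l0 + a1) * (l0 ^ 2 + a1 * l0 - a2 - x1 - x2) - (y1 - l0 * x1) - a3)"
        by (intro val_add val_diff val_mult val_uminus val_power val_const v P)
      ultimately show ?thesis unfolding spec.simps by blast
    qed
    show ?thesis
    proof (cases "f1 = f2")
      case f: True
      show ?thesis
      proof (cases "v = 0")
        case True
        show ?thesis using vals
        proof eventually_elim
          case (elim P)
          then obtain x1 y1 x2 y2 where P: "on_curve E P" and *: "\<phi> P = Affine x1 y1" "\<psi> P = Affine x2 y2"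
            "val P f1 x1" "val P h1 y1" "val P f2 x2" "val P h2 y2" by blast
          have "x1 = x2" using val_unique[OF P] * f by blast
          moreover have "y1 + y2 + a1 * x2 + a3 = 0"
            using vv[OF P *(4,5,6)] True val_unique[OF P _ val_0[OF P]] by blast
          ultimately show ?case using True f * by (simp add: \<Phi> \<Psi> v_def weierstrass.map_sel)
        qed
      next
        case False
        define d n where "d = 2 * h1 + kc a1 * f1 + kc a3" and "n = 3 * f1 ^ 2 + 2 * kc a2 * f1 + kc a4 - kc a1 * h1"
        have dL: "d \<in> L" using fL by (simp add: d_def)
        have eq: "ec_add EM \<Phi> \<Psi> = Affine ((n / d) ^ 2 + kc a1 * (n / d) - kc a2 - f1 - f2)
            (- (n / d + kc a1) * ((n / d) ^ 2 + kc a1 * (n / d) - kc a2 - f1 - f2) - (h1 - n / d * f1) - kc a3)"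
          using f False by (simp add: \<Phi> \<Psi> v_def d_def n_def Let_def weierstrass.map_sel)
        \<comment> \<open>If the tangent denominator vanishes identically, both quotients are
          divisions by zero with value 0, so they still correspond.\<close>
        have dd: "\<forall>\<^sub>F P in AE. \<forall>c. val P d c \<longrightarrow> (c = 0 \<longleftrightarrow> d = 0)"
        proof (cases "d = 0")
          case True
          show ?thesis using AE_on_curve by eventually_elim (use True val_unique[OF _ _ val_0] in blast)
        next
          case False
          show ?thesis using AE_dichotomy[OF dL False] by eventually_elim (use False in blast)
        qed
        show ?thesis using vals AE_dichotomy[OF vL False] dd
        proof eventually_elim
          case (elim P)
          then obtain x1 y1 x2 y2 where P: "on_curve E P" and *: "\<phi> P = Affine x1 y1" "\<psi> P = Affine x2 y2"
            "val P f1 x1" "val P h1 y1" "val P f2 x2" "val P h2 y2" by blast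
          have x: "x1 = x2" using val_unique[OF P] * f by blast
          have y: "y1 + y2 + a1 * x2 + a3 \<noteq> 0"
            using vv[OF P *(4,5,6)] elim(2) by blast
          define d0 n0 where "d0 = 2 * y1 + a1 * x1 + a3" and "n0 = 3 * x1 ^ 2 + 2 * a2 * x1 + a4 - a1 * y1"
          have num: "val P (numeral k) (numeral k)" for k using val_const[OF P, of "numeral k"] by simp
          have vd: "val P d d0" unfolding d_def d0_def by (intro val_add val_mult val_const num * P)
          have vn: "val P n n0" unfolding n_def n0_def by (intro val_add val_diff val_mult val_power val_const num * P)
          have "val P (n / d) (n0 / d0)"
          proof (cases "d = 0")
            case True
            then have "d0 = 0" using elim(3) vd by blast
            then show ?thesis using True val_0[OF P] by simp
          next
            case False
            then show ?thesis using elim(3) vd val_divide[OF P vn vd] by blast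
          qed
          from step[OF P *(3,4,5) this] show ?case
            unfolding eq using * x y by (simp add: d0_def n0_def Let_def)
        qed
      qed
    next
      case False
      define l where "l = (h2 - h1) / (f2 - f1)"
      have eq: "ec_add EM \<Phi> \<Psi> = Affine (l ^ 2 + kc a1 * l - kc a2 - f1 - f2)
          (- (l + kc a1) * (l ^ 2 + kc a1 * l - kc a2 - f1 - f2) - (h1 - l * f1) - kc a3)"
        using False by (simp add: \<Phi> \<Psi> l_def Let_def weierstrass.map_sel)
      have df: "f2 - f1 \<in> L" "f2 - f1 \<noteq> 0" using fL False by simp_all
      show ?thesis using vals AE_dichotomy[OF df]
      proof eventually_elim
        case (elim P)
        then obtain x1 y1 x2 y2 where P: "on_curve E P" and *: "\<phi> P = Affine x1 y1" "\<psi> P = Affine x2 y2"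
          "val P f1 x1" "val P h1 y1" "val P f2 x2" "val P h2 y2" by blast
        have ne: "x2 - x1 \<noteq> 0" using elim(2) val_diff[OF P *(5,3)] by blast
        have "val P l ((y2 - y1) / (x2 - x1))" unfolding l_def by (intro val_divide val_diff * P ne)
        from step[OF P *(3,4,5) this] show ?case
          unfolding eq using * ne by (simp add: Let_def)
      qed
    qed
  qed
qed

lemma AE_spec_mult: "pointL (ec_mult EM n (Affine gX gY)) \<and>
  (\<forall>\<^sub>F P in AE. spec P (ec_mult EM n (Affine gX gY)) (ec_mult E n P))"
proof (induction n)
  case 0
  show ?case by simp
next
  case (Suc n)
  have "\<forall>\<^sub>F P in AE. spec P (Affine gX gY) P"
    using AE_on_curve AE_neq[of Infinity]
  proof eventually_elim
    case (elim P)
    then show ?case using val_gX val_gY by (cases P) (auto simp del: val.simps)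
  qed
  then show ?case using Suc pointL_add AE_spec_add[of "Affine gX gY" _ "\<lambda>P. P"] by (simp add: ec_mult_Suc)
qed

definition tors :: "nat \<Rightarrow> 'a point set" where
  "tors m = {P. on_curve E P \<and> ec_mult E m P = Infinity}"

lemma finite_fibre:
  assumes "finite (tors m)" shows "finite {P. on_curve E P \<and> ec_mult E m P = T}"
proof (cases "\<exists>P. on_curve E P \<and> ec_mult E m P = T")
  case True
  then obtain P where P: "on_curve E P" "ec_mult E m P = T" by blast
  have "{P. on_curve E P \<and> ec_mult E m P = T} \<subseteq> (\<lambda>R. R \<boxplus> P) ` tors m"
  proof
    fix Q assume "Q \<in> {P. on_curve E P \<and> ec_mult E m P = T}"
    then have Q: "on_curve E Q" "ec_mult E m Q = T" by auto
    then have "Q \<boxplus> neg P \<in> tors m"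
      using P by (simp add: tors_def ec_mult_distrib ec_mult_neg pt_add_neg)
    moreover have "Q = Q \<boxplus> neg P \<boxplus> P" using add_neg_cancel P Q by simp
    ultimately show "Q \<in> (\<lambda>R. R \<boxplus> P) ` tors m" by blast
  qed
  then show ?thesis using assms finite_surj by blast
next
  case False
  then show ?thesis by (metis (mono_tags, lifting) Collect_empty_eq finite.emptyI)
qed

text \<open>Finite fibres make the abscissa of m times the generic point nonconstant, and a
  nonconstant function takes every value. The sign of the ordinate is corrected by negation, so
  almost all points are reached; every point is a difference of two such points.\<close>

lemma mult_surjective:
  assumes fin: "finite (tors m)" and T: "on_curve E T"
  shows "\<exists>P. on_curve E P \<and> ec_mult E m P = T"
proof -
  define bad where "bad = {P. on_curve E P \<and> \<not> spec P (ec_mult EM m (Affine gX gY)) (ec_mult E m P)}"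
  have finbad: "finite bad" using AE_spec_mult[of m] unfolding eventually_AE bad_def by blast
  obtain f h where fh: "ec_mult EM m (Affine gX gY) = Affine f h"
  proof (cases "ec_mult EM m (Affine gX gY)")
    case Infinity
    then have "{P. on_curve E P} \<subseteq> bad \<union> tors m" unfolding bad_def tors_def by auto
    then show ?thesis using infinite_points finbad fin finite_subset by blast
  qed (use that in blast)
  have fL: "f \<in> L" using AE_spec_mult[of m] fh by simp
  have sp: "\<exists>y. ec_mult E m P = Affine x y" if "on_curve E P" "P \<notin> bad" "val P f x" for P x
    using that val_unique[OF that(1)] unfolding bad_def fh by fastforce
  have nonconst: "f \<noteq> kc c" for c
  proof
    assume f: "f = kc c"
    obtain y where y: "on_curve E (Affine c y)" using point_above by blast
    have "{P. on_curve E P} \<subseteq> bad \<union> ({P. on_curve E P \<and> ec_mult E m P = Affine c y}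
        \<union> {P. on_curve E P \<and> ec_mult E m P = neg (Affine c y)})"
    proof
      fix P assume "P \<in> {P. on_curve E P}"
      then have P: "on_curve E P" by simp
      show "P \<in> bad \<union> ({P. on_curve E P \<and> ec_mult E m P = Affine c y}
        \<union> {P. on_curve E P \<and> ec_mult E m P = neg (Affine c y)})"
      proof (cases "P \<in> bad")
        case False
        then obtain y' where y': "ec_mult E m P = Affine c y'" using sp[OF P] val_const[OF P] f by blast
        then have "y' = y \<or> y' = - y - a1 * c - a3" using on_curve_same_x[OF y] on_curve_mult[OF P] by metis
        then show ?thesis using P y' by auto
      qed simp
    qed
    moreover have "finite (bad \<union> ({P. on_curve E P \<and> ec_mult E m P = Affine c y}
        \<union> {P. on_curve E P \<and> ec_mult E m P = neg (Affine c y)}))"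
      using finbad finite_fibre[OF fin] by simp
    ultimately show False using infinite_points finite_subset by blast
  qed
  have "\<forall>\<^sub>F T in AE. \<exists>P. on_curve E P \<and> ec_mult E m P = T"
  proof -
    \<comment> \<open>The values of \<open>f\<close> at the finitely many points where
      specialization fails.\<close>
    define C where "C = {c. \<exists>P\<in>bad. val P f c}"
    have "finite C"
    proof -
      have "C \<subseteq> (\<lambda>P. THE c. val P f c) ` bad"
      proof
        fix c assume "c \<in> C"
        then obtain P where P: "P \<in> bad" "val P f c" unfolding C_def by blast
        then have "(THE c. val P f c) = c" using val_unique[of P f] unfolding bad_def by blast
        then show "c \<in> (\<lambda>P. THE c. val P f c) ` bad" using P by force
      qed
      then show ?thesis using finbad finite_surj by blast
    qed
    have ex: "\<exists>P. on_curve E P \<and> ec_mult E m P = Affine c y" if "c \<notin> C" and y: "on_curve E (Affine c y)" for c y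
    proof -
      obtain P where P: "on_curve E P" "val P f c" using takes_value[OF fL nonconst] by blast
      then have "P \<notin> bad" using that unfolding C_def by blast
      then obtain y' where y': "ec_mult E m P = Affine c y'" using sp P by blast
      then have "y' = y \<or> y' = - y - a1 * c - a3" using on_curve_same_x[OF y] on_curve_mult[OF P(1)] by metis
      then have "ec_mult E m P = Affine c y \<or> ec_mult E m (neg P) = Affine c y"
        using y' ec_mult_neg[OF P(1)] by auto
      then show ?thesis using P(1) on_curve_neg by blast
    qed
    have fy: "finite {y. on_curve E (Affine c y)}" for c
    proof -
      obtain y\<^sub>0 where y0: "on_curve E (Affine c y\<^sub>0)" using point_above by blast
      have "{y. on_curve E (Affine c y)} \<subseteq> {y\<^sub>0, - y\<^sub>0 - a1 * c - a3}" using on_curve_same_x[OF y0] by blast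
      then show ?thesis by (rule finite_subset) simp
    qed
    have "{T. on_curve E T \<and> \<not> (\<exists>P. on_curve E P \<and> ec_mult E m P = T)} \<subseteq> (\<Union>c\<in>C. Affine c ` {y. on_curve E (Affine c y)})"
    proof
      fix T assume "T \<in> {T. on_curve E T \<and> \<not> (\<exists>P. on_curve E P \<and> ec_mult E m P = T)}"
      then have T: "on_curve E T" "\<nexists>P. on_curve E P \<and> ec_mult E m P = T" by auto
      then have "T \<noteq> Infinity" by (metis ec_mult_Infinity on_curve.simps(1))
      then obtain c y where "T = Affine c y" by (cases T) auto
      then show "T \<in> (\<Union>c\<in>C. Affine c ` {y. on_curve E (Affine c y)})" using T ex by blast
    qed
    then show ?thesis unfolding eventually_AE using \<open>finite C\<close> fy by (meson finite_UN_I finite_imageI finite_subset)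
  qed
  \<comment> \<open>For almost all \<open>R\<close> both \<open>R\<close> and R + T are multiples by
    m, and T = - R + (R + T).\<close>
  from this AE_shift[OF T this] AE_on_curve
  have "\<forall>\<^sub>F R in AE. \<exists>P. on_curve E P \<and> ec_mult E m P = T"
  proof eventually_elim
    case (elim R)
    then obtain P P' where P: "on_curve E P" "ec_mult E m P = R" "on_curve E P'" "ec_mult E m P' = R \<boxplus> T" by blast
    then have "ec_mult E m (neg P \<boxplus> P') = neg R \<boxplus> (R \<boxplus> T)" by (simp add: ec_mult_distrib ec_mult_neg)
    also have "\<dots> = T" using elim T pt_add_assoc[of "neg R" R T] neg_add[of R] by simp
    finally show ?case using P by (intro exI[of _ "neg P \<boxplus> P'"]) simp
  qed
  then show ?thesis using AE_nontrivial by simp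
qed

end

section \<open>The Weil pairing\<close>

lemma nat_mod_eqI:
  fixes a b k m :: nat
  assumes "m dvd k + a" "m dvd k + b"
  shows "a mod m = b mod m"
proof -
  have "int m dvd int (k + a) - int (k + b)" using assms by (intro dvd_diff) (simp_all only: int_dvd_int_iff)
  then have "int a mod int m = int b mod int m" by (simp add: mod_eq_dvd_iff)
  then show ?thesis by (simp flip: zmod_int)
qed

context ec
begin

text \<open>
  A finite group \<open>H\<close> of translations has no invariant function whose only poles are simple poles at
  the points of \<open>H\<close>: such a function would identify the quotient of the curve by \<open>H\<close> with the
  projective line, on which every translation would act as a linear fractional transformation; but
  the latter has a fixed point.
\<close>

lemma no_invariant_simple_pole:
  assumes H: "finite H" "\<And>P. P \<in> H \<Longrightarrow> on_curve E P" "Infinity \<in> H"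
      "\<And>P Q. P \<in> H \<Longrightarrow> Q \<in> H \<Longrightarrow> P \<boxplus> Q \<in> H" "\<And>P. P \<in> H \<Longrightarrow> neg P \<in> H"
    and g: "g \<in> L" "g \<noteq> 0" and inv: "\<And>S. S \<in> H \<Longrightarrow> tr S g = g"
    and pole: "\<And>P. P \<in> H \<Longrightarrow> ord P g = -1"
    and reg: "\<And>P. on_curve E P \<Longrightarrow> P \<notin> H \<Longrightarrow> reg P g"
  shows False
proof -
  have O: "on_curve E Infinity" by simp
  have gnc: "g \<noteq> kc c" for c
    using pole[OF H(3)] ord_const[OF O, of c] g(2) by (cases "c = 0") auto
  have Hadd: "P \<boxplus> R \<in> H \<longleftrightarrow> P \<in> H" if "on_curve E P" "R \<in> H" for P R
    using H(4)[of P R] H(4)[of "P \<boxplus> R" "neg R"] H(5)[of R] H(2)[of R] that add_neg_cancel(1)[of P R] by metis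
  have nreg: "\<not> reg P g" if "P \<in> H" for P
    using reg_iff[OF H(2)[OF that] g] pole[OF that] by simp
  \<comment> \<open>By invariance, all poles on \<open>H\<close> are governed by the one at
    infinity. Subtracting the multiple of \<open>g\<close> with the same leading coefficient removes
    them and leaves a constant.\<close>
  have span: "\<exists>A B. f = kc A * g + kc B"
    if f: "f \<in> L" "\<And>S. S \<in> H \<Longrightarrow> tr S f = f" "\<And>P. on_curve E P \<Longrightarrow> P \<notin> H \<Longrightarrow> reg P f"
      "f = 0 \<or> ord Infinity f \<ge> -1" for f
  proof (cases "f = 0")
    case True
    then show ?thesis by (intro exI[of _ 0]) simp
  next
    case False
    have "ord Infinity (f / g) \<ge> 0"
      using ord_divide[OF O f(1) False g] f(4) False pole[OF H(3)] by simp
    then have "reg Infinity (f / g)" using reg_iff[OF O, of "f / g"] f(1) False g by simp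
    then obtain A where A: "val Infinity (f / g) A" unfolding reg_def by blast
    define h where "h = f - kc A * g"
    have hL: "h \<in> L" using f g by (simp add: h_def)
    have h0: "reg Infinity h"
    proof (cases "h = 0")
      case True
      then show ?thesis using reg_const[OF O, of 0] by simp
    next
      case hnz: False
      define k where "k = f / g - kc A"
      have hk: "h = g * k" using g(2) by (simp add: h_def k_def field_simps)
      have k: "k \<in> L" "k \<noteq> 0" using f g hnz hk by (auto simp: k_def)
      have "val Infinity k 0" unfolding k_def using val_diff[OF O A val_const[OF O, of A]] by simp
      then have "ord Infinity k > 0" using val_0_iff[OF O k] by blast
      then have "ord Infinity h \<ge> 0" unfolding hk using ord_mult[OF O g k] pole[OF H(3)] by simp
      then show ?thesis using reg_iff[OF O hL hnz] by simp
    qed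
    have "reg P h" if P: "on_curve E P" for P
    proof (cases "P \<in> H")
      case True
      have nP: "neg P \<in> H" "on_curve E (neg P)" using H True P by simp_all
      obtain c where "val Infinity h c" using h0 unfolding reg_def by blast
      then have "val P (tr (neg P) h) c" using val_tr[OF nP(2) P] pt_add_neg by simp
      moreover have "tr (neg P) h = h"
        unfolding h_def using f(1) g(1) nP by (simp add: tr_diff tr_mult f(2) inv)
      ultimately show ?thesis unfolding reg_def by auto
    next
      case False
      then obtain c d where "val P f c" "val P g d" using f(3)[OF P] reg[OF P] unfolding reg_def by blast
      then have "val P h (c - A * d)" unfolding h_def by (intro val_diff val_mult val_const P)
      then show ?thesis unfolding reg_def by blast
    qed
    then obtain B where "h = kc B" using regular_const[OF hL] by blast
    then have "f = kc A * g + kc B" by (simp add: h_def algebra_simps)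
    then show ?thesis by blast
  qed
  \<comment> \<open>The poles of the translated function lie on the coset of -S, where
    \<open>g\<close> takes the value \<open>c\<close>; the factor g - c cancels them. The condition
    \<open>A * c + B \<noteq> 0\<close> says that the resulting fractional transformation is
    nondegenerate.\<close>
  have moebius: "\<exists>A B. (g - kc c) * tr S g = kc A * g + kc B \<and> A * c + B \<noteq> 0"
    if S: "on_curve E S" "S \<notin> H" and c: "val (neg S) g c" for S c
  proof -
    have nS: "on_curve E (neg S)" using S by simp
    have tL: "tr S g \<in> L" "tr S g \<noteq> 0" using S g tr_nonzero[OF S(1)] by simp_all
    have gc: "g - kc c \<in> L" "g - kc c \<noteq> 0" using g gnc by simp_all
    define f where "f = (g - kc c) * tr S g"
    have fL: "f \<in> L" "f \<noteq> 0" using tL gc by (simp_all add: f_def)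
    have of: "ord P f = ord P (g - kc c) + ord (P \<boxplus> S) g" if "on_curve E P" for P
      unfolding f_def using ord_mult[OF that gc tL] ord_tr[OF S(1) that g] by simp
    have SH: "Infinity \<boxplus> S \<notin> H" using S by simp
    have "ord (Infinity \<boxplus> S) g \<ge> 0" using reg_iff[OF _ g, of S] reg[OF S] S by simp
    moreover have "ord Infinity (g - kc c) = -1"
      using ord_add_const[OF O g, of "- c"] pole[OF H(3)] by simp
    ultimately have "ord Infinity f \<ge> -1" using of[OF O] by simp
    moreover have "tr R f = f" if R: "R \<in> H" for R
    proof -
      have "tr R (tr S g) = tr S (tr R g)"
        using tr_tr[OF H(2)[OF R] S(1) g(1)] tr_tr[OF S(1) H(2)[OF R] g(1)] pt_add_commute[OF H(2)[OF R] S(1)] by simp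
      then show ?thesis unfolding f_def
        using H(2)[OF R] gc tL g inv[OF R] by (simp add: tr_mult tr_diff)
    qed
    moreover have "reg P f" if P: "on_curve E P" "P \<notin> H" for P
    proof (cases "P \<boxplus> S \<in> H")
      case False
      have "ord (P \<boxplus> S) g \<ge> 0" using reg_iff[OF _ g, of "P \<boxplus> S"] reg[of "P \<boxplus> S"] False P S by simp
      moreover have "reg P (g - kc c)" using reg[OF P] val_diff[OF P(1) _ val_const[OF P(1)]] unfolding reg_def by blast
      then have "ord P (g - kc c) \<ge> 0" using reg_iff[OF P(1) gc] by simp
      ultimately show ?thesis using of[OF P(1)] reg_iff[OF P(1) fL] by simp
    next
      case True
      define R where "R = P \<boxplus> S"
      have R: "R \<in> H" "on_curve E R" "neg R \<in> H" "on_curve E (neg R)" using True H(2,5) by (auto simp: R_def)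
      have "P \<boxplus> neg R = neg S"
      proof -
        have "P = R \<boxplus> neg S" using add_neg_cancel(1)[OF P(1) S(1)] by (simp add: R_def)
        then have "P \<boxplus> neg R = neg S \<boxplus> R \<boxplus> neg R" using pt_add_commute[OF R(2) nS] by simp
        then show ?thesis using add_neg_cancel(1)[OF nS R(2)] by simp
      qed
      then have "val P (tr (neg R) g) c" using val_tr[OF R(4) P(1)] c by simp
      then have "val P g c" using inv[OF R(3)] by simp
      then have "val P (g - kc c) (c - c)" by (intro val_diff val_const P)
      then have "ord P (g - kc c) > 0" using val_0_iff[OF P(1) gc] by simp
      then show ?thesis using of[OF P(1)] pole[OF True] reg_iff[OF P(1) fL] by simp
    qed
    ultimately obtain A B where AB: "f = kc A * g + kc B" using span fL by blast
    have "A * c + B \<noteq> 0"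
    proof
      assume "A * c + B = 0"
      then have "kc A * kc c + kc B = 0" by (metis kc.add kc.mult kc.zero)
      then have "(g - kc c) * tr S g = (g - kc c) * kc A" using AB unfolding f_def by Groebner_Basis.algebra
      then have "tr S g = kc A" using gc by simp
      then have "g = kc A" using tr_tr[OF nS S(1) g(1)] neg_add[OF S(1)] tr_Infinity[OF g(1)] tr_kc[OF nS] by metis
      then show False using gnc by blast
    qed
    then show ?thesis using AB[unfolded f_def] by blast
  qed
  \<comment> \<open>\<open>g\<close> separates the cosets of \<open>H\<close>: in
    \<open>moebius\<close> for translation by -Q the left side would vanish at \<open>Q'\<close>,
    while the right side has the nonzero value A t + B.\<close>
  have inj: "Q' \<boxplus> neg Q \<in> H"
    if Q: "on_curve E Q" "val Q g t" and Q': "on_curve E Q'" "val Q' g t" for Q Q' t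
  proof (rule ccontr)
    assume n: "Q' \<boxplus> neg Q \<notin> H"
    have "Q \<notin> H" using nreg Q unfolding reg_def by blast
    then have nQ: "on_curve E (neg Q)" "neg Q \<notin> H" using Q H(5)[of "neg Q"] by auto
    then obtain A B where AB: "(g - kc t) * tr (neg Q) g = kc A * g + kc B" "A * t + B \<noteq> 0"
      using moebius[OF nQ, unfolded neg_neg, OF Q(2)] by blast
    obtain d where "val (Q' \<boxplus> neg Q) g d" using reg[of "Q' \<boxplus> neg Q"] n Q' nQ unfolding reg_def by auto
    then have "val Q' (tr (neg Q) g) d" using val_tr[OF nQ(1) Q'(1)] by blast
    then have "val Q' ((g - kc t) * tr (neg Q) g) ((t - t) * d)" by (intro val_mult val_diff val_const Q')
    moreover have "val Q' (kc A * g + kc B) (A * t + B)" by (intro val_add val_mult val_const Q')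
    ultimately show False using AB val_unique[OF Q'(1)] by fastforce
  qed
  obtain S where S: "on_curve E S" "S \<notin> H"
    using infinite_points H(1) finite_subset[of "{P. on_curve E P}" H] by blast
  then have nS: "on_curve E (neg S)" "neg S \<notin> H" using H(5)[of "neg S"] by auto
  obtain c where c: "val (neg S) g c" using reg[OF nS] unfolding reg_def by blast
  obtain A B where AB: "(g - kc c) * tr S g = kc A * g + kc B" "A * c + B \<noteq> 0"
    using moebius[OF S c] by blast
  \<comment> \<open>A root is a fixed point of t -> (A t + B) / (t - c). A point \<open>Q\<close>
    with value \<open>t\<close> then has the same value as Q + S, which contradicts the separation
    of cosets.\<close>
  have "\<exists>t. poly [:- B, - c - A, 1:] t = 0" by (rule alg_closed_imp_poly_has_root) simp
  then obtain t where t0: "poly [:- B, - c - A, 1:] t = 0" by blast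
  have t: "t * (t - c) = A * t + B" using t0 by (simp add: algebra_simps)
  then have tc: "t - c \<noteq> 0" using AB(2) by auto
  obtain Q where Q: "on_curve E Q" "val Q g t" using takes_value[OF g(1) gnc] by blast
  have "val Q ((kc A * g + kc B) / (g - kc c)) ((A * t + B) / (t - c))"
    by (intro val_divide val_add val_diff val_mult val_const Q tc)
  moreover have "(kc A * g + kc B) / (g - kc c) = tr S g"
    unfolding AB(1)[symmetric] using gnc by simp
  moreover have "(A * t + B) / (t - c) = t" using t tc by (simp flip: t)
  ultimately have "val Q (tr S g) t" by simp
  then have "val (Q \<boxplus> S) (tr (neg S) (tr S g)) t"
    using val_tr[OF nS(1), of "Q \<boxplus> S"] add_neg_cancel(1)[OF Q(1) S(1)] Q S by simp
  then have QS: "val (Q \<boxplus> S) g t" using tr_tr[OF nS(1) S(1) g(1)] neg_add[OF S(1)] tr_Infinity[OF g(1)] by simp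
  have "Q \<boxplus> S \<boxplus> neg Q \<in> H" using inj[OF Q _ QS] Q S by simp
  moreover have "Q \<boxplus> S \<boxplus> neg Q = S"
    using pt_add_commute[OF Q(1) S(1)] add_neg_cancel(1)[OF S(1) Q(1)] by simp
  ultimately show False using S(2) by simp
qed

end

section \<open>Weil functions and the pairing on the torsion group\<close>

locale ec_basis = ec E for E :: "'a::alg_closed_field weierstrass" +
  fixes m :: nat and P1 P2 :: "'a point"
  assumes m: "m > 0"
    and P1: "on_curve E P1" "ec_mult E m P1 = Infinity"
    and P2: "on_curve E P2" "ec_mult E m P2 = Infinity"
    and generate: "on_curve E P \<Longrightarrow> ec_mult E m P = Infinity \<Longrightarrow>
      \<exists>a b. P = ec_add E (ec_mult E a P1) (ec_mult E b P2)"
    and independent: "ec_add E (ec_mult E a P1) (ec_mult E b P2) = Infinity \<Longrightarrow> m dvd a \<and> m dvd b"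
begin

abbreviation "H \<equiv> tors m"

lemma tors_on_curve: "P \<in> H \<Longrightarrow> on_curve E P" and tors_mult: "P \<in> H \<Longrightarrow> ec_mult E m P = Infinity"
  by (simp_all add: tors_def)

lemma tors_Infinity: "Infinity \<in> H" and tors_P1: "P1 \<in> H" and tors_P2: "P2 \<in> H"
  using P1 P2 by (simp_all add: tors_def)

lemma tors_add: "P \<in> H \<Longrightarrow> Q \<in> H \<Longrightarrow> P \<boxplus> Q \<in> H"
  by (simp add: tors_def ec_mult_distrib)

lemma tors_neg: "P \<in> H \<Longrightarrow> neg P \<in> H"
  by (simp add: tors_def ec_mult_neg)

lemma tors_ec_mult: "P \<in> H \<Longrightarrow> ec_mult E n P \<in> H"
  by (induction n) (simp_all add: ec_mult_Suc tors_add tors_Infinity)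

lemma ec_mult_mod: "P \<in> H \<Longrightarrow> ec_mult E (n mod m) P = ec_mult E n P"
proof -
  assume P: "P \<in> H"
  have "ec_mult E n P = ec_mult E (n mod m + n div m * m) P" by simp
  also have "\<dots> = ec_mult E (n mod m) P \<boxplus> ec_mult E (n div m) (ec_mult E m P)"
    using tors_on_curve[OF P] by (simp only: ec_mult_add ec_mult_mult)
  finally show ?thesis using tors_mult[OF P] by simp
qed

lemma combination_inj:
  assumes "ec_mult E a P1 \<boxplus> ec_mult E b P2 = ec_mult E c P1 \<boxplus> ec_mult E d P2"
  shows "a mod m = c mod m" "b mod m = d mod m"
proof -
  \<comment> \<open>Natural numbers representing -c and -d modulo m.\<close>
  define c' d' where "c' = m * c - c" and "d' = m * d - d"
  have c': "c' + c = m * c" and d': "d' + d = m * d" using m by (simp_all add: c'_def d'_def)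
  have z: "ec_mult E c' P1 \<boxplus> ec_mult E c P1 = Infinity" "ec_mult E d' P2 \<boxplus> ec_mult E d P2 = Infinity"
    using P1 P2 by (simp_all flip: ec_mult_add add: c' d' mult.commute[of m] ec_mult_mult)
  have "ec_mult E (c' + a) P1 \<boxplus> ec_mult E (d' + b) P2 =
      (ec_mult E c' P1 \<boxplus> ec_mult E d' P2) \<boxplus> (ec_mult E a P1 \<boxplus> ec_mult E b P2)"
    using P1 P2 by (simp add: ec_mult_add pt_add_assoc pt_add_left_commute)
  also have "\<dots> = (ec_mult E c' P1 \<boxplus> ec_mult E c P1) \<boxplus> (ec_mult E d' P2 \<boxplus> ec_mult E d P2)"
    unfolding assms using P1 P2 by (simp add: pt_add_assoc pt_add_left_commute)
  finally have "m dvd c' + a" "m dvd d' + b" using z independent by simp_all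
  moreover have "m dvd c' + c" "m dvd d' + d" unfolding c' d' by simp_all
  ultimately show "a mod m = c mod m" "b mod m = d mod m" using nat_mod_eqI by blast+
qed

lemma tors_eq: "H = (\<lambda>(a, b). ec_mult E a P1 \<boxplus> ec_mult E b P2) ` ({..<m} \<times> {..<m})"
proof (intro equalityI subsetI)
  fix P assume P: "P \<in> H"
  then obtain a b where ab: "P = ec_mult E a P1 \<boxplus> ec_mult E b P2"
    using generate tors_on_curve tors_mult by blast
  then have "P = ec_mult E (a mod m) P1 \<boxplus> ec_mult E (b mod m) P2"
    using ec_mult_mod tors_P1 tors_P2 by simp
  then show "P \<in> (\<lambda>(a, b). ec_mult E a P1 \<boxplus> ec_mult E b P2) ` ({..<m} \<times> {..<m})"
    using m by (intro image_eqI[of _ _ "(a mod m, b mod m)"]) auto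
next
  fix P assume "P \<in> (\<lambda>(a, b). ec_mult E a P1 \<boxplus> ec_mult E b P2) ` ({..<m} \<times> {..<m})"
  then show "P \<in> H" using tors_add tors_ec_mult tors_P1 tors_P2 by auto
qed

lemma finite_tors: "finite H"
  unfolding tors_eq by simp

lemma card_tors: "card H = m * m"
proof -
  have "inj_on (\<lambda>(a, b). ec_mult E a P1 \<boxplus> ec_mult E b P2) ({..<m} \<times> {..<m})"
  proof (rule inj_onI)
    fix x y assume xy: "x \<in> {..<m} \<times> {..<m}" "y \<in> {..<m} \<times> {..<m}"
      "(\<lambda>(a, b). ec_mult E a P1 \<boxplus> ec_mult E b P2) x = (\<lambda>(a, b). ec_mult E a P1 \<boxplus> ec_mult E b P2) y"
    obtain a b c d where "x = (a, b)" "y = (c, d)" by (cases x, cases y)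
    then show "x = y" using combination_inj[of a b c d] xy by simp
  qed
  then show ?thesis unfolding tors_eq by (simp add: card_image card_cartesian_product)
qed

definition wfun :: "'a point \<Rightarrow> 'a ff \<Rightarrow> bool" where
  "wfun T g \<longleftrightarrow> g \<in> L \<and> g \<noteq> 0 \<and> (\<forall>P. on_curve E P \<longrightarrow>
     ord P g = of_bool (ec_mult E m P = T) - of_bool (ec_mult E m P = Infinity))"

text \<open>The chord functions of T and its successive multiples telescope.\<close>

lemma multiple_function:
  assumes T: "on_curve E T"
  shows "\<exists>f. f \<in> L \<and> f \<noteq> 0 \<and> (\<forall>P. on_curve E P \<longrightarrow> ord P f = int n * of_bool (P = T)
    - int n * of_bool (P = Infinity) - of_bool (P = ec_mult E n T) + of_bool (P = Infinity))"
proof (induction n)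
  case 0
  show ?case using ord_unit[OF _ unit_1] by (intro exI[of _ 1]) simp
next
  case (Suc n)
  then obtain f where f: "f \<in> L" "f \<noteq> 0" "\<And>P. on_curve E P \<Longrightarrow> ord P f = int n * of_bool (P = T)
    - int n * of_bool (P = Infinity) - of_bool (P = ec_mult E n T) + of_bool (P = Infinity)" by blast
  obtain h where h: "h \<in> L" "h \<noteq> 0" "\<And>R. on_curve E R \<Longrightarrow> ord R h = of_bool (R = T) + of_bool (R = ec_mult E n T)
      - of_bool (R = T \<boxplus> ec_mult E n T) - of_bool (R = Infinity)"
    using chord_function[OF T on_curve_mult[OF T]] by blast
  have "ord P (f * h) = int (Suc n) * of_bool (P = T) - int (Suc n) * of_bool (P = Infinity)
      - of_bool (P = ec_mult E (Suc n) T) + of_bool (P = Infinity)" if P: "on_curve E P" for P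
    unfolding ord_mult[OF P f(1,2) h(1,2)] f(3)[OF P] h(3)[OF P] ec_mult_Suc of_nat_Suc distrib_right by linarith
  then show ?case using f(1,2) h(1,2) by (intro exI[of _ "f * h"]) simp
qed

text \<open>The inverse chord function of \<open>R\<close> and \<open>T\<close> contributes (R + T)
  - (R) - (T) + (O); these are multiplied over \<open>A\<close>.\<close>

lemma shifted_function:
  assumes T: "on_curve E T" and A: "finite A" "\<And>R. R \<in> A \<Longrightarrow> on_curve E R"
  shows "\<exists>f. f \<in> L \<and> f \<noteq> 0 \<and> (\<forall>P. on_curve E P \<longrightarrow> ord P f = (\<Sum>R\<in>A. of_bool (P = R \<boxplus> T) - of_bool (P = R))
    - int (card A) * (of_bool (P = T) - of_bool (P = Infinity)))"
  using A
proof (induction A rule: finite_induct)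
  case empty
  show ?case using ord_unit[OF _ unit_1] by (intro exI[of _ 1]) simp
next
  case (insert R A)
  then obtain f where f: "f \<in> L" "f \<noteq> 0" "\<And>P. on_curve E P \<Longrightarrow> ord P f = (\<Sum>R\<in>A. of_bool (P = R \<boxplus> T) - of_bool (P = R))
    - int (card A) * (of_bool (P = T) - of_bool (P = Infinity))" by auto
  have R: "on_curve E R" using insert by simp
  obtain h where h: "h \<in> L" "h \<noteq> 0" "\<And>P. on_curve E P \<Longrightarrow> ord P h = of_bool (P = R) + of_bool (P = T)
      - of_bool (P = R \<boxplus> T) - of_bool (P = Infinity)"
    using chord_function[OF R T] by blast
  have "ord P (f / h) = (\<Sum>R\<in>insert R A. of_bool (P = R \<boxplus> T) - of_bool (P = R))
      - int (card (insert R A)) * (of_bool (P = T) - of_bool (P = Infinity))" if P: "on_curve E P" for P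
    unfolding ord_divide[OF P f(1,2) h(1,2)] f(3)[OF P] h(3)[OF P] sum.insert[OF insert(1,2)]
      card_insert_disjoint[OF insert(1,2)] of_nat_Suc by Groebner_Basis.algebra
  then show ?case using f(1,2) h(1,2) by (intro exI[of _ "f / h"]) simp
qed

text \<open>The translates R + T with R in \<open>H\<close> run through the fibre of [m] over m T,
  each point once.\<close>

lemma shift_sum:
  assumes P: "on_curve E P" and T: "on_curve E T"
  shows "(\<Sum>R\<in>H. of_bool (P = R \<boxplus> T)) = (of_bool (ec_mult E m P = ec_mult E m T) :: int)"
proof -
  have eq: "P = R \<boxplus> T \<longleftrightarrow> R = P \<boxplus> neg T" if "R \<in> H" for R
    using add_neg_cancel[of R T] add_neg_cancel[of P T] tors_on_curve[OF that] P T by metis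
  have "(\<Sum>R\<in>H. of_bool (P = R \<boxplus> T)) = (\<Sum>R\<in>H. if R = P \<boxplus> neg T then 1 else (0::int))"
    using eq by (intro sum.cong) auto
  also have "\<dots> = of_bool (P \<boxplus> neg T \<in> H)" by (simp add: finite_tors)
  also have "P \<boxplus> neg T \<in> H \<longleftrightarrow> ec_mult E m P = ec_mult E m T"
    using P T add_eq_Infinity_iff[of "ec_mult E m P" "neg (ec_mult E m T)"]
    by (simp add: tors_def ec_mult_distrib ec_mult_neg)
  finally show ?thesis .
qed

text \<open>For an m-th part \<open>T'\<close> of \<open>T\<close>, \<open>shifted_function\<close>
  over \<open>H\<close> leaves the excess m^2 ((O) - (T')). It is cancelled by
  \<open>multiple_function\<close> with n = m^2, because m^2 T' = m T = O.\<close>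

lemma wfun_exists:
  assumes T: "T \<in> H" shows "\<exists>g. wfun T g"
proof -
  obtain T' where T': "on_curve E T'" "ec_mult E m T' = T"
    using mult_surjective[OF finite_tors tors_on_curve[OF T]] by blast
  obtain f where f: "f \<in> L" "f \<noteq> 0" "\<And>P. on_curve E P \<Longrightarrow> ord P f = (\<Sum>R\<in>H. of_bool (P = R \<boxplus> T') - of_bool (P = R))
    - int (card H) * (of_bool (P = T') - of_bool (P = Infinity))"
    using shifted_function[OF T'(1) finite_tors] tors_on_curve by blast
  obtain h where h: "h \<in> L" "h \<noteq> 0" "\<And>P. on_curve E P \<Longrightarrow> ord P h = int (m * m) * of_bool (P = T')
    - int (m * m) * of_bool (P = Infinity) - of_bool (P = ec_mult E (m * m) T') + of_bool (P = Infinity)"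
    using multiple_function[OF T'(1)] by blast
  have mm: "ec_mult E (m * m) T' = Infinity" using T' tors_mult[OF T] by (simp add: ec_mult_mult)
  have "ord P (f * h) = of_bool (ec_mult E m P = T) - of_bool (ec_mult E m P = Infinity)" if P: "on_curve E P" for P
  proof -
    have "ord P (f * h) = (\<Sum>R\<in>H. of_bool (P = R \<boxplus> T')) - (\<Sum>R\<in>H. of_bool (P = R \<boxplus> Infinity))"
      using ord_mult[OF P f(1,2) h(1,2)] f(3)[OF P] h(3)[OF P] mm card_tors
      by (simp add: sum_subtractf algebra_simps)
    then show ?thesis using shift_sum[OF P T'(1)] shift_sum[OF P, of Infinity] T' by simp
  qed
  then show ?thesis unfolding wfun_def using f h by (intro exI[of _ "f * h"]) simp
qed

lemma same_divisor_const:
  assumes f: "f \<in> L" "f \<noteq> 0" and g: "g \<in> L" "g \<noteq> 0" and o: "\<And>P. on_curve E P \<Longrightarrow> ord P f = ord P g"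
  obtains c where "c \<noteq> 0" "f = kc c * g"
proof -
  have fg: "f / g \<in> L" "f / g \<noteq> 0" using f g by simp_all
  have "reg P (f / g)" if P: "on_curve E P" for P
    using reg_iff[OF P fg] ord_divide[OF P f g] o[OF P] by simp
  then obtain c where c: "f / g = kc c" using regular_const[OF fg(1)] by blast
  then have "f = kc c * g" "c \<noteq> 0" using fg g by (auto simp: field_simps)
  then show ?thesis using that by blast
qed

lemma wfun_tr:
  assumes S: "S \<in> H" and g: "wfun T g"
  shows "wfun T (tr S g)"
  using g tors_on_curve[OF S] tors_mult[OF S] unfolding wfun_def
  by (auto simp: tr_nonzero ord_tr ec_mult_distrib)

definition pair :: "'a point \<Rightarrow> 'a point \<Rightarrow> 'a" where
  "pair S T = (SOME c. \<forall>g. wfun T g \<longrightarrow> tr S g = kc c * g)"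

text \<open>Translation by \<open>S\<close> preserves the divisor of \<open>g\<close>, and functions
  with equal divisors are proportional. One constant serves all \<open>g\<close>, since these are
  proportional among themselves.\<close>

lemma pair:
  assumes S: "S \<in> H" and g: "wfun T g"
  shows "tr S g = kc (pair S T) * g" "pair S T \<noteq> 0"
proof -
  have S': "on_curve E S" using tors_on_curve[OF S] .
  have w: "wfun T g \<Longrightarrow> g \<in> L \<and> g \<noteq> 0" for g unfolding wfun_def by blast
  obtain c where c: "c \<noteq> 0" "tr S g = kc c * g"
    by (rule same_divisor_const[of "tr S g" g]) (use wfun_tr[OF S g] g in \<open>auto simp: wfun_def\<close>)
  have "tr S g' = kc c * g'" if g': "wfun T g'" for g'
  proof -
    obtain d where d: "g' = kc d * g"
      by (rule same_divisor_const[of g' g]) (use g g' in \<open>auto simp: wfun_def\<close>)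
    have gL: "g \<in> L" using w[OF g] by blast
    show ?thesis unfolding d tr_mult[OF S' L_kc gL] tr_kc[OF S'] c(2) by (rule mult.left_commute)
  qed
  then have "\<exists>c. \<forall>g. wfun T g \<longrightarrow> tr S g = kc c * g" by blast
  then show p: "tr S g = kc (pair S T) * g"
    unfolding pair_def using someI_ex[of "\<lambda>c. \<forall>g. wfun T g \<longrightarrow> tr S g = kc c * g"] g by blast
  then show "pair S T \<noteq> 0" using tr_nonzero[OF S', of g] w[OF g] by auto
qed

lemma pairI:
  assumes "S \<in> H" "wfun T g" "tr S g = kc c * g"
  shows "pair S T = c"
  using pair(1)[OF assms(1,2)] assms(2,3) unfolding wfun_def by simp

lemma pair_add_left:
  assumes S: "S \<in> H" "S' \<in> H" and T: "T \<in> H"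
  shows "pair (S \<boxplus> S') T = pair S T * pair S' T"
proof -
  obtain g where g: "wfun T g" using wfun_exists[OF T] by blast
  then have gL: "g \<in> L" unfolding wfun_def by blast
  note S' = tors_on_curve[OF S(1)] tors_on_curve[OF S(2)]
  have "tr (S \<boxplus> S') g = tr S (kc (pair S' T) * g)"
    unfolding tr_tr[OF S' gL, symmetric] pair(1)[OF S(2) g] by (rule refl)
  also have "\<dots> = kc (pair S T * pair S' T) * g"
    using S' gL by (simp add: tr_mult pair(1)[OF S(1) g])
  finally show ?thesis using pairI[OF tors_add[OF S] g] by blast
qed

lemma pair_Infinity_left: "T \<in> H \<Longrightarrow> pair Infinity T = 1"
  using wfun_exists[of T] pairI[OF tors_Infinity, of T _ 1] tr_Infinity unfolding wfun_def by fastforce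

lemma pair_mult_left: "S \<in> H \<Longrightarrow> T \<in> H \<Longrightarrow> pair (ec_mult E n S) T = pair S T ^ n"
  by (induction n) (simp_all add: pair_Infinity_left ec_mult_Suc pair_add_left tors_ec_mult)

lemma tr_prod: "on_curve E S \<Longrightarrow> (\<And>i. i \<in> A \<Longrightarrow> f i \<in> L) \<Longrightarrow> tr S (prod f A) = (\<Prod>i\<in>A. tr S (f i))"
  by (induction A rule: infinite_finite_induct) (simp_all add: tr_mult)

text \<open>Take m-th parts \<open>T'\<close> and \<open>U'\<close>. The product over
  \<open>H\<close> of the translates of their chord function is invariant under \<open>H\<close>,
  and dividing \<open>g * h\<close> by it gives a Weil function for T + U, so the translation
  factors multiply.\<close>

lemma pair_add_right:
  assumes S: "S \<in> H" and T: "T \<in> H" "U \<in> H"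
  shows "pair S (T \<boxplus> U) = pair S T * pair S U"
proof -
  note S' = tors_on_curve[OF S]
  obtain T' where T': "on_curve E T'" "ec_mult E m T' = T"
    using mult_surjective[OF finite_tors tors_on_curve[OF T(1)]] by blast
  obtain U' where U': "on_curve E U'" "ec_mult E m U' = U"
    using mult_surjective[OF finite_tors tors_on_curve[OF T(2)]] by blast
  obtain g h where gh: "wfun T g" "wfun U h" using wfun_exists T by blast
  then have L: "g \<in> L" "g \<noteq> 0" "h \<in> L" "h \<noteq> 0" unfolding wfun_def by auto
  obtain l where l: "l \<in> L" "l \<noteq> 0" "\<And>P. on_curve E P \<Longrightarrow> ord P l = of_bool (P = T') + of_bool (P = U')
      - of_bool (P = T' \<boxplus> U') - of_bool (P = Infinity)"
    using chord_function[OF T'(1) U'(1)] by blast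
  define k where "k = (\<Prod>R\<in>H. tr (neg R) l)"
  have k: "k \<in> L" "k \<noteq> 0" using l tr_nonzero tors_on_curve finite_tors by (auto simp: k_def)
  have trk: "tr S k = k"
  proof -
    have "tr S k = (\<Prod>R\<in>H. tr (S \<boxplus> neg R) l)"
      unfolding k_def using S' l tors_on_curve by (subst tr_prod) (auto simp: tr_tr intro!: prod.cong)
    also have "\<dots> = (\<Prod>R\<in>H. tr (neg R) l)"
    proof (rule prod.reindex_bij_witness[of _ "\<lambda>R. R \<boxplus> S" "\<lambda>R. R \<boxplus> neg S"])
      fix R assume R: "R \<in> H"
      note R' = tors_on_curve[OF R]
      show "R \<boxplus> neg S \<boxplus> S = R" "R \<boxplus> S \<boxplus> neg S = R" using add_neg_cancel[OF R' S'] by simp_all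
      show "R \<boxplus> neg S \<in> H" "R \<boxplus> S \<in> H" using tors_add tors_neg R S by simp_all
      have "neg (R \<boxplus> neg S) = S \<boxplus> neg R"
      proof -
        have "(S \<boxplus> neg R) \<boxplus> (R \<boxplus> neg S) = Infinity"
          using S' R' by (simp add: pt_add_assoc pt_add_left_commute[of "neg R" R] neg_add pt_add_neg flip: pt_add_assoc[of "neg R"])
        then show ?thesis using add_eq_Infinity_iff[of "S \<boxplus> neg R" "R \<boxplus> neg S"] S' R' by simp
      qed
      then show "tr (neg (R \<boxplus> neg S)) l = tr (S \<boxplus> neg R) l" by simp
    qed
    finally show ?thesis unfolding k_def .
  qed
  have ok: "ord P k = of_bool (ec_mult E m P = T) + of_bool (ec_mult E m P = U)
      - of_bool (ec_mult E m P = T \<boxplus> U) - of_bool (ec_mult E m P = Infinity)" if P: "on_curve E P" for P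
  proof -
    have sh: "P \<boxplus> neg R = Q \<longleftrightarrow> P = R \<boxplus> Q" if "R \<in> H" "on_curve E Q" for R Q
      using add_neg_cancel[of P R] add_neg_cancel[of Q R] tors_on_curve[OF that(1)] that P pt_add_commute[of R Q] by metis
    have "ord P k = (\<Sum>R\<in>H. ord (P \<boxplus> neg R) l)"
      unfolding k_def using finite_tors tors_on_curve l tr_nonzero P
      by (subst ord_prod[OF P]) (auto simp: ord_tr intro!: sum.cong)
    also have "\<dots> = (\<Sum>R\<in>H. of_bool (P = R \<boxplus> T') + of_bool (P = R \<boxplus> U') - of_bool (P = R \<boxplus> (T' \<boxplus> U')) - of_bool (P = R \<boxplus> Infinity))"
      using l(3) P T' U' tors_on_curve by (intro sum.cong refl) (simp add: sh del: pt_add_Infinity)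
    also have "\<dots> = of_bool (ec_mult E m P = T) + of_bool (ec_mult E m P = U)
      - of_bool (ec_mult E m P = T \<boxplus> U) - of_bool (ec_mult E m P = Infinity)"
      unfolding sum_subtractf sum.distrib using shift_sum[OF P] T' U' by (simp add: ec_mult_distrib del: pt_add_Infinity)
    finally show ?thesis .
  qed
  have w: "wfun (T \<boxplus> U) (g * h / k)"
    unfolding wfun_def using gh k ok L by (simp add: wfun_def ord_divide ord_mult)
  have "tr S (g * h / k) = kc (pair S T * pair S U) * (g * h / k)"
    using S' L k pair(1)[OF S gh(1)] pair(1)[OF S gh(2)] trk
    by (simp add: divide_inverse tr_mult tr_inverse)
  then show ?thesis using pairI[OF S w] by blast
qed

lemma pair_Infinity_right: "S \<in> H \<Longrightarrow> pair S Infinity = 1"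
proof -
  assume S: "S \<in> H"
  obtain g where "wfun Infinity g" using wfun_exists[OF tors_Infinity] by blast
  then have "pair S Infinity \<noteq> 0" by (rule pair(2)[OF S])
  then show ?thesis using pair_add_right[OF S tors_Infinity tors_Infinity] by simp
qed

lemma pair_mult_right: "S \<in> H \<Longrightarrow> T \<in> H \<Longrightarrow> pair S (ec_mult E n T) = pair S T ^ n"
  by (induction n) (simp_all add: pair_Infinity_right ec_mult_Suc pair_add_right tors_ec_mult)

text \<open>For an m-th part \<open>T'\<close> of \<open>T\<close>, the translates of
  \<open>g\<close> by 0, -T', ..., -(m-1) T' have a product with telescoping, hence trivial,
  divisor. This constant is unchanged by one more translation, so its first factor equals the one
  entering at the end, the translate by -T.\<close>

lemma pair_self:
  assumes T: "T \<in> H" shows "pair T T = 1"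
proof -
  obtain T' where T': "on_curve E T'" "ec_mult E m T' = T"
    using mult_surjective[OF finite_tors tors_on_curve[OF T]] by blast
  obtain g where g: "wfun T g" using wfun_exists[OF T] by blast
  then have gL: "g \<in> L" "g \<noteq> 0" unfolding wfun_def by auto
  define N where "N i = neg (ec_mult E i T')" for i
  have N: "on_curve E (N i)" for i using T' by (simp add: N_def)
  define h where "h = (\<Prod>i<m. tr (N i) g)"
  have h: "h \<in> L" "h \<noteq> 0" using gL N tr_nonzero by (auto simp: h_def)
  have oh: "ord P h = 0" if P: "on_curve E P" for P
  proof -
    have eq: "ec_mult E m (P \<boxplus> N i) = U \<longleftrightarrow> ec_mult E m P = ec_mult E i T \<boxplus> U" if "on_curve E U" for i U
    proof -
      have T1: "on_curve E T" using tors_on_curve[OF T] .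
      have "ec_mult E m (ec_mult E i T') = ec_mult E i T"
        using T' by (metis ec_mult_mult mult.commute)
      then have "ec_mult E m (P \<boxplus> N i) = ec_mult E m P \<boxplus> neg (ec_mult E i T)"
        using P T' by (simp add: N_def ec_mult_distrib ec_mult_neg)
      then show ?thesis
        using add_neg_cancel[of "ec_mult E m P" "ec_mult E i T"] add_neg_cancel[of U "ec_mult E i T"] P T1 that
          pt_add_commute[of U "ec_mult E i T"] by auto
    qed
    have T1: "on_curve E T" using tors_on_curve[OF T] .
    have "ord P h = (\<Sum>i<m. ord (P \<boxplus> N i) g)"
      unfolding h_def using gL N tr_nonzero P by (subst ord_prod[OF P]) (auto simp: ord_tr)
    also have "\<dots> = (\<Sum>i<m. of_bool (ec_mult E m P = ec_mult E (Suc i) T) - of_bool (ec_mult E m P = ec_mult E i T))"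
      using g P N eq[OF T1] eq[of Infinity] pt_add_commute[OF T1] T1 unfolding wfun_def
      by (intro sum.cong refl) (simp add: ec_mult_Suc)
    also have "\<dots> = of_bool (ec_mult E m P = ec_mult E m T) - of_bool (ec_mult E m P = ec_mult E 0 T)"
      by (rule sum_lessThan_telescope)
    finally show ?thesis using tors_mult[OF T] by simp
  qed
  obtain c where c: "h = kc c * 1"
    by (rule same_divisor_const[OF h, of 1]) (use oh ord_unit[OF _ unit_1] in auto)
  have "tr (N 1) h = h" unfolding c using N by simp
  moreover have "tr (N 1) h = (\<Prod>i<m. tr (N (Suc i)) g)"
  proof -
    have "N 1 \<boxplus> N i = N (Suc i)" for i
    proof -
      have "N 1 \<boxplus> N i \<boxplus> ec_mult E (Suc i) T' = Infinity"
        using T' by (simp add: N_def ec_mult_Suc pt_add_assoc pt_add_left_commute[of "neg (ec_mult E i T')" T'])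
          (simp add: neg_add flip: pt_add_assoc)
      then show ?thesis using add_eq_Infinity_iff[of "N 1 \<boxplus> N i" "ec_mult E (Suc i) T'"] N T' by (simp add: N_def)
    qed
    then show ?thesis unfolding h_def using N gL by (subst tr_prod) (auto simp: tr_tr)
  qed
  ultimately have "(\<Prod>i<m. tr (N (Suc i)) g) = (\<Prod>i<m. tr (N i) g)" by (simp add: h_def)
  then have "(\<Prod>i<m. tr (N i) g) * tr (N m) g = (\<Prod>i<m. tr (N i) g) * tr (N 0) g"
    using prod.lessThan_Suc_shift[of "\<lambda>i. tr (N i) g" m] by (simp add: mult.commute)
  then have "tr (N m) g = tr (N 0) g" using h by (simp add: h_def)
  then have "tr (neg T) g = kc 1 * g" using T' tr_Infinity[OF gL(1)] by (simp add: N_def)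
  then have "pair (neg T) T = 1" by (rule pairI[OF tors_neg[OF T] g])
  then have "pair (T \<boxplus> neg T) T = pair T T" using pair_add_left[OF T tors_neg[OF T] T] by simp
  then show ?thesis using pt_add_neg pair_Infinity_left[OF T] by simp
qed

text \<open>Otherwise a Weil function for \<open>T\<close> would be invariant under \<open>H\<close>
  with simple poles exactly on \<open>H\<close>.\<close>

lemma pair_nondegenerate:
  assumes T: "T \<in> H" and "\<And>S. S \<in> H \<Longrightarrow> pair S T = 1"
  shows "T = Infinity"
proof (rule ccontr)
  assume ne: "T \<noteq> Infinity"
  obtain g where g: "wfun T g" using wfun_exists[OF T] by blast
  show False
  proof (rule no_invariant_simple_pole[of H g])
    show "tr S g = g" if "S \<in> H" for S using pair(1)[OF that g] assms(2)[OF that] by simp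
    show "ord P g = -1" if "P \<in> H" for P
      using g tors_on_curve[OF that] tors_mult[OF that] ne unfolding wfun_def by simp
    show "reg P g" if "on_curve E P" "P \<notin> H" for P
      using g that reg_iff[OF that(1), of g] unfolding wfun_def tors_def by simp
  qed (use finite_tors tors_on_curve tors_Infinity tors_add tors_neg g in \<open>auto simp: wfun_def\<close>)
qed

text \<open>Primitivity of the root of unity: n P2 pairs trivially with both basis points, so it is
  O by nondegeneracy.\<close>

lemma pair_P1_P2_power:
  assumes "pair P1 P2 ^ n = 1" shows "m dvd n"
proof -
  have "ec_mult E n P2 = Infinity"
  proof (rule pair_nondegenerate)
    show "ec_mult E n P2 \<in> H" using tors_ec_mult tors_P2 by blast
    fix S assume "S \<in> H"
    then obtain a b where S: "S = ec_mult E a P1 \<boxplus> ec_mult E b P2"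
      using generate tors_on_curve tors_mult by blast
    have "(pair P1 P2 ^ a) ^ n = (pair P1 P2 ^ n) ^ a" by (simp flip: power_mult add: mult.commute)
    then show "pair S (ec_mult E n P2) = 1"
      unfolding S using assms tors_P1 tors_P2 tors_ec_mult
      by (simp add: pair_add_left pair_mult_left pair_mult_right pair_self)
  qed
  then show ?thesis using independent[of 0 n] by simp
qed

text \<open>Pairing with P1 kills the P1-component and reads off the P2-coefficient modulo m;
  applied later to a conjugate of P2.\<close>

lemma pair_eq_imp_cong:
  assumes "pair P1 (ec_mult E c P1 \<boxplus> ec_mult E d P2) = pair P1 P2"
  shows "d mod m = 1 mod m"
proof -
  have nz: "pair P1 P2 \<noteq> 0" using pair(2) tors_P1 wfun_exists[OF tors_P2] by blast
  have "pair P1 P2 ^ d = pair P1 P2"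
    using assms tors_P1 tors_P2 tors_ec_mult by (simp add: pair_add_right pair_mult_right pair_self)
  \<comment> \<open>The exponent m - 1 stands in for -1, turning the congruence into a divisibility
    of natural numbers.\<close>
  then have "pair P1 P2 ^ (d + (m - 1)) = pair P1 P2 ^ m" using m by (cases m) (simp_all add: power_add)
  also have "\<dots> = pair (ec_mult E m P1) P2" using pair_mult_left tors_P1 tors_P2 by simp
  also have "\<dots> = 1" using P1 pair_Infinity_left tors_P2 by simp
  finally have "m dvd d + (m - 1)" by (rule pair_P1_P2_power)
  then have "m dvd (m - 1) + d" by (simp add: add.commute)
  moreover have "m dvd (m - 1) + 1" using m by simp
  ultimately show ?thesis by (rule nat_mod_eqI)
qed

end

section \<open>Comparison with rational functions given as pairs\<close>

context ec
begin

definition fr :: "'a ratfun \<Rightarrow> 'a ff" where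
  "fr f = ev (fst f) / ev (snd f)"

lemma is_ratfun_iff: "is_ratfun E f \<longleftrightarrow> ev (snd f) \<noteq> 0"
  by (simp add: is_ratfun_def ev_eq_0_iff)

lemma ratfun_eq_iff: "is_ratfun E f \<Longrightarrow> is_ratfun E g \<Longrightarrow> ratfun_eq E f g \<longleftrightarrow> fr f = fr g"
  by (simp add: is_ratfun_iff ratfun_eq_def fr_def frac_eq_eq flip: ev_eq_0_iff)

lemma fr_L [simp]: "is_ratfun E f \<Longrightarrow> fr f \<in> L"
  by (simp add: fr_def)

lemma fr_surj: "f \<in> L \<Longrightarrow> \<exists>r. is_ratfun E r \<and> fr r = f"
  unfolding L_def is_ratfun_iff fr_def by force

lemma fr_mult: "fr (ratfun_mult f g) = fr f * fr g"
  and is_ratfun_mult: "is_ratfun E f \<Longrightarrow> is_ratfun E g \<Longrightarrow> is_ratfun E (ratfun_mult f g)"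
  by (simp_all add: fr_def ratfun_mult_def is_ratfun_iff)

lemma fr_power: "fr (ratfun_power f n) = fr f ^ n"
  and is_ratfun_power: "is_ratfun E f \<Longrightarrow> is_ratfun E (ratfun_power f n)"
  by (simp_all add: fr_def ratfun_power_def is_ratfun_iff power_divide)

lemma has_value_iff:
  assumes P: "on_curve E P" and f: "is_ratfun E f"
  shows "has_value E f P v \<longleftrightarrow> val P (fr f) v"
proof (cases P)
  case (Affine x y)
  have r: "is_ratfun E (a, b)" if "eval2 b x y \<noteq> 0" for a b
    using that chart.spec[OF chart_affine[OF P[unfolded Affine]]] by (auto simp: is_ratfun_iff)
  have e: "ratfun_eq E f (a, b) \<longleftrightarrow> fr f = ev a / ev b" if "eval2 b x y \<noteq> 0" for a b
    using ratfun_eq_iff[OF f r[OF that]] by (simp add: fr_def)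
  show ?thesis unfolding Affine has_value.simps val.simps lval_def using r e by blast
next
  case Infinity
  show ?thesis unfolding Infinity
  proof
    assume "has_value E f Infinity v"
    then obtain a b N where *: "is_ratfun E (a, b)" "ratfun_eq E f (a, b)" "total_degree_le a N" "total_degree_le b N"
      "Polynomial.coeff (Polynomial.coeff b N) 0 \<noteq> 0"
      "v = Polynomial.coeff (Polynomial.coeff a N) 0 / Polynomial.coeff (Polynomial.coeff b N) 0" by auto
    obtain a' where a': "ev a = gY ^ N * ev2 a' (gX / gY) (1 / gY)"
      "eval2 a' 0 0 = Polynomial.coeff (Polynomial.coeff a N) 0"
      using to_infinity_chart[OF *(3)] gY_nonzero by metis
    obtain b' where b': "ev b = gY ^ N * ev2 b' (gX / gY) (1 / gY)"
      "eval2 b' 0 0 = Polynomial.coeff (Polynomial.coeff b N) 0"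
      using to_infinity_chart[OF *(4)] gY_nonzero by metis
    have "fr f = ev a / ev b" using ratfun_eq_iff[OF f *(1)] *(2) by (simp add: fr_def)
    also have "\<dots> = ev2 a' (gX / gY) (1 / gY) / ev2 b' (gX / gY) (1 / gY)"
      using a'(1) b'(1) gY_nonzero by simp
    finally show "val Infinity (fr f) v" unfolding val.simps lval_def
      using a'(2) b'(2) *(5,6) by metis
  next
    assume "val Infinity (fr f) v"
    then obtain a b where *: "eval2 b 0 0 \<noteq> 0" "fr f = ev2 a (gX / gY) (1 / gY) / ev2 b (gX / gY) (1 / gY)"
      "v = eval2 a 0 0 / eval2 b 0 0" unfolding val.simps lval_def by blast
    obtain N1 where N1: "\<And>N. N \<ge> N1 \<Longrightarrow> \<exists>a'. total_degree_le a' N \<and>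
       (\<forall>x y. y \<noteq> 0 \<longrightarrow> ev2 a' x y = y ^ N * ev2 a (x / y) (1 / y)) \<and>
       Polynomial.coeff (Polynomial.coeff a' N) 0 = eval2 a 0 0" using from_infinity_chart[of a] by blast
    obtain N2 where N2: "\<And>N. N \<ge> N2 \<Longrightarrow> \<exists>b'. total_degree_le b' N \<and>
       (\<forall>x y. y \<noteq> 0 \<longrightarrow> ev2 b' x y = y ^ N * ev2 b (x / y) (1 / y)) \<and>
       Polynomial.coeff (Polynomial.coeff b' N) 0 = eval2 b 0 0" using from_infinity_chart[of b] by blast
    \<comment> \<open>Numerator and denominator must become forms of one common degree.\<close>
    define N where "N = max N1 N2"
    obtain a' where a': "total_degree_le a' N" "ev a' = gY ^ N * ev2 a (gX / gY) (1 / gY)"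
      "Polynomial.coeff (Polynomial.coeff a' N) 0 = eval2 a 0 0"
      using N1[of N] gY_nonzero by (auto simp: N_def)
    obtain b' where b': "total_degree_le b' N" "ev b' = gY ^ N * ev2 b (gX / gY) (1 / gY)"
      "Polynomial.coeff (Polynomial.coeff b' N) 0 = eval2 b 0 0"
      using N2[of N] gY_nonzero by (auto simp: N_def)
    have "ev2 b (gX / gY) (1 / gY) \<noteq> 0" using chart.spec[OF chart_infinity] *(1) by blast
    then have r: "is_ratfun E (a', b')" using b'(2) gY_nonzero by (simp add: is_ratfun_iff)
    have "fr f = fr (a', b')" using a'(2) b'(2) *(2) gY_nonzero by (simp add: fr_def)
    then have "ratfun_eq E f (a', b')" using ratfun_eq_iff[OF f r] by blast
    then show "has_value E f Infinity v" unfolding has_value.simps using r a' b' * by metis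
  qed
qed

lemma uniformizer_iff:
  assumes P: "on_curve E P"
  shows "uniformizer E P t \<longleftrightarrow> is_ratfun E t \<and> unif P (fr t)"
proof (cases "is_ratfun E t")
  case t: True
  have "(\<forall>f. is_ratfun E f \<and> has_value E f P 0 \<longrightarrow>
        (\<exists>g v. is_ratfun E g \<and> has_value E g P v \<and> ratfun_eq E f (ratfun_mult t g))) \<longleftrightarrow>
      (\<forall>f. val P f 0 \<longrightarrow> (\<exists>g. reg P g \<and> f = fr t * g))"
  proof (intro iffI allI impI)
    fix f assume *: "\<forall>f. is_ratfun E f \<and> has_value E f P 0 \<longrightarrow>
        (\<exists>g v. is_ratfun E g \<and> has_value E g P v \<and> ratfun_eq E f (ratfun_mult t g))" and f: "val P f 0"
    obtain r where r: "is_ratfun E r" "fr r = f" using fr_surj[OF val_L[OF P f]] by blast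
    then obtain g v where g: "is_ratfun E g" "has_value E g P v" "ratfun_eq E r (ratfun_mult t g)"
      using * f has_value_iff[OF P] by blast
    then show "\<exists>g. reg P g \<and> f = fr t * g"
      using r has_value_iff[OF P g(1)] ratfun_eq_iff[OF r(1) is_ratfun_mult[OF t g(1)]] fr_mult unfolding reg_def by metis
  next
    fix f assume *: "\<forall>f. val P f 0 \<longrightarrow> (\<exists>g. reg P g \<and> f = fr t * g)" and f: "is_ratfun E f \<and> has_value E f P 0"
    then obtain g v where g: "val P g v" "fr f = fr t * g" using has_value_iff[OF P] unfolding reg_def by blast
    obtain r where r: "is_ratfun E r" "fr r = g" using fr_surj[OF val_L[OF P g(1)]] by blast
    then show "\<exists>g v. is_ratfun E g \<and> has_value E g P v \<and> ratfun_eq E f (ratfun_mult t g)"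
      using f g has_value_iff[OF P] ratfun_eq_iff[OF _ is_ratfun_mult[OF t r(1)]] fr_mult by metis
  qed
  then show ?thesis unfolding uniformizer_def unif_def using t has_value_iff[OF P t] by blast
qed (simp add: uniformizer_def)

lemma has_order_iff:
  assumes P: "on_curve E P" and f: "is_ratfun E f"
  shows "has_order E f P n \<longleftrightarrow> fr f \<noteq> 0 \<and> ord P (fr f) = n"
proof
  assume "has_order E f P n"
  then obtain t u v k l where *: "uniformizer E P t" "is_ratfun E u" "has_value E u P v" "v \<noteq> 0"
      "n = int l - int k" "ratfun_eq E (ratfun_mult f (ratfun_power t k)) (ratfun_mult u (ratfun_power t l))"
    unfolding has_order_def by blast
  have t: "is_ratfun E t" "unif P (fr t)" using *(1) uniformizer_iff[OF P] by blast+
  have u: "unit_at P (fr u)" using * has_value_iff[OF P] unfolding unit_at_def by blast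
  have "fr f * fr t ^ k = fr u * fr t ^ l"
    using *(6) ratfun_eq_iff is_ratfun_mult is_ratfun_power f *(2) t(1) by (simp add: fr_mult fr_power)
  then have eq: "fr f = fr t powi n * fr u"
    unfolding *(5) using unif_nonzero[OF P t(2)] by (simp add: power_int_diff field_simps)
  then have "ord P (fr f) = n" using u by (intro ord_eqI[OF P t(2)]) (auto simp: ordt_def)
  moreover have "fr f \<noteq> 0" using eq unif_nonzero[OF P t(2)] unit_nonzero[OF P u] by simp
  ultimately show "fr f \<noteq> 0 \<and> ord P (fr f) = n" by simp
next
  assume *: "fr f \<noteq> 0 \<and> ord P (fr f) = n"
  obtain t where t: "unif P t" using unif_exists[OF P] by blast
  obtain r where r: "is_ratfun E r" "fr r = t" using fr_surj[OF t_L[OF P t]] by blast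
  obtain g where g: "unit_at P g" "fr f = t powi n * g"
    using ordt_ord[OF P t fr_L[OF f]] * unfolding ordt_def by blast
  obtain u where u: "is_ratfun E u" "fr u = g" using fr_surj[OF unit_L[OF P g(1)]] by blast
  have "fr f * t ^ nat (- n) = g * t ^ nat n"
    using g(2) unif_nonzero[OF P t] by (auto simp: power_int_def field_simps)
  then have "ratfun_eq E (ratfun_mult f (ratfun_power r (nat (- n)))) (ratfun_mult u (ratfun_power r (nat n)))"
    using ratfun_eq_iff is_ratfun_mult is_ratfun_power f r u by (simp add: fr_mult fr_power)
  moreover have "n = int (nat n) - int (nat (- n))" by simp
  moreover obtain v where "v \<noteq> 0" "has_value E u P v"
    using g(1) u has_value_iff[OF P u(1)] unfolding unit_at_def by blast
  ultimately show "has_order E f P n"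
    unfolding has_order_def using uniformizer_iff[OF P, of r] r t u by blast
qed

end

context ec_basis
begin

lemma weil_function_iff: "weil_function E m T g \<longleftrightarrow> is_ratfun E g \<and> wfun T (fr g)"
proof -
  have "on_curve E Infinity" by simp
  then show ?thesis
    unfolding weil_function_def has_divisor_def wfun_def using has_order_iff[of _ g] fr_L[of g] by blast
qed

lemma weil_pairing_unique:
  assumes S: "S \<in> H" and *: "weil_function E m T g" "on_curve E Q" "has_value E g Q v" "v \<noteq> 0"
    "has_value E g (ec_add E Q S) w"
  shows "w / v = pair S T"
proof -
  have g: "is_ratfun E g" "wfun T (fr g)" using *(1) weil_function_iff by blast+
  have Q: "on_curve E (Q \<boxplus> S)" using *(2) tors_on_curve[OF S] by simp
  have v: "val Q (fr g) v" "val (Q \<boxplus> S) (fr g) w" using * has_value_iff g(1) Q by blast+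
  have "val Q (tr S (fr g)) w" using val_tr[OF tors_on_curve[OF S] *(2) v(2)] .
  moreover have "val Q (kc (pair S T) * fr g) (pair S T * v)" by (intro val_mult val_const v *(2))
  ultimately have "w = pair S T * v" using pair(1)[OF S g(2)] val_unique[OF *(2)] by metis
  then show ?thesis using *(4) by simp
qed

lemma weil_pairing_witness:
  assumes S: "S \<in> H" and T: "T \<in> H"
  shows "\<exists>g Q v w. weil_function E m T g \<and> on_curve E Q \<and>
        has_value E g Q v \<and> v \<noteq> 0 \<and> has_value E g (ec_add E Q S) w \<and> w \<noteq> 0 \<and> pair S T = w / v"
proof -
  obtain f where f: "wfun T f" using wfun_exists[OF T] by blast
  then obtain g where g: "is_ratfun E g" "fr g = f" using fr_surj unfolding wfun_def by blast
  have gw: "weil_function E m T g" using weil_function_iff g f by blast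
  \<comment> \<open>A point away from zeros and poles of \<open>g\<close>. Adding \<open>S\<close>
    does not change m Q, so Q + S avoids them as well.\<close>
  have "\<exists>Q. on_curve E Q \<and> ec_mult E m Q \<noteq> T \<and> ec_mult E m Q \<noteq> Infinity"
  proof (rule ccontr)
    assume "\<not> ?thesis"
    then have "{Q. on_curve E Q} \<subseteq> {Q. on_curve E Q \<and> ec_mult E m Q = T} \<union> {Q. on_curve E Q \<and> ec_mult E m Q = Infinity}"
      by blast
    moreover have "finite ({Q. on_curve E Q \<and> ec_mult E m Q = T} \<union> {Q. on_curve E Q \<and> ec_mult E m Q = Infinity})"
      by (intro finite_UnI finite_fibre finite_tors)
    ultimately show False using infinite_points finite_subset by blast
  qed
  then obtain Q where Q: "on_curve E Q" "ec_mult E m Q \<noteq> T" "ec_mult E m Q \<noteq> Infinity" by blast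
  have unit: "\<exists>v. has_value E g R v \<and> v \<noteq> 0" if R: "on_curve E R" "ec_mult E m R = ec_mult E m Q" for R
  proof -
    have "ord R f = 0" using f R Q unfolding wfun_def by simp
    then have "unit_at R f" using unit_iff[OF R(1), of f] f unfolding wfun_def by simp
    then show ?thesis using has_value_iff[OF R(1) g(1)] g(2) unfolding unit_at_def by blast
  qed
  obtain v where v: "has_value E g Q v" "v \<noteq> 0" using unit[OF Q(1)] by blast
  obtain w where w: "has_value E g (Q \<boxplus> S) w" "w \<noteq> 0"
    using unit[of "Q \<boxplus> S"] Q tors_on_curve[OF S] tors_mult[OF S] by (auto simp: ec_mult_distrib)
  show ?thesis using weil_pairing_unique[OF S gw Q(1) v w(1)] gw Q(1) v w by metis
qed

lemma weil_pairing_eq: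
  assumes "S \<in> H" "T \<in> H"
  shows "weil_pairing E m S T = pair S T"
  unfolding weil_pairing_def
proof (rule the_equality)
  show "\<exists>g Q v w. weil_function E m T g \<and> on_curve E Q \<and>
        has_value E g Q v \<and> v \<noteq> 0 \<and> has_value E g (ec_add E Q S) w \<and> w \<noteq> 0 \<and> pair S T = w / v"
    by (rule weil_pairing_witness[OF assms])
qed (use weil_pairing_unique[OF assms(1)] in blast)

end

section \<open>Automorphisms of the constant field\<close>

text \<open>The inverse is carried along so that one implication, applied to both maps, yields an
  equivalence.\<close>

locale field_auto =
  fixes \<sigma> \<tau> :: "'a::field \<Rightarrow> 'a"
  assumes rhom_\<sigma>: "rhom \<sigma>" and rhom_\<tau>: "rhom \<tau>"
    and \<sigma>_\<tau>: "\<sigma> (\<tau> x) = x" and \<tau>_\<sigma>: "\<tau> (\<sigma> x) = x"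

lemma field_auto_swap: "field_auto \<sigma> \<tau> \<Longrightarrow> field_auto \<tau> \<sigma>"
  unfolding field_auto_def by simp

definition sp :: "('a::field \<Rightarrow> 'a) \<Rightarrow> 'a poly poly \<Rightarrow> 'a poly poly" where
  "sp \<sigma> a = map_poly (map_poly \<sigma>) a"

text \<open>The action is on representing pairs: \<open>\<sigma>\<close> comes with no extension to
  \<open>ff\<close>, while \<open>has_value\<close> and \<open>has_order\<close> are formulated for
  pairs.\<close>

definition sr :: "('a::field \<Rightarrow> 'a) \<Rightarrow> 'a ratfun \<Rightarrow> 'a ratfun" where
  "sr \<sigma> f = (sp \<sigma> (fst f), sp \<sigma> (snd f))"

context field_auto
begin

sublocale h: rhom \<sigma> by (rule rhom_\<sigma>)
sublocale h1: rhom "map_poly \<sigma>" by (rule h.rhom_map_poly)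
sublocale h2: rhom "sp \<sigma>"
  unfolding sp_def by (rule h1.rhom_map_poly)

lemmas \<sigma>_field = rhom_divide[OF rhom_\<sigma>]

lemma coeff_sp: "Polynomial.coeff (Polynomial.coeff (sp \<sigma> a) j) i = \<sigma> (Polynomial.coeff (Polynomial.coeff a j) i)"
  by (simp add: sp_def h1.coeff_map h.coeff_map)

lemma sp_inverse: "sp \<tau> (sp \<sigma> a) = a"
proof -
  interpret swap: field_auto \<tau> \<sigma> using field_auto_axioms by (rule field_auto_swap)
  show ?thesis by (intro poly_eqI) (simp add: swap.coeff_sp coeff_sp \<tau>_\<sigma>)
qed

lemma sr_inverse: "sr \<tau> (sr \<sigma> f) = f"
  by (simp add: sr_def sp_inverse)

lemma eval2_sp: "eval2 (sp \<sigma> a) (\<sigma> x) (\<sigma> y) = \<sigma> (eval2 a x y)"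
proof (induction a rule: poly_poly_induct)
  case (const c)
  show ?case by (simp add: sp_def h1.map_poly_pCons h.map_poly_pCons h.zero h.simps)
next
  case varX
  show ?case by (simp add: sp_def h1.map_poly_pCons h.map_poly_pCons h.simps)
next
  case varY
  show ?case by (simp add: sp_def h1.map_poly_pCons h1.zero h1.one h.map_poly_pCons h.simps)
next
  case (add a b)
  then show ?case by (simp add: h2.add h.add)
next
  case (mult a b)
  then show ?case by (simp add: h2.mult h.mult)
qed

lemma total_degree_le_sp: "total_degree_le a N \<Longrightarrow> total_degree_le (sp \<sigma> a) N"
  unfolding total_degree_le_def coeff_sp using h.zero by metis

lemma sr_mult: "sr \<sigma> (ratfun_mult f g) = ratfun_mult (sr \<sigma> f) (sr \<sigma> g)"
  and sr_power: "sr \<sigma> (ratfun_power f n) = ratfun_power (sr \<sigma> f) n"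
  by (simp_all add: sr_def ratfun_mult_def ratfun_power_def h2.mult h2.power)

lemma map_point_inverse: "map_point \<tau> (map_point \<sigma> P) = P"
  by (cases P) (simp_all add: \<tau>_\<sigma>)

end

locale curve_auto = field_auto \<sigma> \<tau> for \<sigma> \<tau> :: "'a::field \<Rightarrow> 'a" +
  fixes E :: "'a weierstrass"
  assumes E: "map_weierstrass \<sigma> E = E"
begin

lemma E_coeffs: "\<sigma> (wa1 E) = wa1 E" "\<sigma> (wa2 E) = wa2 E" "\<sigma> (wa3 E) = wa3 E" "\<sigma> (wa4 E) = wa4 E" "\<sigma> (wa6 E) = wa6 E"
  using E by (metis weierstrass.map_sel)+

lemma swap: "curve_auto \<tau> \<sigma> E"
proof -
  have "map_weierstrass \<tau> (map_weierstrass \<sigma> E) = map_weierstrass id E"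
    by (simp add: weierstrass.map_comp comp_def \<tau>_\<sigma> id_def)
  then have "map_weierstrass \<tau> E = E" by (simp add: E weierstrass.map_id)
  then show ?thesis using field_auto_swap[OF field_auto_axioms] by (simp add: curve_auto_def curve_auto_axioms_def)
qed

lemma sp_weier_poly: "sp \<sigma> (weier_poly E) = weier_poly E"
  by (simp add: sp_def weier_poly_def h1.map_poly_pCons h.map_poly_pCons h1.uminus h1.one h.simps E_coeffs)

lemma weier_poly_dvd_sp: "weier_poly E dvd sp \<sigma> a \<longleftrightarrow> weier_poly E dvd a"
proof -
  have "weier_poly E dvd sp \<sigma> a" if d: "weier_poly E dvd a" and "curve_auto \<sigma> \<tau> E" for \<sigma> \<tau> a
  proof -
    interpret curve_auto \<sigma> \<tau> E by fact
    obtain q where "a = weier_poly E * q" using d by blast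
    then show ?thesis by (simp add: h2.mult sp_weier_poly)
  qed
  from this[OF _ curve_auto_axioms] this[OF _ swap] show ?thesis using sp_inverse by metis
qed

lemma is_ratfun_sr: "is_ratfun E (sr \<sigma> f) \<longleftrightarrow> is_ratfun E f"
  by (simp add: is_ratfun_def sr_def weier_poly_dvd_sp)

lemma ratfun_eq_sr: "ratfun_eq E (sr \<sigma> f) (sr \<sigma> g) \<longleftrightarrow> ratfun_eq E f g"
  by (simp add: ratfun_eq_def sr_def weier_poly_dvd_sp flip: h2.mult h2.diff)

lemma has_value_sr:
  assumes "has_value E f P v" shows "has_value E (sr \<sigma> f) (map_point \<sigma> P) (\<sigma> v)"
proof (cases P)
  case (Affine x y)
  then obtain a b where *: "is_ratfun E (a, b)" "ratfun_eq E f (a, b)" "eval2 b x y \<noteq> 0" "v = eval2 a x y / eval2 b x y"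
    using assms by auto
  then show ?thesis unfolding Affine point.map has_value.simps
    using is_ratfun_sr[of "(a, b)"] ratfun_eq_sr[of f "(a, b)"]
    by (intro exI[of _ "sp \<sigma> a"] exI[of _ "sp \<sigma> b"]) (simp add: sr_def eval2_sp \<sigma>_field)
next
  case Infinity
  then obtain a b N where *: "is_ratfun E (a, b)" "ratfun_eq E f (a, b)" "total_degree_le a N" "total_degree_le b N"
      "Polynomial.coeff (Polynomial.coeff b N) 0 \<noteq> 0"
      "v = Polynomial.coeff (Polynomial.coeff a N) 0 / Polynomial.coeff (Polynomial.coeff b N) 0"
    using assms by auto
  then show ?thesis unfolding Infinity point.map has_value.simps
    using is_ratfun_sr[of "(a, b)"] ratfun_eq_sr[of f "(a, b)"]
    by (intro exI[of _ "sp \<sigma> a"] exI[of _ "sp \<sigma> b"] exI[of _ N])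
      (simp add: sr_def total_degree_le_sp coeff_sp \<sigma>_field)
qed

lemma uniformizer_sr:
  assumes t: "uniformizer E P t" shows "uniformizer E (map_point \<sigma> P) (sr \<sigma> t)"
  unfolding uniformizer_def
proof (intro conjI allI impI)
  interpret s: curve_auto \<tau> \<sigma> E by (rule swap)
  show "is_ratfun E (sr \<sigma> t)" using t is_ratfun_sr unfolding uniformizer_def by blast
  show "has_value E (sr \<sigma> t) (map_point \<sigma> P) 0"
    using has_value_sr[of t P 0] t h.zero unfolding uniformizer_def by simp
  fix f assume f: "is_ratfun E f \<and> has_value E f (map_point \<sigma> P) 0"
  then have "is_ratfun E (sr \<tau> f) \<and> has_value E (sr \<tau> f) P 0"
    using s.is_ratfun_sr s.has_value_sr[of f "map_point \<sigma> P" 0] s.h.zero map_point_inverse by simp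
  then obtain g v where g: "is_ratfun E g" "has_value E g P v" "ratfun_eq E (sr \<tau> f) (ratfun_mult t g)"
    using t unfolding uniformizer_def by blast
  have "ratfun_eq E (sr \<sigma> (sr \<tau> f)) (sr \<sigma> (ratfun_mult t g))" using g(3) ratfun_eq_sr by blast
  then have "ratfun_eq E f (ratfun_mult (sr \<sigma> t) (sr \<sigma> g))" by (simp add: s.sr_inverse sr_mult)
  then show "\<exists>g v. is_ratfun E g \<and> has_value E g (map_point \<sigma> P) v \<and> ratfun_eq E f (ratfun_mult (sr \<sigma> t) g)"
    using is_ratfun_sr g(1) has_value_sr[OF g(2)] by blast
qed

lemma has_order_sr:
  assumes "has_order E f P n" shows "has_order E (sr \<sigma> f) (map_point \<sigma> P) n"
proof -
  obtain t u v k l where *: "uniformizer E P t" "is_ratfun E u" "has_value E u P v" "v \<noteq> 0"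
      "n = int l - int k" "ratfun_eq E (ratfun_mult f (ratfun_power t k)) (ratfun_mult u (ratfun_power t l))"
    using assms unfolding has_order_def by blast
  have "ratfun_eq E (ratfun_mult (sr \<sigma> f) (ratfun_power (sr \<sigma> t) k)) (ratfun_mult (sr \<sigma> u) (ratfun_power (sr \<sigma> t) l))"
    using *(6) ratfun_eq_sr by (simp flip: sr_mult sr_power)
  then show ?thesis unfolding has_order_def
    using uniformizer_sr[OF *(1)] is_ratfun_sr *(2) has_value_sr[OF *(3)] *(4,5) \<sigma>_field(3) by blast
qed

lemma on_curve_map: "on_curve E (map_point \<sigma> P) \<longleftrightarrow> on_curve E P"
proof (cases P)
  case (Affine x y)
  have "on_curve E (map_point \<sigma> P) \<longleftrightarrow> \<sigma> (y ^ 2 + wa1 E * x * y + wa3 E * y) = \<sigma> (x ^ 3 + wa2 E * x ^ 2 + wa4 E * x + wa6 E)"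
    by (simp add: Affine h.simps E_coeffs)
  then show ?thesis by (simp add: Affine \<sigma>_field)
qed simp

lemma ec_add_map: "ec_add E (map_point \<sigma> P) (map_point \<sigma> Q) = map_point \<sigma> (ec_add E P Q)"
proof (cases P)
  case P: (Affine x1 y1)
  show ?thesis
  proof (cases Q)
    case Q: (Affine x2 y2)
    have c: "\<sigma> y1 + \<sigma> y2 + wa1 E * \<sigma> x2 + wa3 E = 0 \<longleftrightarrow> y1 + y2 + wa1 E * x2 + wa3 E = 0"
      using \<sigma>_field(3)[of "y1 + y2 + wa1 E * x2 + wa3 E"] by (simp add: h.simps E_coeffs)
    show ?thesis
      by (simp add: P Q c \<sigma>_field Let_def h.simps E_coeffs)
  qed (simp add: P)
qed simp

lemma ec_mult_map: "ec_mult E n (map_point \<sigma> P) = map_point \<sigma> (ec_mult E n P)"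
  by (induction n) (simp_all add: ec_mult_Suc ec_add_map)

lemma weil_function_sr:
  assumes "weil_function E m T g" shows "weil_function E m (map_point \<sigma> T) (sr \<sigma> g)"
  unfolding weil_function_def has_divisor_def
proof (intro conjI allI impI)
  interpret s: curve_auto \<tau> \<sigma> E by (rule swap)
  show "is_ratfun E (sr \<sigma> g)" using assms is_ratfun_sr unfolding weil_function_def has_divisor_def by blast
  fix P assume P: "on_curve E P"
  define Q where "Q = map_point \<tau> P"
  have PQ: "P = map_point \<sigma> Q" by (simp add: Q_def s.map_point_inverse)
  have inj: "map_point \<sigma> A = map_point \<sigma> B \<longleftrightarrow> A = B" for A B using map_point_inverse by metis
  have "has_order E g Q (of_bool (ec_mult E m Q = T) - of_bool (ec_mult E m Q = Infinity))"
    using assms P PQ on_curve_map unfolding weil_function_def has_divisor_def by blast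
  then have "has_order E (sr \<sigma> g) P (of_bool (ec_mult E m Q = T) - of_bool (ec_mult E m Q = Infinity))"
    unfolding PQ by (rule has_order_sr)
  moreover have "ec_mult E m P = map_point \<sigma> T \<longleftrightarrow> ec_mult E m Q = T"
    "ec_mult E m P = Infinity \<longleftrightarrow> ec_mult E m Q = Infinity"
    unfolding PQ ec_mult_map using inj inj[of _ Infinity] by simp_all
  ultimately show "has_order E (sr \<sigma> g) P (of_bool (ec_mult E m P = map_point \<sigma> T) - of_bool (ec_mult E m P = Infinity))"
    by simp
qed

end

text \<open>Galois equivariance: \<open>\<sigma>\<close> carries a Weil function for
  \<open>T\<close>, an evaluation point and the two values there to corresponding data for the image
  of \<open>T\<close>.\<close>

lemma (in ec_basis) weil_pairing_auto:
  assumes "curve_auto \<sigma> \<tau> E" and S: "S \<in> H" and T: "T \<in> H"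
  shows "weil_pairing E m (map_point \<sigma> S) (map_point \<sigma> T) = \<sigma> (weil_pairing E m S T)"
proof -
  interpret curve_auto \<sigma> \<tau> E by fact
  have HS: "map_point \<sigma> S \<in> H" "map_point \<sigma> T \<in> H"
    using S T by (simp_all add: tors_def on_curve_map ec_mult_map)
  obtain g Q v w where *: "weil_function E m T g" "on_curve E Q" "has_value E g Q v" "v \<noteq> 0"
      "has_value E g (ec_add E Q S) w" "w \<noteq> 0" "pair S T = w / v"
    using weil_pairing_witness[OF S T] by blast
  have "has_value E (sr \<sigma> g) (ec_add E (map_point \<sigma> Q) (map_point \<sigma> S)) (\<sigma> w)"
    unfolding ec_add_map by (rule has_value_sr[OF *(5)])
  then have "\<sigma> w / \<sigma> v = pair (map_point \<sigma> S) (map_point \<sigma> T)"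
    using weil_pairing_unique[OF HS(1) weil_function_sr[OF *(1)] _ has_value_sr[OF *(3)]] * on_curve_map \<sigma>_field(3) by blast
  then show ?thesis using weil_pairing_eq S T HS *(7) by (simp add: \<sigma>_field)
qed

section \<open>Extension of automorphisms\<close>

locale algebraic_over =
  fixes F :: "'b::alg_closed_field set"
  assumes F_0: "0 \<in> F" and F_1: "1 \<in> F" and F_add: "a \<in> F \<Longrightarrow> b \<in> F \<Longrightarrow> a + b \<in> F"
    and F_mult: "a \<in> F \<Longrightarrow> b \<in> F \<Longrightarrow> a * b \<in> F" and F_uminus: "a \<in> F \<Longrightarrow> - a \<in> F"
    and F_inverse: "a \<in> F \<Longrightarrow> inverse a \<in> F"
    and algebraic: "\<exists>h. h \<noteq> 0 \<and> (\<forall>i. Polynomial.coeff h i \<in> F) \<and> poly h x = 0"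
begin

lemma F_diff: "a \<in> F \<Longrightarrow> b \<in> F \<Longrightarrow> a - b \<in> F"
  using F_add[of a "- b"] F_uminus by simp

lemma F_divide: "a \<in> F \<Longrightarrow> b \<in> F \<Longrightarrow> a / b \<in> F"
  by (simp add: divide_inverse F_mult F_inverse)

lemma F_power: "a \<in> F \<Longrightarrow> a ^ n \<in> F"
  by (induction n) (simp_all add: F_1 F_mult)

lemma F_sum: "(\<And>i. i \<in> A \<Longrightarrow> f i \<in> F) \<Longrightarrow> sum f A \<in> F"
  by (induction A rule: infinite_finite_induct) (simp_all add: F_0 F_add)

abbreviation "over_F p \<equiv> (\<forall>i. Polynomial.coeff p i \<in> F)"

text \<open>
  A partial \<open>F\<close>-embedding is represented by its graph, a subfield of the product ring on which the
  first projection is injective.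
\<close>

definition graph :: "('b \<times> 'b) set \<Rightarrow> bool" where
  "graph G \<longleftrightarrow> (\<forall>a\<in>F. (a, a) \<in> G) \<and>
     (\<forall>a b c d. (a, b) \<in> G \<longrightarrow> (c, d) \<in> G \<longrightarrow> (a + c, b + d) \<in> G \<and> (a * c, b * d) \<in> G) \<and>
     (\<forall>a b. (a, b) \<in> G \<longrightarrow> (inverse a, inverse b) \<in> G) \<and>
     (\<forall>b. (0, b) \<in> G \<longrightarrow> b = 0)"

text \<open>The polynomial \<open>g\<close> is the image of \<open>f\<close> when the partial
  embedding \<open>G\<close> acts on coefficients.\<close>

definition cw :: "('b \<times> 'b) set \<Rightarrow> 'b poly \<Rightarrow> 'b poly \<Rightarrow> bool" where
  "cw G f g \<longleftrightarrow> (\<forall>i. (Polynomial.coeff f i, Polynomial.coeff g i) \<in> G)"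

context
  fixes G assumes G: "graph G"
begin

lemma G_F: "a \<in> F \<Longrightarrow> (a, a) \<in> G"
  and G_add: "(a, b) \<in> G \<Longrightarrow> (c, d) \<in> G \<Longrightarrow> (a + c, b + d) \<in> G"
  and G_mult: "(a, b) \<in> G \<Longrightarrow> (c, d) \<in> G \<Longrightarrow> (a * c, b * d) \<in> G"
  and G_inverse: "(a, b) \<in> G \<Longrightarrow> (inverse a, inverse b) \<in> G"
  and G_zero: "(0, b) \<in> G \<Longrightarrow> b = 0"
  using G unfolding graph_def by blast+

lemma G_diff: "(a, b) \<in> G \<Longrightarrow> (c, d) \<in> G \<Longrightarrow> (a - c, b - d) \<in> G"
  using G_add[of a b "- c" "- d"] G_mult[of "-1" "-1" c d] G_F[OF F_uminus[OF F_1]] by simp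

lemma G_divide: "(a, b) \<in> G \<Longrightarrow> (c, d) \<in> G \<Longrightarrow> (a / c, b / d) \<in> G"
  using G_mult[OF _ G_inverse] by (simp add: divide_inverse)

lemma G_sum: "(\<And>i. i \<in> A \<Longrightarrow> (f i, g i) \<in> G) \<Longrightarrow> (sum f A, sum g A) \<in> G"
  by (induction A rule: infinite_finite_induct) (simp_all add: G_F F_0 G_add)

lemma G_unique: "(a, b) \<in> G \<Longrightarrow> (a, c) \<in> G \<Longrightarrow> b = c"
  using G_zero[of "b - c"] G_diff[of a b a c] by simp

lemma G_nonzero: "(a, b) \<in> G \<Longrightarrow> a \<noteq> 0 \<Longrightarrow> b \<noteq> 0"
  using G_mult[OF _ G_inverse, of a b a b] G_unique[OF G_F[OF F_1], of "b * inverse b"] by auto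

lemma cw_add: "cw G f g \<Longrightarrow> cw G f' g' \<Longrightarrow> cw G (f + f') (g + g')"
  and cw_diff: "cw G f g \<Longrightarrow> cw G f' g' \<Longrightarrow> cw G (f - f') (g - g')"
  and cw_mult: "cw G f g \<Longrightarrow> cw G f' g' \<Longrightarrow> cw G (f * f') (g * g')"
  unfolding cw_def by (simp_all add: G_add G_diff Polynomial.coeff_mult G_sum G_mult)

lemma cw_monom: "(a, b) \<in> G \<Longrightarrow> cw G (Polynomial.monom a n) (Polynomial.monom b n)"
  by (simp add: cw_def G_F F_0)

lemma cw_F: "over_F h \<Longrightarrow> cw G h h"
  by (simp add: cw_def G_F)

lemma cw_degree:
  assumes "cw G f g" shows "Polynomial.degree f = Polynomial.degree g"
proof -
  have "Polynomial.coeff f i = 0 \<longleftrightarrow> Polynomial.coeff g i = 0" for i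
    using assms G_zero G_nonzero unfolding cw_def by metis
  then show ?thesis unfolding Polynomial.degree_def by simp
qed

text \<open>\<open>p\<close> is a minimal polynomial of \<open>x\<close> over the domain of
  \<open>G\<close> and \<open>q\<close> its image. Dividing \<open>f\<close> by \<open>p\<close> and
  \<open>g\<close> by \<open>q\<close> in parallel carries the relation f(x) = 0 over to g(y) =
  0.\<close>

lemma extend_zero:
  assumes pq: "cw G p q" "p \<noteq> 0" "poly p x = 0" "poly q y = 0"
    and min: "\<And>f g. cw G f g \<Longrightarrow> f \<noteq> 0 \<Longrightarrow> poly f x = 0 \<Longrightarrow> Polynomial.degree p \<le> Polynomial.degree f"
    and fg: "cw G f g" "poly f x = 0"
  shows "poly g y = 0"
  using fg
proof (induction "Polynomial.degree f" arbitrary: f g rule: less_induct)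
  case less
  have zero: "poly g y = 0" if "f = 0" "cw G f g" for f g
  proof -
    have "g = 0" using that G_zero by (intro poly_eqI) (simp add: cw_def)
    then show ?thesis by simp
  qed
  show ?case
  proof (cases "f = 0")
    case True
    then show ?thesis using zero less.prems by blast
  next
    case False
    define n k where "n = Polynomial.degree f" and "k = n - Polynomial.degree p"
    have nk: "n = k + Polynomial.degree p" using min[OF less.prems(1) False less.prems(2)] by (simp add: k_def n_def)
    define a b where "a = Polynomial.coeff f n / Polynomial.lead_coeff p" and "b = Polynomial.coeff g n / Polynomial.lead_coeff q"
    have dq: "Polynomial.degree q = Polynomial.degree p" using cw_degree[OF pq(1)] by simp
    have ab: "(a, b) \<in> G" unfolding a_def b_def dq
      using less.prems(1) pq(1) unfolding cw_def by (intro G_divide) blast+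
    define f' g' where "f' = f - Polynomial.monom a k * p" and "g' = g - Polynomial.monom b k * q"
    have fg': "cw G f' g'" unfolding f'_def g'_def by (intro cw_diff cw_mult cw_monom ab pq(1) less.prems(1))
    have f'0: "poly f' x = 0" using less.prems(2) pq(3) by (simp add: f'_def)
    have "poly g' y = 0"
    proof (cases "f' = 0")
      case True
      then show ?thesis using zero fg' by blast
    next
      case f'nz: False
      have mp: "Polynomial.coeff (Polynomial.monom a k * p) n = Polynomial.coeff f n"
        using pq(2) by (simp add: coeff_monom_mult nk a_def)
      have "Polynomial.degree (Polynomial.monom a k * p) \<le> n"
        using degree_mult_le[of "Polynomial.monom a k" p] degree_monom_le[of a k] nk by linarith
      then have "Polynomial.degree f' \<le> n" unfolding f'_def by (intro degree_diff_le) (simp_all add: n_def)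
      moreover have "Polynomial.coeff f' n = 0" using mp by (simp add: f'_def)
      ultimately have "Polynomial.degree f' < n"
        using f'nz by (metis leading_coeff_0_iff le_neq_implies_less)
      then show ?thesis using less.hyps fg' f'0 by (simp add: n_def)
    qed
    then show ?thesis using pq(4) by (simp add: g'_def)
  qed
qed

text \<open>The extension consists of the pairs of values f(x), g(y); \<open>extend_zero\<close>
  makes it single-valued. It contains inverses because the inverse of an algebraic element is a
  polynomial in it over \<open>F\<close>.\<close>

lemma graph_extend:
  assumes pq: "cw G p q" "p \<noteq> 0" "poly p x = 0" "poly q y = 0"
    and min: "\<And>f g. cw G f g \<Longrightarrow> f \<noteq> 0 \<Longrightarrow> poly f x = 0 \<Longrightarrow> Polynomial.degree p \<le> Polynomial.degree f"
  shows "\<exists>G'. graph G' \<and> G \<subseteq> G' \<and> (x, y) \<in> G'"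
proof -
  define G' where "G' = {(poly f x, poly g y) | f g. cw G f g}"
  have I: "cw G f g \<Longrightarrow> (poly f x, poly g y) \<in> G'" for f g by (auto simp: G'_def)
  have sub: "G \<subseteq> G'"
  proof
    fix c assume c: "c \<in> G"
    obtain a b where ab: "c = (a, b)" by (cases c)
    have "cw G [:a:] [:b:]" using c ab cw_monom[of a b 0] by (simp add: monom_0)
    then show "c \<in> G'" using I[of "[:a:]" "[:b:]"] ab by simp
  qed
  have zero: "b = 0" if "(0, b) \<in> G'" for b
    using that extend_zero[OF pq min] unfolding G'_def by auto
  have ring: "(a + c, b + d) \<in> G' \<and> (a * c, b * d) \<in> G'" if abcd: "(a, b) \<in> G'" "(c, d) \<in> G'" for a b c d
  proof -
    obtain f g f' g' where "cw G f g" "cw G f' g'" "a = poly f x" "b = poly g y" "c = poly f' x" "d = poly g' y"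
      using abcd unfolding G'_def by blast
    then show ?thesis using I[OF cw_add[of f g f' g']] I[OF cw_mult[of f g f' g']] by simp
  qed
  have F: "(a, a) \<in> G'" if "a \<in> F" for a using sub G_F[OF that] by blast
  have polyF: "(poly h a, poly h b) \<in> G'" if "over_F h" "(a, b) \<in> G'" for h a b
    using that(1)
  proof (induction h)
    case 0
    show ?case using F[OF F_0] by simp
  next
    case (pCons c h)
    have "c \<in> F" "over_F h" using pCons.prems by (auto, metis Polynomial.coeff_pCons_0, metis coeff_pCons_Suc)
    then show ?case using ring[of c c "a * poly h a" "b * poly h b"] ring[OF that(2)] pCons.IH F by simp
  qed
  have inv: "(inverse a, inverse b) \<in> G'" if ab: "(a, b) \<in> G'" for a b
  proof (cases "a = 0")
    case True
    then have "b = 0" using zero ab by blast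
    then show ?thesis using True F[OF F_0] by simp
  next
    case a: False
    \<comment> \<open>Removing factors of the variable from an annihilating polynomial leaves a
      nonzero constant term, and the inverse of \<open>a\<close> is then - h(a) / c.\<close>
    have "\<exists>c h. c \<noteq> 0 \<and> over_F (pCons c h) \<and> poly (pCons c h) a = 0"
    proof -
      obtain h where h: "h \<noteq> 0" "over_F h" "poly h a = 0" using algebraic by blast
      then show ?thesis
      proof (induction h)
        case (pCons c h)
        show ?case
        proof (cases "c = 0")
          case True
          have "over_F h" using pCons.prems(2) by (metis coeff_pCons_Suc)
          moreover have "h \<noteq> 0" "poly h a = 0" using pCons.prems True a by auto
          ultimately show ?thesis using pCons.IH by blast
        qed (use pCons.prems in blast)
      qed simp
    qed
    then obtain c h where ch: "c \<noteq> 0" "over_F (pCons c h)" "poly (pCons c h) a = 0" by blast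
    have "(0, poly (pCons c h) b) \<in> G'" using polyF[OF ch(2) ab] ch(3) by simp
    then have b0: "poly (pCons c h) b = 0" by (rule zero)
    define k where "k = Polynomial.smult (- inverse c) h"
    have cF: "c \<in> F" "over_F h" using ch(2) by (metis Polynomial.coeff_pCons_0, metis coeff_pCons_Suc)
    then have "over_F k" by (simp add: k_def F_mult F_uminus F_inverse)
    moreover have "inverse a = poly k a"
      using ch(1,3) a by (simp add: k_def field_simps add_eq_0_iff)
    moreover have "b \<noteq> 0" using b0 ch(1) by auto
    then have "inverse b = poly k b"
      using ch(1) b0 by (simp add: k_def field_simps add_eq_0_iff)
    ultimately show ?thesis using polyF[OF _ ab, of k] by simp
  qed
  have "graph G'" unfolding graph_def using F ring inv zero by blast
  moreover have "(x, y) \<in> G'"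
  proof -
    have "cw G (Polynomial.monom 1 1) (Polynomial.monom 1 1)" by (intro cw_monom G_F F_1)
    from I[OF this] show ?thesis by (simp add: poly_monom)
  qed
  ultimately show ?thesis using sub by blast
qed

lemma minimal_pair_exists: "\<exists>p q. cw G p q \<and> p \<noteq> 0 \<and> poly p x = 0 \<and>
  (\<forall>f g. cw G f g \<longrightarrow> f \<noteq> 0 \<longrightarrow> poly f x = 0 \<longrightarrow> Polynomial.degree p \<le> Polynomial.degree f)"
proof -
  define Q where "Q n \<longleftrightarrow> (\<exists>p q. cw G p q \<and> p \<noteq> 0 \<and> poly p x = 0 \<and> Polynomial.degree p = n)" for n
  have "\<exists>n. Q n" using algebraic[of x] cw_F unfolding Q_def by blast
  then have "Q (LEAST n. Q n)" by (metis LeastI)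
  moreover have "(LEAST n. Q n) \<le> n" if "Q n" for n using that by (rule Least_le)
  ultimately show ?thesis unfolding Q_def by metis
qed

end

lemma graph_total:
  assumes G: "graph G\<^sub>0"
  obtains G where "graph G" "G\<^sub>0 \<subseteq> G" "\<And>x. \<exists>y. (x, y) \<in> G"
proof -
  define S where "S = {G. graph G \<and> G\<^sub>0 \<subseteq> G}"
  have "\<exists>A\<in>S. \<forall>B\<in>S. A \<subseteq> B \<longrightarrow> B = A"
  proof (rule subset_Zorn_nonempty)
    show "S \<noteq> {}" using G by (auto simp: S_def)
    fix C assume C: "C \<noteq> {}" "subset.chain S C"
    have CS: "A \<in> S" if "A \<in> C" for A using C(2) that by (auto simp: subset.chain_def)
    have two: "\<exists>A\<in>C. c \<in> A \<and> d \<in> A" if cd: "c \<in> \<Union>C" "d \<in> \<Union>C" for c d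
    proof -
      obtain A B where "A \<in> C" "c \<in> A" "B \<in> C" "d \<in> B" using cd by blast
      moreover have "A \<subseteq> B \<or> B \<subseteq> A" using C(2) calculation by (auto simp: subset.chain_def)
      ultimately show ?thesis by blast
    qed
    have "graph (\<Union>C)"
      unfolding graph_def
    proof (intro conjI allI impI ballI)
      show "(a, a) \<in> \<Union>C" if "a \<in> F" for a
        using C(1) CS G_F that unfolding S_def by (metis (mono_tags, lifting) UnionI ex_in_conv mem_Collect_eq)
      show "(a + c, b + d) \<in> \<Union>C" "(a * c, b * d) \<in> \<Union>C" if "(a, b) \<in> \<Union>C" "(c, d) \<in> \<Union>C" for a b c d
        using two[OF that] CS G_add G_mult unfolding S_def by blast+
      show "(inverse a, inverse b) \<in> \<Union>C" if "(a, b) \<in> \<Union>C" for a b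
        using that CS G_inverse unfolding S_def by blast
      show "b = 0" if "(0, b) \<in> \<Union>C" for b using that CS G_zero unfolding S_def by blast
    qed
    moreover have "G\<^sub>0 \<subseteq> \<Union>C" using C(1) CS unfolding S_def by blast
    ultimately show "\<Union>C \<in> S" by (simp add: S_def)
  qed
  then obtain M where MS: "M \<in> S" "\<forall>B\<in>S. M \<subseteq> B \<longrightarrow> B = M" by blast
  have M: "graph M" "G\<^sub>0 \<subseteq> M" using MS(1) by (simp_all add: S_def)
  have max: "A = M" if "graph A" "M \<subseteq> A" for A
    using MS(2) that M(2) by (simp add: S_def)
  have "\<exists>y. (x, y) \<in> M" for x
  proof -
    obtain p q where pq: "cw M p q" "p \<noteq> 0" "poly p x = 0"
      "\<And>f g. cw M f g \<Longrightarrow> f \<noteq> 0 \<Longrightarrow> poly f x = 0 \<Longrightarrow> Polynomial.degree p \<le> Polynomial.degree f"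
      using minimal_pair_exists[OF M(1)] by blast
    have "Polynomial.degree p > 0"
      using pq(2,3) by (metis degree_eq_zeroE gr0I poly_const_conv pCons_0_0)
    then have "Polynomial.degree q > 0" using cw_degree[OF M(1) pq(1)] by simp
    then obtain y where y: "poly q y = 0" using alg_closed_imp_poly_has_root by blast
    have "\<exists>G'. graph G' \<and> M \<subseteq> G' \<and> (x, y) \<in> G'"
      by (rule graph_extend[OF M(1) pq(1-3) y]) (rule pq(4))
    then show ?thesis using max by blast
  qed
  then show ?thesis using that M by blast
qed

theorem conjugate_automorphism:
  assumes p: "over_F p" "p \<noteq> 0" "poly p x = 0" "poly p y = 0"
    and min: "\<And>f. over_F f \<Longrightarrow> f \<noteq> 0 \<Longrightarrow> poly f x = 0 \<Longrightarrow> Polynomial.degree p \<le> Polynomial.degree f"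
  obtains \<sigma> \<tau> where "field_auto \<sigma> \<tau>" "\<And>a. a \<in> F \<Longrightarrow> \<sigma> a = a" "\<sigma> x = y"
proof -
  define D where "D = {(a, a) | a. a \<in> F}"
  have D: "graph D"
    unfolding graph_def D_def using F_add F_mult F_inverse by auto
  have cwD: "cw D f g \<longleftrightarrow> f = g \<and> over_F f" for f g
    unfolding cw_def D_def by (auto intro: poly_eqI)
  obtain G\<^sub>0 where G0: "graph G\<^sub>0" "(x, y) \<in> G\<^sub>0"
    using graph_extend[OF D, of p p x y] p min unfolding cwD by blast
  obtain G where G: "graph G" "G\<^sub>0 \<subseteq> G" "\<And>x. \<exists>y. (x, y) \<in> G" using graph_total[OF G0(1)] by blast
  define \<sigma> where "\<sigma> x = (SOME y. (x, y) \<in> G)" for x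
  have \<sigma>: "(x, \<sigma> x) \<in> G" for x unfolding \<sigma>_def using G(3) by (metis someI_ex)
  have eqI: "(a, b) \<in> G \<Longrightarrow> \<sigma> a = b" for a b using G_unique[OF G(1) \<sigma>] by blast
  have hom: "rhom \<sigma>"
  proof
    show "\<sigma> (a + b) = \<sigma> a + \<sigma> b" for a b by (intro eqI G_add[OF G(1)] \<sigma>)
    show "\<sigma> (a * b) = \<sigma> a * \<sigma> b" for a b by (intro eqI G_mult[OF G(1)] \<sigma>)
    show "\<sigma> 1 = 1" by (intro eqI G_F[OF G(1)] F_1)
  qed
  interpret rhom \<sigma> by (rule hom)
  have fixF: "\<sigma> a = a" if "a \<in> F" for a by (intro eqI G_F[OF G(1)] that)
  have inj: "inj \<sigma>" using rhom_divide(4)[OF hom] by (auto intro: injI)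
  have "surj \<sigma>"
    unfolding surj_def
  proof
    fix b
    obtain h where h: "h \<noteq> 0" "over_F h" "poly h b = 0" using algebraic by blast
    \<comment> \<open>Since \<open>h\<close> has coefficients in \<open>F\<close>,
      \<open>\<sigma>\<close> maps its finite root set injectively into itself and thus reaches
      \<open>b\<close>.\<close>
    have "map_poly \<sigma> h = h" using fixF h(2) by (intro poly_eqI) (simp add: coeff_map)
    then have "poly h (\<sigma> a) = 0" if "poly h a = 0" for a using poly_map[of h a] that zero by simp
    then have "\<sigma> ` {a. poly h a = 0} \<subseteq> {a. poly h a = 0}" by blast
    then have "\<sigma> ` {a. poly h a = 0} = {a. poly h a = 0}"
      using poly_roots_finite[OF h(1)] inj by (metis endo_inj_surj inj_on_subset subset_UNIV)
    then show "\<exists>a. b = \<sigma> a" using h(3) by blast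
  qed
  define \<tau> where "\<tau> = inv_into UNIV \<sigma>"
  have st: "\<sigma> (\<tau> b) = b" "\<tau> (\<sigma> b) = b" for b
    unfolding \<tau>_def using \<open>surj \<sigma>\<close> inj by (simp_all add: f_inv_into_f)
  have "rhom \<tau>"
  proof
    show "\<tau> (a + b) = \<tau> a + \<tau> b" for a b using add[of "\<tau> a" "\<tau> b"] st by metis
    show "\<tau> (a * b) = \<tau> a * \<tau> b" for a b using mult[of "\<tau> a" "\<tau> b"] st by metis
    show "\<tau> 1 = 1" using one st by metis
  qed
  then have "field_auto \<sigma> \<tau>" using hom st by unfold_locales (simp_all add: rhom_def)
  moreover have "\<sigma> x = y" using eqI G0(2) G(2) by blast
  ultimately show ?thesis using that fixF by blast
qed

end

section \<open>Minimal polynomials and rationality over a subfield\<close>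

context algebraic_over
begin

lemma F_of_nat: "of_nat n \<in> F"
  by (induction n) (simp_all add: F_0 F_1 F_add)

lemma F_numeral: "numeral n \<in> F"
  using F_of_nat[of "numeral n"] by simp

definition minimal_poly :: "'b poly \<Rightarrow> 'b \<Rightarrow> bool" where
  "minimal_poly p x \<longleftrightarrow> over_F p \<and> p \<noteq> 0 \<and> poly p x = 0 \<and>
     (\<forall>f. over_F f \<longrightarrow> f \<noteq> 0 \<longrightarrow> poly f x = 0 \<longrightarrow> Polynomial.degree p \<le> Polynomial.degree f)"

lemma minimal_poly_exists: "\<exists>p. minimal_poly p x"
proof -
  define Q where "Q n \<longleftrightarrow> (\<exists>p. over_F p \<and> p \<noteq> 0 \<and> poly p x = 0 \<and> Polynomial.degree p = n)" for n
  have "\<exists>n. Q n" using algebraic[of x] unfolding Q_def by blast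
  then have "Q (LEAST n. Q n)" by (rule LeastI_ex)
  then obtain p where p: "over_F p" "p \<noteq> 0" "poly p x = 0" "Polynomial.degree p = (LEAST n. Q n)"
    unfolding Q_def by blast
  have "Polynomial.degree p \<le> Polynomial.degree f" if "over_F f" "f \<noteq> 0" "poly f x = 0" for f
    unfolding p(4) by (rule Least_le) (use that in \<open>auto simp: Q_def\<close>)
  then show ?thesis using p unfolding minimal_poly_def by blast
qed

lemma minimal_poly_dvd:
  assumes p: "minimal_poly p x" and f: "over_F f" "poly f x = 0"
  shows "p dvd f"
  using f
proof (induction "Polynomial.degree f" arbitrary: f rule: less_induct)
  case less
  have p': "over_F p" "p \<noteq> 0" "poly p x = 0" using p unfolding minimal_poly_def by blast+
  show ?case
  proof (cases "f = 0")
    case False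
    define n k where "n = Polynomial.degree f" and "k = n - Polynomial.degree p"
    have nk: "n = k + Polynomial.degree p"
      using p less.prems False unfolding minimal_poly_def by (simp add: k_def n_def)
    define a where "a = Polynomial.coeff f n / Polynomial.lead_coeff p"
    have aF: "a \<in> F" using less.prems(1) p'(1) by (simp add: a_def F_divide)
    define f' where "f' = f - Polynomial.monom a k * p"
    have "over_F f'"
      using aF less.prems(1) p'(1) by (auto simp: f'_def coeff_monom_mult intro!: F_diff F_mult F_0)
    have f'0: "poly f' x = 0" using less.prems(2) p'(3) by (simp add: f'_def)
    have "p dvd f'"
    proof (cases "f' = 0")
      case f'nz: False
      have mp: "Polynomial.coeff (Polynomial.monom a k * p) n = Polynomial.coeff f n"
        using p'(2) by (simp add: coeff_monom_mult nk a_def)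
      have "Polynomial.degree (Polynomial.monom a k * p) \<le> n"
        using degree_mult_le[of "Polynomial.monom a k" p] degree_monom_le[of a k] nk by linarith
      then have "Polynomial.degree f' \<le> n" unfolding f'_def by (intro degree_diff_le) (simp_all add: n_def)
      moreover have "Polynomial.coeff f' n = 0" using mp by (simp add: f'_def)
      ultimately have "Polynomial.degree f' < n"
        using f'nz by (metis leading_coeff_0_iff le_neq_implies_less)
      then show ?thesis using less.hyps \<open>over_F f'\<close> f'0 by (simp add: n_def)
    qed simp
    then have "p dvd f' + Polynomial.monom a k * p" by simp
    then show ?thesis by (simp add: f'_def)
  qed simp
qed

lemma minimal_poly_degree_pos: "minimal_poly p x \<Longrightarrow> Polynomial.degree p > 0"
  unfolding minimal_poly_def by (metis degree_eq_zeroE gr0I poly_const_conv pCons_0_0)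

lemma minimal_poly_degree_1:
  assumes "minimal_poly p x" shows "Polynomial.degree p = 1 \<longleftrightarrow> x \<in> F"
proof
  assume d: "Polynomial.degree p = 1"
  then have "p = [:Polynomial.coeff p 0, Polynomial.coeff p 1:]"
    by (intro poly_eqI) (auto simp: Polynomial.coeff_pCons Polynomial.coeff_eq_0 split: nat.split)
  then have "Polynomial.coeff p 0 + x * Polynomial.coeff p 1 = 0"
    using assms unfolding minimal_poly_def by (metis add.right_neutral mult_zero_right poly_0 poly_pCons)
  moreover have "Polynomial.coeff p 1 \<noteq> 0" using d by (metis degree_0 leading_coeff_0_iff one_neq_zero)
  ultimately have "x = - (Polynomial.coeff p 0 / Polynomial.coeff p 1)"
    by (simp add: field_simps add_eq_0_iff2)
  then show "x \<in> F" using assms F_uminus F_divide unfolding minimal_poly_def by metis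
next
  assume "x \<in> F"
  then have "over_F [:- x, 1:]" using F_uminus F_1 F_0 by (auto simp: Polynomial.coeff_pCons split: nat.split)
  moreover have "[:- x, 1:] \<noteq> 0" "poly [:- x, 1:] x = 0" by simp_all
  ultimately have "Polynomial.degree p \<le> Polynomial.degree [:- x, 1:]"
    using assms unfolding minimal_poly_def by blast
  then show "Polynomial.degree p = 1" using minimal_poly_degree_pos[OF assms] by simp
qed

lemma conjugate:
  assumes "minimal_poly p x" "poly p y = 0"
  obtains \<sigma> \<tau> where "field_auto \<sigma> \<tau>" "\<And>a. a \<in> F \<Longrightarrow> \<sigma> a = a" "\<sigma> x = y"
  using conjugate_automorphism[of p x y] assms unfolding minimal_poly_def by blast

text \<open>If all conjugates coincide with \<open>x\<close>, a minimal polynomial of degree above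
  one has \<open>x\<close> as a multiple root. It divides \<open>f\<close>, which contradicts the
  nonzero derivative.\<close>

lemma separable_fixed_in_F:
  assumes fixed: "\<And>\<sigma> \<tau>. field_auto \<sigma> \<tau> \<Longrightarrow> (\<And>a. a \<in> F \<Longrightarrow> \<sigma> a = a) \<Longrightarrow> \<sigma> x = x"
    and f: "over_F f" "poly f x = 0" "poly (pderiv f) x \<noteq> 0"
  shows "x \<in> F"
proof -
  obtain p where p: "minimal_poly p x" using minimal_poly_exists by blast
  have "Polynomial.degree p = 1"
  proof (rule ccontr)
    assume "Polynomial.degree p \<noteq> 1"
    then have d: "Polynomial.degree p > 1" using minimal_poly_degree_pos[OF p] by simp
    obtain q where q: "p = [:- x, 1:] * q" using p unfolding minimal_poly_def poly_eq_0_iff_dvd by (auto elim: dvdE)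
    then have "q \<noteq> 0" using d by auto
    then have "Polynomial.degree q > 0" using d unfolding q by (subst (asm) degree_mult_eq) auto
    then obtain y where y: "poly q y = 0" using alg_closed_imp_poly_has_root by blast
    then have "poly p y = 0" unfolding q by simp
    then obtain \<sigma> \<tau> where "field_auto \<sigma> \<tau>" "\<And>a. a \<in> F \<Longrightarrow> \<sigma> a = a" "\<sigma> x = y" using conjugate[OF p] by blast
    then have "y = x" using fixed by blast
    then obtain r where "q = [:- x, 1:] * r" using y by (auto simp: poly_eq_0_iff_dvd elim: dvdE)
    moreover obtain s where "f = p * s" using minimal_poly_dvd[OF p f(1,2)] by (auto elim: dvdE)
    ultimately have fq: "f = [:- x, 1:] * ([:- x, 1:] * (r * s))" using q by (simp only: mult.assoc)
    have "poly (pderiv f) x = 0" unfolding fq pderiv_mult by simp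
    then show False using f(3) by simp
  qed
  then show ?thesis using minimal_poly_degree_1[OF p] by blast
qed

lemma point_add_over_F:
  assumes "wa1 W \<in> F" "wa2 W \<in> F" "wa3 W \<in> F" "wa4 W \<in> F" "wa6 W \<in> F"
    and "set_point P \<subseteq> F" "set_point Q \<subseteq> F"
  shows "set_point (ec_add W P Q) \<subseteq> F"
proof (cases P; cases Q)
  fix x1 y1 x2 y2 assume P: "P = Affine x1 y1" and Q: "Q = Affine x2 y2"
  define l where "l = (if x1 = x2
                 then (3 * x1 ^ 2 + 2 * wa2 W * x1 + wa4 W - wa1 W * y1)
                        / (2 * y1 + wa1 W * x1 + wa3 W)
                 else (y2 - y1) / (x2 - x1))"
  define x3 where "x3 = l ^ 2 + wa1 W * l - wa2 W - x1 - x2"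
  have xy: "x1 \<in> F" "y1 \<in> F" "x2 \<in> F" "y2 \<in> F" using assms P Q by auto
  have l: "l \<in> F" unfolding l_def
    by (auto intro!: F_divide F_diff F_add F_mult F_power F_numeral assms xy)
  have x3: "x3 \<in> F" unfolding x3_def by (intro F_diff F_add F_mult F_power assms xy l)
  have y3: "- (l + wa1 W) * x3 - (y1 - l * x1) - wa3 W \<in> F"
    by (intro F_diff F_add F_mult F_uminus assms xy l x3)
  have "ec_add W P Q = (if x1 = x2 \<and> y1 + y2 + wa1 W * x2 + wa3 W = 0 then Infinity
      else Affine x3 (- (l + wa1 W) * x3 - (y1 - l * x1) - wa3 W))"
    unfolding P Q ec_add.simps Let_def l_def[symmetric] x3_def[symmetric] by (rule refl)
  then show ?thesis using x3 y3 by simp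
qed (use assms in auto)

lemma point_mult_over_F:
  assumes "wa1 W \<in> F" "wa2 W \<in> F" "wa3 W \<in> F" "wa4 W \<in> F" "wa6 W \<in> F" "set_point P \<subseteq> F"
  shows "set_point (ec_mult W n P) \<subseteq> F"
  by (induction n) (simp_all add: ec_mult_Suc point_add_over_F assms)

lemma point_neg_over_F:
  assumes "wa1 W \<in> F" "wa3 W \<in> F" "set_point P \<subseteq> F"
  shows "set_point (ec_neg W P) \<subseteq> F"
  using assms by (cases P) (auto intro!: F_diff F_mult F_uminus)

end

section \<open>Subfields generated inside the algebraic closure\<close>

lemma closure_ring_simps [simp]:
  "carrier closure_ring = UNIV" "monoid.mult closure_ring = (*)" "ring.add closure_ring = (+)"
  "one closure_ring = 1" "ring.zero closure_ring = 0"
  by (simp_all add: ring_of_type_algebra_def)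

lemma closure_ring_a_inv [simp]: "a_inv closure_ring x = - x"
proof -
  interpret cring closure_ring by (rule cring_from_type_algebra)
  show ?thesis using minus_equality[of "- x" x] by simp
qed

lemma closure_ring_m_inv:
  assumes "x \<noteq> 0" shows "m_inv closure_ring x = inverse x"
proof -
  interpret cring closure_ring by (rule cring_from_type_algebra)
  show ?thesis using comm_inv_char[of x "inverse x"] assms by simp
qed

lemma adjoin_algebraic_over: "algebraic_over (adjoin S)"
proof
  show one: "1 \<in> adjoin S" unfolding adjoin_def using generate_field.one[of closure_ring] by simp
  show add: "a + b \<in> adjoin S" if "a \<in> adjoin S" "b \<in> adjoin S" for a b
    using that generate_field.eng_add[of a closure_ring _ b] unfolding adjoin_def by simp
  show "a * b \<in> adjoin S" if "a \<in> adjoin S" "b \<in> adjoin S" for a b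
    using that generate_field.eng_mult[of a closure_ring _ b] unfolding adjoin_def by simp
  show um: "- a \<in> adjoin S" if "a \<in> adjoin S" for a
    using that generate_field.a_inv[of a closure_ring] unfolding adjoin_def by simp
  show zero: "0 \<in> adjoin S" using add[OF one um[OF one]] by simp
  \<comment> \<open>Generated fields contain inverses of nonzero elements; for 0 the convention
    \<open>inverse 0 = 0\<close> applies.\<close>
  show "inverse a \<in> adjoin S" if "a \<in> adjoin S" for a
    using that generate_field.m_inv[of a closure_ring] closure_ring_m_inv[of a] zero unfolding adjoin_def
    by (cases "a = 0") simp_all
  fix x :: "'a alg_closure"
  obtain p :: "'a poly" where p: "p \<noteq> 0" "poly (map_poly to_ac p) x = 0" by (rule alg_closure_algebraic)
  have "map_poly to_ac p \<noteq> 0" using p(1) by (simp add: map_poly_eq_0_iff)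
  moreover have "Polynomial.coeff (map_poly to_ac p) i \<in> adjoin S" for i
    unfolding adjoin_def by (rule generate_field.incl) (simp add: coeff_map_poly)
  ultimately show "\<exists>h. h \<noteq> 0 \<and> (\<forall>i. Polynomial.coeff h i \<in> adjoin S) \<and> poly h x = 0" using p(2) by blast
qed

lemma adjoin_incl: "S \<subseteq> adjoin S" and adjoin_base: "to_ac c \<in> adjoin S"
  unfolding adjoin_def by (auto intro: generate_field.incl)

lemma adjoin_minimal:
  assumes "S \<subseteq> A" "\<And>c. to_ac c \<in> A" "1 \<in> A" "\<And>a. a \<in> A \<Longrightarrow> - a \<in> A" "\<And>a. a \<in> A \<Longrightarrow> a \<noteq> 0 \<Longrightarrow> inverse a \<in> A"
    "\<And>a b. a \<in> A \<Longrightarrow> b \<in> A \<Longrightarrow> a + b \<in> A" "\<And>a b. a \<in> A \<Longrightarrow> b \<in> A \<Longrightarrow> a * b \<in> A"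
  shows "adjoin S \<subseteq> A"
proof
  fix x assume "x \<in> adjoin S"
  then show "x \<in> A" unfolding adjoin_def
    by (induction rule: generate_field.induct) (use assms in \<open>auto simp: closure_ring_m_inv\<close>)
qed

lemma adjoin_subset_adjoin:
  assumes "S \<subseteq> adjoin T" shows "adjoin S \<subseteq> adjoin T"
proof -
  interpret algebraic_over "adjoin T" by (rule adjoin_algebraic_over)
  show ?thesis using assms F_1 F_uminus F_inverse F_add F_mult adjoin_base by (intro adjoin_minimal) auto
qed

section \<open>Points on a horizontal line\<close>

context ec
begin

text \<open>The three abscissas are the roots of one monic cubic, so they sum to - a2, which is what
  the addition formula gives for slope zero.\<close>

lemma collinear_distinct:
  assumes P: "on_curve E (Affine x y)" "on_curve E (Affine x' y)" "on_curve E (Affine x'' y)"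
    and ne: "x \<noteq> x'" "x' \<noteq> x''" "x \<noteq> x''"
  shows "Affine x y \<boxplus> Affine x' y = neg (Affine x'' y)"
proof -
  have 1: "(x - x') * (x ^ 2 + x * x' + x' ^ 2 + a2 * (x + x') + a4 - a1 * y) = 0"
    using P(1,2) unfolding on_curve.simps by Groebner_Basis.algebra
  have 2: "(x - x'') * (x ^ 2 + x * x'' + x'' ^ 2 + a2 * (x + x'') + a4 - a1 * y) = 0"
    using P(1,3) unfolding on_curve.simps by Groebner_Basis.algebra
  have "(x' - x'') * (x + x' + x'' + a2) = 0"
    using 1 2 ne by simp Groebner_Basis.algebra
  then have "x + x' + x'' + a2 = 0" using ne by simp
  then have "x'' = - a2 - x - x'" by Groebner_Basis.algebra
  then show ?thesis using ne by (simp add: Let_def)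
qed

lemma collinear_tangent:
  assumes "2 * y + a1 * x + a3 \<noteq> 0" "3 * x ^ 2 + 2 * a2 * x + a4 - a1 * y = 0"
  shows "Affine x y \<boxplus> Affine x y = neg (Affine (- a2 - 2 * x) y)"
proof -
  have "y + y + a1 * x + a3 \<noteq> 0" using assms(1) by (simp add: mult_2[symmetric])
  then show ?thesis using assms(2) by (simp add: Let_def algebra_simps)
qed

end

section \<open>The torsion field\<close>

locale torsion_setup =
  fixes E :: "'k::field weierstrass" and m :: nat and x1 y1 x2 y2 :: "'k alg_closure"
  assumes elliptic: "elliptic_curve E" and m4: "m \<ge> 4"
    and char_coprime: "CHAR('k) > 0 \<Longrightarrow> coprime m CHAR('k)"
    and basis: "torsion_basis E m (Affine x1 y1) (Affine x2 y2)"
begin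

abbreviation "C \<equiv> base_change E"
abbreviation "pt1 \<equiv> Affine x1 y1"
abbreviation "pt2 \<equiv> Affine x2 y2"
abbreviation "\<zeta> \<equiv> weil_pairing C m pt1 pt2"
abbreviation "F \<equiv> adjoin {x1, \<zeta>, y1, y2}"
abbreviation "Km \<equiv> torsion_field E m"

sublocale ec_basis C m pt1 pt2
proof
  have "discriminant C = to_ac (discriminant E)"
    by (simp add: base_change_def discriminant_def weierstrass.map_sel Let_def)
  then show "discriminant C \<noteq> 0" using elliptic by (simp add: elliptic_curve_def)
  show "m > 0" using m4 by simp
  show "on_curve C pt1" "ec_mult C m pt1 = Infinity" "on_curve C pt2" "ec_mult C m pt2 = Infinity"
    using basis unfolding torsion_basis_def torsion_def Let_def by blast+
  show "\<exists>a b. P = ec_add C (ec_mult C a pt1) (ec_mult C b pt2)"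
    if "on_curve C P" "ec_mult C m P = Infinity" for P
    using basis that unfolding torsion_basis_def torsion_def Let_def by blast
  show "m dvd a \<and> m dvd b" if "ec_add C (ec_mult C a pt1) (ec_mult C b pt2) = Infinity" for a b
    using basis that unfolding torsion_basis_def Let_def by blast
qed

abbreviation pt_sum (infixl "\<boxplus>" 65) where "P \<boxplus> Q \<equiv> ec_add C P Q"

sublocale F: algebraic_over F by (rule adjoin_algebraic_over)

sublocale K: algebraic_over Km unfolding torsion_field_def by (rule adjoin_algebraic_over)

lemma tors_torsion: "tors n = torsion E n"
  by (simp add: tors_def torsion_def)

lemma C_coeffs: "a1 \<in> adjoin S" "a2 \<in> adjoin S" "a3 \<in> adjoin S" "a4 \<in> adjoin S" "a6 \<in> adjoin S"
  by (simp_all add: base_change_def weierstrass.map_sel adjoin_base)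

lemma tors_over:
  assumes "{x1, y1, x2, y2} \<subseteq> adjoin S" "P \<in> H"
  shows "set_point P \<subseteq> adjoin S"
proof -
  interpret A: algebraic_over "adjoin S" by (rule adjoin_algebraic_over)
  obtain a b where "P = ec_mult C a pt1 \<boxplus> ec_mult C b pt2"
    using generate tors_on_curve tors_mult assms(2) by blast
  then show ?thesis using assms(1)
    by (simp add: A.point_add_over_F A.point_mult_over_F C_coeffs)
qed

lemma F_elems: "x1 \<in> F" "\<zeta> \<in> F" "y1 \<in> F" "y2 \<in> F"
  using adjoin_incl[of "{x1, \<zeta>, y1, y2}"] by simp_all

lemma tors_over_Km:
  assumes "P \<in> H" shows "set_point P \<subseteq> Km"
proof -
  have "set_point P \<subseteq> coordinates (torsion E m)"
    using assms unfolding coordinates_def tors_torsion by blast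
  then show ?thesis using adjoin_incl unfolding torsion_field_def by (rule order.trans)
qed

lemma Km_elems: "x1 \<in> Km" "y1 \<in> Km" "x2 \<in> Km" "y2 \<in> Km"
  using tors_over_Km[OF tors_P1] tors_over_Km[OF tors_P2] by simp_all

lemma char_neq_1: "CHAR('k) \<noteq> 1"
proof
  assume "CHAR('k) = 1"
  then have "of_nat 1 = (0 :: 'k)" by (simp only: of_nat_eq_0_iff_char_dvd one_dvd)
  then show False by simp
qed

lemma auto_curve:
  assumes "field_auto \<sigma> \<tau>" "\<And>c. \<sigma> (to_ac c) = to_ac c"
  shows "curve_auto \<sigma> \<tau> C"
proof -
  have "map_weierstrass \<sigma> C = C"
    using assms(2) by (simp add: base_change_def weierstrass.map_comp comp_def)
  then show ?thesis using assms(1) by (simp add: curve_auto_def curve_auto_axioms_def)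
qed

lemma zeta_power: "\<zeta> ^ m = 1"
proof -
  have "pair pt1 pt2 ^ m = pair (ec_mult C m pt1) pt2" by (rule pair_mult_left[OF tors_P1 tors_P2, symmetric])
  also have "\<dots> = 1" unfolding P1(2) by (rule pair_Infinity_left[OF tors_P2])
  finally show ?thesis by (simp only: weil_pairing_eq[OF tors_P1 tors_P2])
qed

lemma of_nat_m: "(of_nat m :: 'k alg_closure) \<noteq> 0"
proof
  assume "(of_nat m :: 'k alg_closure) = 0"
  then have d: "CHAR('k) dvd m" by (simp add: of_nat_eq_0_iff_char_dvd)
  show False
  proof (cases "CHAR('k) > 0")
    case True
    then have "CHAR('k) = 1" using char_coprime d by (metis coprime_absorb_right nat_dvd_1_iff_1 coprime_commute)
    then show False using char_neq_1 by simp
  next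
    case False
    then show False using d m4 by simp
  qed
qed

text \<open>Automorphisms over \<open>Km\<close> fix both basis points, hence their pairing. This
  suffices because X^m - 1 is separable: m is nonzero in the field.\<close>

lemma zeta_in_Km: "\<zeta> \<in> Km"
proof (rule K.separable_fixed_in_F)
  fix \<sigma> \<tau> assume \<sigma>: "field_auto \<sigma> \<tau>" "\<And>a. a \<in> Km \<Longrightarrow> \<sigma> a = a"
  have "curve_auto \<sigma> \<tau> C" using \<sigma> adjoin_base unfolding torsion_field_def by (intro auto_curve) auto
  then have "weil_pairing C m (map_point \<sigma> pt1) (map_point \<sigma> pt2) = \<sigma> \<zeta>"
    by (rule weil_pairing_auto[OF _ tors_P1 tors_P2])
  then show "\<sigma> \<zeta> = \<zeta>" using \<sigma>(2) Km_elems by simp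
next
  show "K.over_F (Polynomial.monom 1 m - 1)"
    using K.F_0 K.F_1 K.F_uminus by (auto intro!: K.F_diff simp: coeff_1)
  show "poly (Polynomial.monom 1 m - 1) \<zeta> = 0" using zeta_power by (simp add: poly_monom)
  have "\<zeta> \<noteq> 0" using zeta_power m4 by (metis not_numeral_le_zero power_eq_0_iff zero_neq_one power_0_left)
  then show "poly (pderiv (Polynomial.monom 1 m - 1)) \<zeta> \<noteq> 0"
    using of_nat_m by (simp add: pderiv_diff pderiv_monom poly_monom)
qed

lemma F_sub_Km: "F \<subseteq> Km"
  using Km_elems zeta_in_Km unfolding torsion_field_def by (intro adjoin_subset_adjoin) simp

lemma Km_sub:
  assumes "{x1, y1, x2, y2} \<subseteq> adjoin S" shows "Km \<subseteq> adjoin S"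
proof -
  have "coordinates (torsion E m) \<subseteq> adjoin S"
    unfolding coordinates_def using tors_over[OF assms] by (intro UN_least) (simp add: tors_torsion)
  then show ?thesis unfolding torsion_field_def by (rule adjoin_subset_adjoin)
qed

lemma not_2_torsion: "2 * y2 + a1 * x2 + a3 \<noteq> 0"
proof
  assume "2 * y2 + a1 * x2 + a3 = 0"
  then have "pt2 \<boxplus> pt2 = Infinity" by (simp add: mult_2[symmetric])
  then have "ec_mult C 0 pt1 \<boxplus> ec_mult C 2 pt2 = Infinity" by (simp add: numeral_2_eq_2 ec_mult_Suc)
  then have "m dvd 2" using independent by blast
  then show False using m4 by (auto dest: dvd_imp_le)
qed

lemma auto_P2:
  assumes \<sigma>: "field_auto \<sigma> \<tau>" "\<And>a. a \<in> F \<Longrightarrow> \<sigma> a = a"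
  shows "\<sigma> x2 = x2 \<or> (even m \<and> Affine (\<sigma> x2) y2 = ec_mult C (m div 2) pt1 \<boxplus> pt2)"
proof (unfold disj_imp, rule impI)
  assume ne: "\<sigma> x2 \<noteq> x2"
  have ca: "curve_auto \<sigma> \<tau> C" using \<sigma> adjoin_base by (intro auto_curve) auto
  interpret s: curve_auto \<sigma> \<tau> C by (rule ca)
  define Q where "Q = Affine (\<sigma> x2) y2"
  define R where "R = Affine (\<sigma> (\<sigma> x2)) y2"
  have m1: "map_point \<sigma> pt1 = pt1" and m2: "map_point \<sigma> pt2 = Q" and mQ: "map_point \<sigma> Q = R"
    using \<sigma>(2) F_elems by (simp_all add: Q_def R_def)
  have "on_curve C (map_point \<sigma> pt2)" by (simp only: s.on_curve_map P2(1))
  moreover have "ec_mult C m (map_point \<sigma> pt2) = Infinity" unfolding s.ec_mult_map P2(2) by simp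
  ultimately have QH: "Q \<in> H" unfolding m2 tors_def by simp
  obtain c d where cd: "Q = ec_mult C c pt1 \<boxplus> ec_mult C d pt2"
    using generate tors_on_curve[OF QH] tors_mult[OF QH] by blast
  have "pair pt1 Q = pair pt1 pt2"
    using weil_pairing_auto[OF ca tors_P1 tors_P2] \<sigma>(2)[OF F_elems(2)]
      weil_pairing_eq[OF tors_P1 tors_P2] weil_pairing_eq[OF tors_P1 QH] unfolding m1 m2 by simp
  then have "d mod m = 1 mod m" using pair_eq_imp_cong cd by simp
  then have "ec_mult C d pt2 = pt2"
    using ec_mult_mod[OF tors_P2, of d] ec_mult_mod[OF tors_P2, of 1] by simp
  then have Q: "Q = ec_mult C c pt1 \<boxplus> pt2" using cd by simp
  have R: "R = ec_mult C c pt1 \<boxplus> Q"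
    using s.ec_add_map[of "ec_mult C c pt1" pt2] s.ec_mult_map[of c pt1] unfolding Q[symmetric] m1 m2 mQ by simp
  have oc: "on_curve C Q" "on_curve C R" using tors_on_curve[OF QH] s.on_curve_map[of Q] mQ by simp_all
  have nc: "\<not> m dvd c"
  proof
    assume "m dvd c"
    then have "ec_mult C c pt1 = Infinity" using ec_mult_mod[OF tors_P1, of c] by (simp add: dvd_eq_mod_eq_0)
    then show False using Q ne by (simp add: Q_def)
  qed
  have "R = pt2"
  proof (rule ccontr)
    assume "R \<noteq> pt2"
    then have "x2 \<noteq> \<sigma> (\<sigma> x2)" by (auto simp: R_def)
    moreover have "\<sigma> x2 \<noteq> \<sigma> (\<sigma> x2)" using ne s.\<sigma>_field(4) by auto
    ultimately have "pt2 \<boxplus> Q = neg R"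
      unfolding Q_def R_def using oc P2 ne by (intro collinear_distinct) (auto simp: Q_def R_def)
    then have "pt2 \<boxplus> Q \<boxplus> R = Infinity" using neg_add[OF oc(2)] by simp
    moreover have "ec_mult C (c + (c + c)) pt1 \<boxplus> ec_mult C (Suc (Suc (Suc 0))) pt2 = pt2 \<boxplus> Q \<boxplus> R"
      unfolding R unfolding Q using P1 P2
      by (simp only: ec_mult_add ec_mult_Suc ec_mult_0 pt_add_Infinity pt_add_assoc pt_add_left_commute on_curve_mult on_curve_add)
    ultimately have "m dvd Suc (Suc (Suc 0))" using independent by metis
    then show False using m4 by (auto dest: dvd_imp_le)
  qed
  then have "ec_mult C (c + c) pt1 \<boxplus> ec_mult C 1 pt2 = ec_mult C 0 pt1 \<boxplus> ec_mult C 1 pt2"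
    using R Q P1 P2 by (simp add: ec_mult_add pt_add_assoc)
  then have "m dvd 2 * c" using combination_inj(1) by (metis mod_0 dvd_eq_mod_eq_0 mult_2)
  have "even m"
  proof (rule ccontr)
    assume "odd m"
    then have "coprime m 2" by simp
    then show False using \<open>m dvd 2 * c\<close> nc by (simp add: coprime_dvd_mult_right_iff)
  qed
  \<comment> \<open>As m divides 2 c but not c, c is an odd multiple of m / 2 and hence congruent to
    m / 2 modulo m.\<close>
  then obtain k where k: "m = 2 * k" by (elim evenE)
  obtain j where j: "c = k * j" using \<open>m dvd 2 * c\<close> k by auto
  have "odd j"
  proof
    assume "even j"
    then obtain i where "j = 2 * i" by (elim evenE)
    then show False using nc j k by simp
  qed
  then obtain i where "j = 2 * i + 1" by (elim oddE)
  then have "c = k + m * i" using j k by (simp add: algebra_simps)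
  then have "c mod m = k" using k m4 by simp
  then have "ec_mult C c pt1 = ec_mult C (m div 2) pt1" using ec_mult_mod[OF tors_P1, of c] k by simp
  then show "even m \<and> Affine (\<sigma> x2) y2 = ec_mult C (m div 2) pt1 \<boxplus> pt2"
    using \<open>even m\<close> Q Q_def by simp
qed

lemma three_P2: "pt2 \<boxplus> pt2 \<noteq> neg pt2"
proof
  assume "pt2 \<boxplus> pt2 = neg pt2"
  then have "pt2 \<boxplus> (pt2 \<boxplus> pt2) = Infinity" using pt_add_neg[of pt2] by simp
  then have "ec_mult C 0 pt1 \<boxplus> ec_mult C (Suc (Suc (Suc 0))) pt2 = Infinity" by (simp only: ec_mult_Suc ec_mult_0 pt_add_Infinity)
  then have "m dvd Suc (Suc (Suc 0))" using independent by metis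
  then show False using m4 by (auto dest: dvd_imp_le)
qed

text \<open>On the m-torsion for odd m, multiplication by (m + 1) / 2 inverts doubling.\<close>

lemma half_in_F:
  assumes "set_point (ec_mult C 2 pt2) \<subseteq> F" "odd m"
  shows "x2 \<in> F"
proof -
  obtain k where k: "m = 2 * k + 1" using assms(2) by (elim oddE)
  have "pt2 = ec_mult C (m + 1) pt2" using P2 by (simp only: ec_mult_add) simp
  also have "m + 1 = (k + 1) * 2" using k by simp
  also have "ec_mult C ((k + 1) * 2) pt2 = ec_mult C (k + 1) (ec_mult C 2 pt2)" using P2 by (simp only: ec_mult_mult)
  finally have "set_point pt2 \<subseteq> F"
    using F.point_mult_over_F[OF C_coeffs assms(1), of "k + 1"] by simp
  then show ?thesis by simp
qed

text \<open>A horizontal tangent puts -2 P2 on the line y = y2, with abscissa - a2 - 2 x2 in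
  \<open>F\<close>. In characteristic 2, where 2 x2 says nothing about x2, m is odd by coprimality
  and \<open>half_in_F\<close> applies.\<close>

lemma tangent_in_F:
  assumes D: "3 * x2 ^ 2 + 2 * a2 * x2 + a4 - a1 * y2 = 0" and "2 * x2 \<in> F"
  shows "x2 \<in> F"
proof (cases "(2 :: 'k alg_closure) = 0")
  case False
  then have "x2 = (2 * x2) / 2" by simp
  then show ?thesis using assms(2) F.F_divide[OF _ F.F_numeral] by metis
next
  case True
  then have "CHAR('k) dvd 2" using of_nat_eq_0_iff_char_dvd[where 'a = "'k alg_closure", of 2] by simp
  then have "CHAR('k) = 2" using char_neq_1 by (metis prime_nat_iff two_is_prime_nat)
  then have "odd m" using char_coprime by simp
  have "ec_mult C 2 pt2 = neg (Affine (- a2 - 2 * x2) y2)"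
    using collinear_tangent[OF not_2_torsion D] by (simp add: numeral_2_eq_2 ec_mult_Suc)
  moreover have "- a2 - 2 * x2 \<in> F" using assms(2) C_coeffs F.F_diff F.F_uminus by blast
  ultimately have "set_point (ec_mult C 2 pt2) \<subseteq> F"
    using F.point_neg_over_F[OF C_coeffs(1,3), of "Affine (- a2 - 2 * x2) y2"] F_elems by simp
  then show ?thesis using half_in_F \<open>odd m\<close> by blast
qed

text \<open>The minimal polynomial of \<open>x2\<close> divides the cubic \<open>f\<close> of
  abscissas on the line y = y2. By \<open>auto_P2\<close> a conjugate of \<open>x2\<close> other
  than itself must be the abscissa of (m/2) P1 + P2. What remains is to show that the degree is two
  and the two roots differ.\<close>

lemma x2_cases:
  assumes nF: "x2 \<notin> F"
  obtains r \<sigma> \<tau> where "even m" "r \<noteq> x2" "Affine r y2 = ec_mult C (m div 2) pt1 \<boxplus> pt2"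
    "x2 + r \<in> F" "x2 * r \<in> F" "field_auto \<sigma> \<tau>" "\<And>a. a \<in> F \<Longrightarrow> \<sigma> a = a" "\<sigma> x2 = r"
proof -
  obtain p where p: "F.minimal_poly p x2" using F.minimal_poly_exists by blast
  have p': "F.over_F p" "p \<noteq> 0" "poly p x2 = 0" using p unfolding F.minimal_poly_def by blast+
  have root: "r = x2 \<or> (even m \<and> Affine r y2 = ec_mult C (m div 2) pt1 \<boxplus> pt2)" if pr: "poly p r = 0" for r
  proof -
    obtain \<sigma> \<tau> where "field_auto \<sigma> \<tau>" "\<And>a. a \<in> F \<Longrightarrow> \<sigma> a = a" "\<sigma> x2 = r" using F.conjugate[OF p pr] by blast
    then show ?thesis using auto_P2 by blast
  qed
  define b c where "b = a4 - a1 * y2" and "c = a6 - y2 ^ 2 - a3 * y2"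
  define f where "f = [:c, b, a2, 1:]"
  have bc: "b \<in> F" "c \<in> F" unfolding b_def c_def
    by (intro F.F_diff F.F_mult F.F_power C_coeffs F_elems)+
  have fF: "F.over_F f" unfolding f_def using bc C_coeffs F.F_1 F.F_0
    by (auto simp: Polynomial.coeff_pCons split: nat.split)
  have fx: "poly f x2 = 0"
    using P2(1) unfolding f_def b_def c_def on_curve.simps by simp Groebner_Basis.algebra
  have pf: "p dvd f" using F.minimal_poly_dvd[OF p fF fx] .
  have deg3: "Polynomial.degree f = 3" "f \<noteq> 0" by (simp_all add: f_def)
  have "Polynomial.degree p \<le> 3" using dvd_imp_degree_le[OF pf deg3(2)] deg3 by simp
  moreover have "Polynomial.degree p > 0" using F.minimal_poly_degree_pos[OF p] .
  moreover have "Polynomial.degree p \<noteq> 1" using F.minimal_poly_degree_1[OF p] nF by simp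
  ultimately consider "Polynomial.degree p = 2" | "Polynomial.degree p = 3" by linarith
  then show ?thesis
  proof cases
    case 1
    obtain p1 where p1: "p = [:- x2, 1:] * p1" using p'(3) by (auto simp: poly_eq_0_iff_dvd elim: dvdE)
    have "p1 \<noteq> 0" using p1 p'(2) by auto
    then have d1: "Polynomial.degree p1 = 1" using 1 unfolding p1 by (subst (asm) degree_mult_eq) auto
    define u v where "u = Polynomial.coeff p1 0" and "v = Polynomial.coeff p1 1"
    have p1': "p1 = [:u, v:]" unfolding u_def v_def using d1
      by (intro poly_eqI) (auto simp: Polynomial.coeff_pCons Polynomial.coeff_eq_0 split: nat.split)
    have v: "v \<noteq> 0" using d1 unfolding v_def by (metis leading_coeff_0_iff \<open>p1 \<noteq> 0\<close>)
    define t where "t = - u / v"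
    have ut: "u = - (v * t)" using v by (simp add: t_def)
    have pc: "p = [:v * (x2 * t), - (v * (x2 + t)), v:]" unfolding p1 p1' ut by (simp add: algebra_simps)
    have coeffs: "v * (x2 * t) \<in> F" "- (v * (x2 + t)) \<in> F" "v \<in> F"
      using p'(1)[rule_format, of 0] p'(1)[rule_format, of 1] p'(1)[rule_format, of 2] unfolding pc
      by (simp_all add: numeral_2_eq_2)
    have sum: "x2 + t \<in> F" and prod: "x2 * t \<in> F"
    proof -
      have "v * (x2 * t) / v \<in> F" by (rule F.F_divide[OF coeffs(1,3)])
      moreover have "- (- (v * (x2 + t))) / v \<in> F" by (rule F.F_divide[OF F.F_uminus[OF coeffs(2)] coeffs(3)])
      ultimately show "x2 + t \<in> F" "x2 * t \<in> F" using v by simp_all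
    qed
    have pt: "poly p t = 0" unfolding p1 p1' ut by simp
    \<comment> \<open>A repeated root of \<open>p\<close> would be a multiple root of
      \<open>f\<close>, which makes the tangent at P2 horizontal.\<close>
    have tne: "t \<noteq> x2"
    proof
      assume t: "t = x2"
      obtain q where q: "f = p * q" using pf by (auto elim: dvdE)
      have "p1 = [:- x2, 1:] * [:v:]" unfolding p1' ut t by (simp add: algebra_simps)
      then have "f = [:- x2, 1:] * ([:- x2, 1:] * ([:v:] * q))"
        using q p1 by (simp only: mult.assoc)
      then have "poly (pderiv f) x2 = 0" by (simp only: pderiv_mult) simp
      then have "3 * x2 ^ 2 + 2 * a2 * x2 + a4 - a1 * y2 = 0"
        unfolding f_def b_def by (simp add: pderiv_pCons) Groebner_Basis.algebra
      then have "x2 \<in> F" by (rule tangent_in_F) (use sum t in \<open>simp only: mult_2\<close>)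
      then show False using nF by simp
    qed
    obtain \<sigma> \<tau> where st: "field_auto \<sigma> \<tau>" "\<And>a. a \<in> F \<Longrightarrow> \<sigma> a = a" "\<sigma> x2 = t" using F.conjugate[OF p pt] by blast
    then show ?thesis using that[of t \<sigma> \<tau>] root[OF pt] tne sum prod by blast
  next
    \<comment> \<open>Now \<open>p\<close> is proportional to \<open>f\<close>, so all three roots
      of \<open>f\<close> are conjugates of \<open>x2\<close>; only two values are available, and
      some root is repeated.\<close>
    case 3: 2
    obtain q where q: "f = p * q" using pf by (auto elim: dvdE)
    have "q \<noteq> 0" using q deg3 by auto
    then have "Polynomial.degree q = 0" using 3 deg3(1) p'(2) unfolding q by (subst (asm) degree_mult_eq) auto
    then obtain k where k: "q = [:k:]" by (metis degree_eq_zeroE)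
    have "k \<noteq> 0" using k \<open>q \<noteq> 0\<close> by auto
    then have root_f: "poly p r = 0" if "poly f r = 0" for r using that unfolding q k by simp
    have "\<exists>r. poly [:b + x2 * (a2 + x2), a2 + x2, 1:] r = 0" by (rule alg_closed_imp_poly_has_root) simp
    then obtain r where r: "poly [:b + x2 * (a2 + x2), a2 + x2, 1:] r = 0" by blast
    then have r0: "r ^ 2 + (a2 + x2) * r + b + x2 * (a2 + x2) = 0" by (simp add: algebra_simps power2_eq_square)
    define s where "s = - a2 - x2 - r"
    have fx': "x2 ^ 3 + a2 * x2 ^ 2 + b * x2 + c = 0" using fx unfolding f_def by simp Groebner_Basis.algebra
    have fr: "poly f r = 0" and fs: "poly f s = 0"
      using r0 fx' unfolding f_def s_def by (simp, Groebner_Basis.algebra)+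
    define D where "D z = 3 * z ^ 2 + 2 * a2 * z + b" for z
    have Dx: "D x2 = (x2 - r) * (x2 - s)" and Dr: "D r = (r - x2) * (r - s)" and Ds: "D s = (s - x2) * (s - r)"
      unfolding D_def s_def using r0 by Groebner_Basis.algebra+
    have Dpoly: "D z = poly [:b, 2 * a2, 3:] z" for z unfolding D_def by (simp add: algebra_simps power2_eq_square)
    have DF: "F.over_F [:b, 2 * a2, 3:]" using bc(1) C_coeffs F.F_0 F.F_numeral F.F_mult
      by (auto simp: Polynomial.coeff_pCons split: nat.split)
    \<comment> \<open>\<open>D\<close> is the derivative of \<open>f\<close>. If the repeated root
      is \<open>r = s\<close> rather than \<open>x2\<close>, an automorphism over \<open>F\<close>
      taking \<open>x2\<close> to \<open>r\<close> transports the zero of \<open>D\<close> back to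
      \<open>x2\<close>.\<close>
    have "D x2 = 0"
    proof (cases "r = x2 \<or> s = x2")
      case True
      then show ?thesis using Dx by auto
    next
      case False
      have "r = s" using root[OF root_f[OF fr]] root[OF root_f[OF fs]] False by (metis point.inject)
      then have "D r = 0" using Dr by simp
      obtain \<sigma> \<tau> where st: "field_auto \<sigma> \<tau>" "\<And>a. a \<in> F \<Longrightarrow> \<sigma> a = a" "\<sigma> x2 = r"
        using F.conjugate[OF p root_f[OF fr]] by blast
      interpret s: field_auto \<sigma> \<tau> by (rule st(1))
      have "\<sigma> (D x2) = D r" unfolding D_def
        using st(2)[OF C_coeffs(2)] st(2)[OF bc(1)] st(3) by (simp add: s.h.simps)
      then show ?thesis using \<open>D r = 0\<close> s.\<sigma>_field(3) by simp
    qed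
    \<comment> \<open>The derivative has degree at most two and annihilates \<open>x2\<close>, whose
      minimal polynomial has degree three; so it is the zero polynomial.\<close>
    have "[:b, 2 * a2, 3:] = 0"
    proof (rule ccontr)
      assume "[:b, 2 * a2, 3:] \<noteq> 0"
      then have "Polynomial.degree p \<le> Polynomial.degree [:b, 2 * a2, 3:]"
        using p DF \<open>D x2 = 0\<close> Dpoly unfolding F.minimal_poly_def by metis
      also have "Polynomial.degree [:b, 2 * a2, 3:] \<le> 2" by simp
      finally show False using 3 by simp
    qed
    then have "D z = 0" for z unfolding Dpoly by simp
    then have "(x2 - r) * (x2 - s) = 0" "(r - x2) * (r - s) = 0" "(s - x2) * (s - r) = 0"
      using Dx Dr Ds by metis+
    then have rs: "r = x2" "s = x2" by auto
    then have "- a2 - x2 - x2 = x2" unfolding s_def by simp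
    \<comment> \<open>All three intersections coincide with P2, a flex, whence 3 P2 = O.\<close>
    then have third: "- a2 - 2 * x2 = x2" by (simp only: mult_2 diff_diff_eq)
    have "3 * x2 ^ 2 + 2 * a2 * x2 + a4 - a1 * y2 = 0"
      using \<open>D x2 = 0\<close> unfolding D_def b_def by (simp only: add_diff_eq)
    then have "pt2 \<boxplus> pt2 = neg pt2"
      using collinear_tangent[OF not_2_torsion] unfolding third by blast
    then show ?thesis using three_P2 by blast
  qed
qed

end

section \<open>The quadratic case and its Galois group\<close>

context torsion_setup
begin

lemma Km_eq_F_iff: "Km = F \<longleftrightarrow> x2 \<in> F"
proof
  assume "x2 \<in> F"
  then have "Km \<subseteq> F" using F_elems by (intro Km_sub) simp
  then show "Km = F" using F_sub_Km by blast
qed (use Km_elems in blast)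

text \<open>\<open>x2\<close> is a root of the quadratic with sum \<open>x2 + r\<close> and product
  \<open>x2 * r\<close> in \<open>F\<close>, so F + F x2 is closed under products. As it contains
  both basis points, it contains all of E[m].\<close>

lemma Km_quadratic:
  assumes nF: "x2 \<notin> F" and r: "x2 + r \<in> F" "x2 * r \<in> F"
  shows "Km = {u + v * x2 | u v. u \<in> F \<and> v \<in> F}"
proof
  let ?B = "{u + v * x2 | u v. u \<in> F \<and> v \<in> F}"
  show "?B \<subseteq> Km" using F_sub_Km Km_elems(3) K.F_add K.F_mult by blast
  have I: "u + v * x2 \<in> ?B" if "u \<in> F" "v \<in> F" for u v using that by blast
  have FB: "u \<in> ?B" if "u \<in> F" for u using I[OF that F.F_0] by simp
  have "Km \<subseteq> adjoin {x1, y1, x2, y2}" by (rule Km_sub[OF adjoin_incl])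
  also have "\<dots> \<subseteq> ?B"
  proof (rule adjoin_minimal)
    have "x2 \<in> ?B" using I[OF F.F_0 F.F_1] by simp
    then show "{x1, y1, x2, y2} \<subseteq> ?B" using FB F_elems by simp
    show "to_ac c \<in> ?B" for c by (rule FB[OF adjoin_base])
    show "1 \<in> ?B" by (rule FB[OF F.F_1])
    fix a assume "a \<in> ?B"
    then obtain u v where uv: "a = u + v * x2" "u \<in> F" "v \<in> F" by blast
    have "- a = - u + (- v) * x2" unfolding uv by simp
    then show "- a \<in> ?B" using I[OF F.F_uminus[OF uv(2)] F.F_uminus[OF uv(3)]] by simp
    show "inverse a \<in> ?B" if "a \<noteq> 0"
    proof -
      \<comment> \<open>The norm of \<open>a\<close>, its product with the conjugate u + v r, which
        serves to invert \<open>a\<close>.\<close>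
      define n where "n = u ^ 2 + u * v * (x2 + r) + v ^ 2 * (x2 * r)"
      have nF': "n \<in> F" unfolding n_def by (intro F.F_add F.F_mult F.F_power uv r)
      have n: "n = a * (u + v * r)" unfolding n_def uv(1) by Groebner_Basis.algebra
      have wnz: "u + v * r \<noteq> 0"
      proof
        assume z: "u + v * r = 0"
        show False
        proof (cases "v = 0")
          case True
          then show False using z that uv(1) by simp
        next
          case False
          then have "r = - u / v" using z by (simp add: field_simps add_eq_0_iff2)
          then have "r \<in> F" using F.F_divide[OF F.F_uminus[OF uv(2)] uv(3)] by simp
          then have "x2 + r - r \<in> F" using r(1) F.F_diff by blast
          then show False using nF by simp
        qed
      qed
      then have "inverse a = (u + v * r) / n" unfolding n by (simp add: inverse_eq_divide)
      also have "\<dots> = (u + v * (x2 + r)) / n + (- v / n) * x2" by (simp add: add_divide_distrib diff_divide_distrib algebra_simps)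
      finally show ?thesis
        using I[of "(u + v * (x2 + r)) / n" "- v / n"] uv r nF' F.F_divide F.F_add F.F_mult F.F_uminus by simp
    qed
    fix b assume "b \<in> ?B"
    then obtain u' v' where uv': "b = u' + v' * x2" "u' \<in> F" "v' \<in> F" by blast
    have "a + b = (u + u') + (v + v') * x2" unfolding uv uv' by (simp add: algebra_simps)
    then show "a + b \<in> ?B" using I[OF F.F_add[OF uv(2) uv'(2)] F.F_add[OF uv(3) uv'(3)]] by simp
    have "a * b = (u * u' - v * v' * (x2 * r)) + (u * v' + v * u' + v * v' * (x2 + r)) * x2"
      unfolding uv uv' by Groebner_Basis.algebra
    moreover have "u * u' - v * v' * (x2 * r) \<in> F" "u * v' + v * u' + v * v' * (x2 + r) \<in> F"
      by (intro F.F_diff F.F_add F.F_mult uv uv' r)+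
    ultimately show "a * b \<in> ?B" using I by simp
  qed
  finally show "Km \<subseteq> ?B" .
qed

text \<open>\<open>dimension\<close> counts line extensions: \<open>F\<close> is the line through 1,
  and adjoining the line through \<open>x2\<close>, which lies outside \<open>F\<close>, gives
  \<open>Km\<close>.\<close>

lemma dimension_Km:
  assumes "x2 \<notin> F" "x2 + r \<in> F" "x2 * r \<in> F"
  shows "ring.dimension closure_ring 2 F Km"
proof -
  interpret cring closure_ring by (rule cring_from_type_algebra)
  have le: "line_extension K a A = {k * a + v | k v. k \<in> K \<and> v \<in> A}" for K a A
    using line_extension_mem_iff[of _ K a A] by auto
  have "dimension (Suc 0) F (line_extension F 1 {0})"
    using Suc_dim[of 1 "{0}" 0 F] zero_dim[of F] by simp
  moreover have "line_extension F 1 {0} = F" unfolding le by auto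
  ultimately have "dimension (Suc 0) F F" by simp
  then have "dimension (Suc (Suc 0)) F (line_extension F x2 F)" using assms(1) by (intro Suc_dim) simp_all
  moreover have "line_extension F x2 F = Km"
    unfolding le Km_quadratic[OF assms] by (auto, metis add.commute, metis add.commute)
  ultimately show ?thesis by (simp add: numeral_2_eq_2)
qed

lemma galois_groupD:
  assumes "\<rho> \<in> carrier (galois_group Km F)"
  shows "\<rho> \<in> Bij Km" "a \<in> Km \<Longrightarrow> b \<in> Km \<Longrightarrow> \<rho> (a + b) = \<rho> a + \<rho> b"
    "a \<in> Km \<Longrightarrow> b \<in> Km \<Longrightarrow> \<rho> (a * b) = \<rho> a * \<rho> b" "a \<in> F \<Longrightarrow> \<rho> a = a" "\<rho> \<in> extensional Km"
  using assms by (auto simp: galois_group_def ring_iso_def ring_hom_def Bij_def)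

lemma galois_group_eqI:
  assumes "x2 \<notin> F" "x2 + r \<in> F" "x2 * r \<in> F"
    and \<rho>: "\<rho> \<in> carrier (galois_group Km F)" "\<rho>' \<in> carrier (galois_group Km F)" "\<rho> x2 = \<rho>' x2"
  shows "\<rho> = \<rho>'"
proof (rule extensionalityI)
  show "\<rho> \<in> extensional Km" "\<rho>' \<in> extensional Km" using galois_groupD(5) \<rho> by blast+
  fix z assume "z \<in> Km"
  then obtain u v where z: "z = u + v * x2" "u \<in> F" "v \<in> F" unfolding Km_quadratic[OF assms(1-3)] by blast
  have mem: "u \<in> Km" "v \<in> Km" "v * x2 \<in> Km" using F_sub_Km z Km_elems(3) K.F_mult by auto
  have val: "\<rho> z = u + v * \<rho> x2" if "\<rho> \<in> carrier (galois_group Km F)" for \<rho>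
    unfolding z(1) using galois_groupD[OF that] mem z Km_elems(3) by simp
  show "\<rho> z = \<rho>' z" using val[OF \<rho>(1)] val[OF \<rho>(2)] \<rho>(3) by simp
qed

text \<open>\<open>\<sigma>\<close> fixes x2 + r and therefore swaps the two roots; its restriction
  is an involution of \<open>Km\<close>. An automorphism over \<open>F\<close> is determined by its
  value at \<open>x2\<close>, which can only be one of the two roots.\<close>

lemma galois_group_quadratic:
  assumes nF: "x2 \<notin> F" and r: "r \<noteq> x2" "x2 + r \<in> F" "x2 * r \<in> F"
    and \<sigma>: "field_auto \<sigma> \<tau>" "\<And>a. a \<in> F \<Longrightarrow> \<sigma> a = a" "\<sigma> x2 = r"
  defines "\<rho> \<equiv> restrict \<sigma> Km" and "G \<equiv> galois_group Km F"
  shows "\<rho> \<in> carrier G" "\<rho> x2 = r" "generate G {\<rho>} = carrier G"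
    "{\<rho>' \<in> carrier G. \<rho>' x2 = r} = {\<rho>}"
proof -
  interpret s: field_auto \<sigma> \<tau> by (rule \<sigma>(1))
  note Km = Km_quadratic[OF nF r(2,3)]
  have rK: "r \<in> Km"
  proof -
    have "x2 + r - x2 \<in> Km" using F_sub_Km r(2) Km_elems(3) K.F_diff by blast
    then show ?thesis by simp
  qed
  have \<sigma>r: "\<sigma> r = x2"
  proof -
    have "\<sigma> x2 + \<sigma> r = x2 + r" using \<sigma>(2)[OF r(2)] by (simp add: s.h.add)
    then show ?thesis using \<sigma>(3) by simp
  qed
  have val: "\<sigma> (u + v * x2) = u + v * r" "\<sigma> (u + v * r) = u + v * x2" if "u \<in> F" "v \<in> F" for u v
    using that \<sigma>(2,3) \<sigma>r by (simp_all add: s.h.simps)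
  have maps: "\<sigma> z \<in> Km" if z: "z \<in> Km" for z
  proof -
    obtain u v where uv: "z = u + v * x2" "u \<in> F" "v \<in> F" using z unfolding Km by blast
    have "u \<in> Km" "v \<in> Km" using uv F_sub_Km by blast+
    then have "u + v * r \<in> Km" by (intro K.F_add K.F_mult rK)
    then show ?thesis using val(1)[OF uv(2,3)] uv(1) by simp
  qed
  have invol: "\<sigma> (\<sigma> z) = z" if z: "z \<in> Km" for z
  proof -
    obtain u v where "z = u + v * x2" "u \<in> F" "v \<in> F" using z unfolding Km by blast
    then show ?thesis using val by simp
  qed
  have bij: "bij_betw \<rho> Km Km"
    by (rule bij_betw_byWitness[of _ \<rho>]) (auto simp: \<rho>_def maps invol)
  have \<rho>B: "\<rho> \<in> Bij Km" using bij by (simp add: Bij_def \<rho>_def)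
  show \<rho>G: "\<rho> \<in> carrier G"
    using \<rho>B bij maps \<sigma>(2) F_sub_Km K.F_add K.F_mult K.F_1
    by (auto simp: G_def galois_group_def ring_iso_def ring_hom_def \<rho>_def s.h.simps)
  show \<rho>x: "\<rho> x2 = r" using Km_elems(3) \<sigma>(3) by (simp add: \<rho>_def)
  note eqI = galois_group_eqI[OF nF r(2,3), folded G_def]
  show A: "{\<rho>' \<in> carrier G. \<rho>' x2 = r} = {\<rho>}" using \<rho>G \<rho>x eqI by auto
  interpret B: group "BijGroup Km" by (rule group_BijGroup)
  have one: "one (BijGroup Km) = (\<lambda>z\<in>Km. z)" by (simp add: BijGroup_def)
  have oneG: "(\<lambda>z\<in>Km. z) \<in> carrier G"
    using F_sub_Km K.F_add K.F_mult K.F_1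
    by (auto simp: G_def galois_group_def ring_iso_def ring_hom_def id_Bij bij_betw_def inj_on_def)
  have car: "carrier G = {\<lambda>z\<in>Km. z, \<rho>}"
  proof (intro equalityI subsetI)
    fix \<kappa> assume \<kappa>: "\<kappa> \<in> carrier G"
    note D = galois_groupD[OF \<kappa>[unfolded G_def]]
    have K2: "x2 * x2 \<in> Km" "x2 + r \<in> Km" "x2 * r \<in> Km" using F_sub_Km r Km_elems(3) K.F_mult by auto
    \<comment> \<open>Applies \<open>\<kappa>\<close> to x2^2 + x2 r = x2 (x2 + r), so that the
      image of \<open>x2\<close> satisfies the same quadratic equation.\<close>
    have "\<kappa> x2 * \<kappa> x2 + x2 * r = \<kappa> (x2 * x2 + x2 * r)"
      using D(2)[OF K2(1,3)] D(3)[OF Km_elems(3) Km_elems(3)] D(4)[OF r(3)] by simp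
    also have "\<dots> = \<kappa> (x2 * (x2 + r))" by (simp add: algebra_simps)
    also have "\<dots> = \<kappa> x2 * (x2 + r)" using D(3)[OF Km_elems(3) K2(2)] D(4)[OF r(2)] by simp
    finally have "(\<kappa> x2 - x2) * (\<kappa> x2 - r) = 0" by Groebner_Basis.algebra
    then have "\<kappa> x2 = x2 \<or> \<kappa> x2 = r" by simp
    then show "\<kappa> \<in> {\<lambda>z\<in>Km. z, \<rho>}"
      using eqI[OF \<kappa> \<rho>G] eqI[OF \<kappa> oneG] \<rho>x Km_elems(3) by auto
  qed (use \<rho>G oneG in auto)
  have mult: "\<rho> \<otimes>\<^bsub>BijGroup Km\<^esub> \<rho> = (\<lambda>z\<in>Km. z)"
    using \<rho>B maps invol by (auto simp: BijGroup_def compose_def \<rho>_def restrict_def)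
  have inv: "m_inv (BijGroup Km) \<rho> = \<rho>"
    by (rule B.inv_equality) (use mult one \<rho>B in \<open>simp_all add: BijGroup_def\<close>)
  have sub: "subgroup (carrier G) (BijGroup Km)"
  proof (rule B.subgroupI)
    show "carrier G \<subseteq> carrier (BijGroup Km)" by (auto simp: G_def galois_group_def BijGroup_def)
    then have cl: "\<kappa> \<in> carrier (BijGroup Km)" if "\<kappa> \<in> carrier G" for \<kappa> using that by blast
    show "carrier G \<noteq> {}" using \<rho>G by blast
    have o: "\<kappa> = one (BijGroup Km) \<or> \<kappa> = \<rho>" if "\<kappa> \<in> carrier G" for \<kappa> using that unfolding car one by blast
    show "m_inv (BijGroup Km) \<kappa> \<in> carrier G" if "\<kappa> \<in> carrier G" for \<kappa>
      using o[OF that]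
    proof
      assume "\<kappa> = one (BijGroup Km)"
      then show ?thesis using oneG unfolding one[symmetric] by (simp only: B.inv_one)
    qed (use inv \<rho>G in simp)
    show "\<kappa> \<otimes>\<^bsub>BijGroup Km\<^esub> \<kappa>' \<in> carrier G" if "\<kappa> \<in> carrier G" "\<kappa>' \<in> carrier G" for \<kappa> \<kappa>'
      using o[OF that(1)]
    proof
      assume "\<kappa> = one (BijGroup Km)"
      then show ?thesis using B.l_one[OF cl[OF that(2)]] that(2) by (simp only:)
    next
      assume k: "\<kappa> = \<rho>"
      show ?thesis using o[OF that(2)]
      proof
        assume "\<kappa>' = one (BijGroup Km)"
        then show ?thesis using B.r_one[OF cl[OF that(1)]] that(1) by (simp only:)
      qed (use mult k oneG in simp)
    qed
  qed
  have GB: "G = (BijGroup Km)\<lparr>carrier := carrier G\<rparr>" by (simp add: G_def galois_group_def)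
  have "group G" using B.subgroup_imp_group[OF sub] GB by simp
  then have "generate G {\<rho>} \<subseteq> carrier G" using \<rho>G group.generate_incl[of G "{\<rho>}"] by simp
  moreover have "carrier G \<subseteq> generate G {\<rho>}"
  proof -
    have "one G = (\<lambda>z\<in>Km. z)" using GB one by (metis monoid.simps(2) monoid.surjective monoid.update_convs(1) partial_object.update_convs(1))
    then show ?thesis unfolding car using generate.one[of G "{\<rho>}"] generate.incl[of \<rho> "{\<rho>}" G] by auto
  qed
  ultimately show "generate G {\<rho>} = carrier G" by blast
qed

text \<open>The third point of the line through P2 and its conjugate has abscissa \<open>s\<close>
  in \<open>F\<close>, so 2 P2 + (m/2) P1 = -(s, y2) shows that 2 P2 is defined over
  \<open>F\<close>. A point of E[m/2] is a combination of P1 and 2 P2.\<close>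

lemma half_torsion_over_F:
  assumes "even m" "x2 \<notin> F" "r \<noteq> x2" "Affine r y2 = ec_mult C (m div 2) pt1 \<boxplus> pt2" "x2 + r \<in> F" "x2 * r \<in> F"
  shows "torsion_field E (m div 2) \<subseteq> F"
proof -
  define s where "s = - a2 - (x2 + r)"
  have sF: "s \<in> F" unfolding s_def by (intro F.F_diff F.F_uminus C_coeffs assms)
  have R: "on_curve C (Affine r y2)" using assms(4) P1 P2 by simp
  have "r \<notin> F"
  proof
    assume "r \<in> F"
    then have "x2 + r - r \<in> F" using assms(5) F.F_diff by blast
    then show False using assms(2) by simp
  qed
  have S: "on_curve C (Affine s y2)"
  proof -
    have "(x2 - r) * (x2 ^ 2 + x2 * r + r ^ 2 + a2 * (x2 + r) + a4 - a1 * y2) = 0"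
      using P2(1) R unfolding on_curve.simps by Groebner_Basis.algebra
    then have "x2 ^ 2 + x2 * r + r ^ 2 + a2 * (x2 + r) + a4 - a1 * y2 = 0" using assms(3) by simp
    then show ?thesis using P2(1) unfolding on_curve.simps s_def by Groebner_Basis.algebra
  qed
  have "pt2 \<boxplus> Affine r y2 = neg (Affine s y2)"
    using R S P2(1) assms(2,3) \<open>r \<notin> F\<close> sF by (intro collinear_distinct) auto
  moreover have "ec_mult C 2 pt2 \<boxplus> ec_mult C (m div 2) pt1 = pt2 \<boxplus> Affine r y2"
  proof -
    have h: "on_curve C (ec_mult C (m div 2) pt1)" by (rule on_curve_mult[OF P1(1)])
    have "ec_mult C 2 pt2 = pt2 \<boxplus> pt2" by (simp only: numeral_2_eq_2 ec_mult_Suc ec_mult_0 pt_add_Infinity)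
    then show ?thesis
      by (simp only: assms(4) pt_add_assoc[OF P2(1) P2(1) h] pt_add_commute[OF h P2(1)])
  qed
  ultimately have sum: "ec_mult C 2 pt2 \<boxplus> ec_mult C (m div 2) pt1 = neg (Affine s y2)" by (simp only:)
  have h1: "set_point (ec_mult C (m div 2) pt1) \<subseteq> F"
    using F.point_mult_over_F[OF C_coeffs] F_elems by simp
  have "ec_mult C 2 pt2 = neg (Affine s y2) \<boxplus> neg (ec_mult C (m div 2) pt1)"
    unfolding sum[symmetric] using add_neg_cancel(1) P1 P2 by simp
  moreover have "set_point (neg (Affine s y2)) \<subseteq> F"
    using F.point_neg_over_F[OF C_coeffs(1,3), of "Affine s y2"] sF F_elems by simp
  moreover have "set_point (neg (ec_mult C (m div 2) pt1)) \<subseteq> F"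
    by (rule F.point_neg_over_F[OF C_coeffs(1,3) h1])
  ultimately have two: "set_point (ec_mult C 2 pt2) \<subseteq> F"
    using F.point_add_over_F[OF C_coeffs] by simp
  have "set_point Q \<subseteq> F" if Q: "Q \<in> torsion E (m div 2)" for Q
  proof -
    have Q': "on_curve C Q" "ec_mult C (m div 2) Q = Infinity" using Q by (simp_all add: torsion_def)
    have "ec_mult C (2 * (m div 2)) Q = Infinity" using Q' by (simp only: ec_mult_mult ec_mult_Infinity)
    then have "ec_mult C m Q = Infinity" using assms(1) by simp
    then obtain a b where ab: "Q = ec_mult C a pt1 \<boxplus> ec_mult C b pt2" using generate Q'(1) by blast
    \<comment> \<open>Independence makes m divide (m/2) b, so the coefficient \<open>b\<close> of P2
      is even.\<close>
    have "ec_mult C (m div 2 * a) pt1 \<boxplus> ec_mult C (m div 2 * b) pt2 = Infinity"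
      using Q'(2) P1 P2 unfolding ab by (simp add: ec_mult_distrib ec_mult_mult)
    then have "m dvd m div 2 * b" using independent by blast
    then have "m div 2 * 2 dvd m div 2 * b" using assms(1) by simp
    moreover have "m div 2 \<noteq> 0" using m4 by simp
    ultimately have "2 dvd b" by simp
    then obtain k where "b = k * 2" by (metis dvd_div_mult_self)
    then have "Q = ec_mult C a pt1 \<boxplus> ec_mult C k (ec_mult C 2 pt2)" using ab P2 by (simp only: ec_mult_mult)
    then show ?thesis
      using F.point_add_over_F[OF C_coeffs F.point_mult_over_F[OF C_coeffs] F.point_mult_over_F[OF C_coeffs two]] F_elems
      by simp
  qed
  then have "coordinates (torsion E (m div 2)) \<subseteq> F" unfolding coordinates_def by blast
  then show ?thesis unfolding torsion_field_def by (rule adjoin_subset_adjoin)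
qed

lemma half_torsion_over_Km:
  assumes "even m" shows "torsion_field E (m div 2) \<subseteq> Km"
proof -
  have "torsion E (m div 2) \<subseteq> torsion E m"
  proof
    fix Q assume "Q \<in> torsion E (m div 2)"
    then have Q': "on_curve C Q" "ec_mult C (m div 2) Q = Infinity" by (simp_all add: torsion_def)
    have "ec_mult C (2 * (m div 2)) Q = Infinity" using Q' by (simp only: ec_mult_mult ec_mult_Infinity)
    then show "Q \<in> torsion E m" using assms Q' by (simp add: torsion_def)
  qed
  then have "coordinates (torsion E (m div 2)) \<subseteq> coordinates (torsion E m)" unfolding coordinates_def by blast
  then have "coordinates (torsion E (m div 2)) \<subseteq> adjoin (coordinates (torsion E m))" using adjoin_incl by (rule order.trans)
  then show ?thesis unfolding torsion_field_def by (rule adjoin_subset_adjoin)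
qed

lemma half_P1: "ec_mult C (m div 2) pt1 \<boxplus> pt2 \<noteq> pt2" if "even m"
proof
  assume "ec_mult C (m div 2) pt1 \<boxplus> pt2 = pt2"
  then have "ec_mult C (m div 2) pt1 \<boxplus> pt2 \<boxplus> neg pt2 = pt2 \<boxplus> neg pt2" by (rule arg_cong)
  then have "ec_mult C (m div 2) pt1 = Infinity"
    using add_neg_cancel(1)[of "ec_mult C (m div 2) pt1" pt2] pt_add_neg P1 P2 by simp
  then have "ec_mult C (m div 2) pt1 \<boxplus> ec_mult C 0 pt2 = Infinity" by simp
  then have "m dvd m div 2" using independent by blast
  then show False using m4 by (auto dest: dvd_imp_le)
qed

lemma main_statement:
  "(odd m \<longrightarrow> Km = F) \<and>
    (even m \<longrightarrow>
      (let G = galois_group Km F;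
           A = {\<sigma> \<in> carrier G. map_point \<sigma> pt2 = ec_add C (ec_mult C (m div 2) pt1) pt2}
       in Km \<noteq> F \<longleftrightarrow> ring.dimension closure_ring 2 F Km \<and>
            (\<exists>\<sigma>. A = {\<sigma>} \<and> generate G {\<sigma>} = carrier G))) \<and>
    (even m \<longrightarrow> torsion_field E (m div 2) \<subseteq> F)"
proof (cases "x2 \<in> F")
  case True
  then have KF: "Km = F" using Km_eq_F_iff by blast
  \<comment> \<open>If \<open>Km = F\<close>, every element of the group fixes P2, so the set
    \<open>A\<close> is empty and the right-hand side of the equivalence fails together with the
    left.\<close>
  have "map_point \<sigma> pt2 \<noteq> ec_add C (ec_mult C (m div 2) pt1) pt2"
    if "even m" "\<sigma> \<in> carrier (galois_group Km F)" for \<sigma>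
    using galois_groupD(4)[OF that(2)] True F_elems half_P1[OF that(1)] by simp
  then have "{\<sigma> \<in> carrier (galois_group Km F). map_point \<sigma> pt2 = ec_add C (ec_mult C (m div 2) pt1) pt2} = {}"
    if "even m" using that by blast
  then show ?thesis using KF half_torsion_over_Km unfolding Let_def by auto
next
  case False
  then have KF: "Km \<noteq> F" using Km_eq_F_iff by blast
  obtain r \<sigma> \<tau> where r: "even m" "r \<noteq> x2" "Affine r y2 = ec_mult C (m div 2) pt1 \<boxplus> pt2"
    "x2 + r \<in> F" "x2 * r \<in> F" "field_auto \<sigma> \<tau>" "\<And>a. a \<in> F \<Longrightarrow> \<sigma> a = a" "\<sigma> x2 = r"
    using x2_cases[OF False] by blast
  note gal = galois_group_quadratic[OF False r(2,4,5,6,7,8)]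
  have "{\<rho> \<in> carrier (galois_group Km F). map_point \<rho> pt2 = ec_add C (ec_mult C (m div 2) pt1) pt2} =
      {\<rho> \<in> carrier (galois_group Km F). \<rho> x2 = r}"
    unfolding r(3)[symmetric] using galois_groupD(4) F_elems(4) by auto
  then show ?thesis
    using KF r(1) gal(3,4) dimension_Km[OF False r(4,5)] half_torsion_over_F[OF r(1) False r(2,3,4,5)]
    unfolding Let_def by auto
qed

end

theorem theorem3p1:
  fixes E :: "'k::field weierstrass"
    and m :: nat
    and x1 y1 x2 y2 \<zeta> :: "'k alg_closure"
    and P1 P2 :: "'k alg_closure point"
    and Km F :: "'k alg_closure set"
  assumes "elliptic_curve E"
    and "m \<ge> 4"
    and "CHAR('k) > 0 \<Longrightarrow> coprime m CHAR('k)"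
    and "P1 = Affine x1 y1"
    and "P2 = Affine x2 y2"
    and "torsion_basis E m P1 P2"
    and "\<zeta> = weil_pairing (base_change E) m P1 P2"
    and "Km = torsion_field E m"
    and "F = adjoin {x1, \<zeta>, y1, y2}"
  shows "(odd m \<longrightarrow> Km = F) \<and>
    (even m \<longrightarrow>
      (let G = galois_group Km F;
           A = {\<sigma> \<in> carrier G.
                  map_point \<sigma> P2 = ec_add (base_change E) (ec_mult (base_change E) (m div 2) P1) P2}
       in Km \<noteq> F \<longleftrightarrow>
            ring.dimension closure_ring 2 F Km \<and>
            (\<exists>\<sigma>. A = {\<sigma>} \<and> generate G {\<sigma>} = carrier G))) \<and>
    (even m \<longrightarrow> torsion_field E (m div 2) \<subseteq> F)"
proof -
  interpret torsion_setup E m x1 y1 x2 y2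
    using assms by unfold_locales simp_all
  show ?thesis using main_statement unfolding assms(4,5,7,8,9) .
qed

end
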